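(* There exists no separating polynomial $P\in\mathbb{C}\langle X_4\rangle$ with $\deg P\le 50$ for the concrete magic unitary $M=(M_{ij})\in M_4(A\otimes A\otimes A)$ defined in the context. That is, if $P\in\mathbb{C}\langle X_4\rangle$ is a non-commutative polynomial with $\deg P\le 50$ and $P(M)=0$ (where $P(M)$ is obtained by substituting $M_{ij}$ for $x_{ij}$), then $P\in I_4$.
   Context: Let $A=C^*(p,q\mid p^2=p^*=p,\ q^2=q^*=q)$ be the universal unital $C^*$-algebra generated by two projections $p,q$ (so $A\cong C^*(\mathbb{Z}_2*\mathbb{Z}_2)$). Put $$R=\begin{pmatrix} p&0&1-p&0\\ 1-p&0&p&0\\ 0&q&0&1-q\\ 0&1-q&0&q\end{pmatrix}\in M_4(A),$$ and let $M\in M_4(A\otimes A\otimes A)$ be given by $M_{ij}=\sum_{k,l=1}^4 R_{ik}\otimes R_{kl}\otimes R_{lj}$ (each entry of $M$ is a projection and every row and column of $M$ sums to $1$, i.e. $M$ is a magic unitary). For $n\in\mathbb{N}$ let $X_n=\{x_{ij}: 1\le i,j\le n\}$ and let $\mathbb{C}\langle X_n\rangle$ be the free unital associative algebra on $X_n$ (non-commutative polynomials); the degree of a monomial is its word length and $\deg P$ is the maximal degree of a monomial occurring in $P$. The magic unitary ideal $I_n\subseteq\mathbb{C}\langle X_n\rangle$ is the two-sided ideal generated by $x_{ij}^2-x_{ij}$, $\sum_{k=1}^n x_{ik}-1$, $\sum_{k=1}^n x_{kj}-1$ for $1\le i,j\le n$, and $x_{ij}x_{ik}$, $x_{ji}x_{ki}$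 for $1\le i,j,k\le n$, $j\ne k$. For a magic unitary $M\in M_n(D)$ over a unital $C^*$-algebra $D$, a non-zero $P\in\mathbb{C}\langle X_n\rangle$ is called separating for $M$ if $\varphi_M(P)=0$ but $P\notin I_n$, where $\varphi_M:\mathbb{C}\langle X_n\rangle\to D$ is the unital algebra homomorphism with $x_{ij}\mapsto M_{ij}$. *)

theory Defs
  imports "HOL-Analysis.Analysis" "HOL-Library.Poly_Mapping"
begin

text \<open>
  Unital complex \<^emph>\<open>*\<close>-algebras and unital \<open>C\<^sup>*\<close>-algebras. The zero algebra is allowed, so neither
  \<^class>\<open>ring_1\<close> nor \<^class>\<open>real_normed_algebra_1\<close> can be used as a superclass.
\<close>

class complex_star_algebra = ring + monoid_mult +
  fixes scaleC :: "complex \<Rightarrow> 'a \<Rightarrow> 'a" (infixr "*\<^sub>C" 75)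
    and star :: "'a \<Rightarrow> 'a"
  assumes scaleC_add_right: "c *\<^sub>C (x + y) = c *\<^sub>C x + c *\<^sub>C y"
    and scaleC_add_left: "(c + d) *\<^sub>C x = c *\<^sub>C x + d *\<^sub>C x"
    and scaleC_scaleC: "c *\<^sub>C d *\<^sub>C x = (c * d) *\<^sub>C x"
    and scaleC_one: "1 *\<^sub>C x = x"
    and mult_scaleC_left: "c *\<^sub>C x * y = c *\<^sub>C (x * y)"
    and mult_scaleC_right: "x * c *\<^sub>C y = c *\<^sub>C (x * y)"
    and star_star: "star (star x) = x"
    and star_add: "star (x + y) = star x + star y"
    and star_scaleC: "star (c *\<^sub>C x) = cnj c *\<^sub>C star x"
    and star_mult: "star (x * y) = star y * star x"

definition (in complex_star_algebra) cstar_seminorm :: "('a \<Rightarrow> real) \<Rightarrow> bool"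
  where "cstar_seminorm s \<longleftrightarrow>
    (\<forall>x y. s (x + y) \<le> s x + s y) \<and>
    (\<forall>c x. s (c *\<^sub>C x) = cmod c * s x) \<and>
    (\<forall>x y. s (x * y) \<le> s x * s y) \<and>
    (\<forall>x. s (star x * x) = (s x)\<^sup>2)"

class cstar_algebra = complex_star_algebra + real_normed_algebra + banach +
  assumes scaleR_eq_scaleC: "r *\<^sub>R x = complex_of_real r *\<^sub>C x"
    and norm_scaleC: "norm (c *\<^sub>C x) = cmod c * norm x"
    and cstar_identity: "norm (star x * x) = (norm x)\<^sup>2"

text \<open>
  A \<^emph>\<open>*\<close>-algebra has an enveloping \<open>C\<^sup>*\<close>-algebra if the \<open>C\<^sup>*\<close>-seminorms are bounded at each element.
  The enveloping \<open>C\<^sup>*\<close>-algebra is then the Hausdorff completion with respect to the largest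
  \<open>C\<^sup>*\<close>-seminorm. If the \<^emph>\<open>*\<close>-algebra is given by generators and relations, this is the universal
  \<open>C\<^sup>*\<close>-algebra on these generators and relations, since \<open>C\<^sup>*\<close>-seminorms are exactly the functions
  \<open>x \<mapsto> \<parallel>\<pi> x\<parallel>\<close> for \<^emph>\<open>*\<close>-homomorphisms \<open>\<pi>\<close> into \<open>C\<^sup>*\<close>-algebras.
\<close>

class enveloped_star_algebra = complex_star_algebra +
  assumes bounded_seminorms: "\<exists>K. \<forall>s. cstar_seminorm s \<longrightarrow> s x \<le> K"

lemma real_idempotent_le_one: "r * r = r \<Longrightarrow> r \<le> (1::real)"
  by (metis mult_cancel_left1 order_refl zero_le_one)

context complex_star_algebra
begin

lemma scaleC_0_left: "0 *\<^sub>C x = 0"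
  using scaleC_add_left[of 0 0 x] by simp

lemma scaleC_0_right: "c *\<^sub>C 0 = 0"
  using scaleC_add_right[of c 0 0] by simp

lemma scaleC_minus_one: "(-1) *\<^sub>C x = - x"
  using scaleC_add_left[of "-1" 1 x] by (simp add: scaleC_0_left scaleC_one eq_neg_iff_add_eq_0)

lemma scaleC_minus_right: "c *\<^sub>C (- x) = - (c *\<^sub>C x)"
  using scaleC_add_right[of c x "-x"] by (simp add: scaleC_0_right eq_neg_iff_add_eq_0 add.commute)

lemma scaleC_diff_right: "c *\<^sub>C (x - y) = c *\<^sub>C x - c *\<^sub>C y"
  using scaleC_add_right[of c x "-y"] by (simp add: scaleC_minus_right)

lemma star_0: "star 0 = 0"
  using star_add[of 0 0] by simp

lemma star_1: "star 1 = 1"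
  using star_mult[of "star 1" 1] by (simp add: star_star)

lemma star_minus: "star (- x) = - star x"
  using star_add[of "-x" x] by (simp add: star_0 eq_neg_iff_add_eq_0)

lemma star_diff: "star (x - y) = star x - star y"
  using star_add[of x "-y"] by (simp add: star_minus)

lemma cstar_seminormD:
  assumes "cstar_seminorm s"
  shows "s (x + y) \<le> s x + s y" "s (c *\<^sub>C x) = cmod c * s x" "s (x * y) \<le> s x * s y"
    "s (star x * x) = (s x)\<^sup>2"
  using assms by (auto simp: cstar_seminorm_def)

lemma cstar_seminorm_0: "cstar_seminorm s \<Longrightarrow> s 0 = 0"
  using cstar_seminormD(2)[of s 0 0] by (simp add: scaleC_0_left)

lemma cstar_seminorm_minus: "cstar_seminorm s \<Longrightarrow> s (- x) = s x"
  using cstar_seminormD(2)[of s "-1" x] by (simp add: scaleC_minus_one)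

lemma cstar_seminorm_nonneg: "cstar_seminorm s \<Longrightarrow> 0 \<le> s x"
  using cstar_seminormD(1)[of s x "-x"] by (simp add: cstar_seminorm_0 cstar_seminorm_minus)

lemma cstar_seminorm_star:
  assumes s: "cstar_seminorm s" shows "s (star x) = s x"
proof -
  have *: "s x \<le> s (star x)" for x
  proof (cases "s x = 0")
    case True
    then show ?thesis using cstar_seminorm_nonneg[OF s] by simp
  next
    case False
    have "s x * s x \<le> s (star x) * s x"
      using cstar_seminormD(3)[OF s, of "star x" x]
      unfolding cstar_seminormD(4)[OF s] monoid_mult_class.power2_eq_square .
    with False cstar_seminorm_nonneg[OF s, of x] show ?thesis
      by (metis mult_le_cancel_right order_le_less)
  qed
  from *[of x] *[of "star x"] show ?thesis by (simp add: star_star)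
qed

lemma cstar_seminorm_zero: "cstar_seminorm (\<lambda>_. 0)"
  by (simp add: cstar_seminorm_def)

lemma cstar_seminorm_one_le: 
  assumes s: "cstar_seminorm s" shows "s 1 \<le> 1"
proof -
  have "s 1 * s 1 = s 1"
    using cstar_seminormD(4)[OF s, of 1] by (simp add: star_1 monoid_mult_class.power2_eq_square)
  then show ?thesis by (rule real_idempotent_le_one)
qed

end

definition env_norm :: "'a::complex_star_algebra \<Rightarrow> real"
  where "env_norm x = Sup {s x | s. cstar_seminorm s}"

lemma le_env_norm: "cstar_seminorm s \<Longrightarrow> s x \<le> env_norm x"
  for x :: "'a::enveloped_star_algebra"
proof -
  assume s: "cstar_seminorm s"
  obtain K where "\<And>s. cstar_seminorm s \<Longrightarrow> s x \<le> K"
    using bounded_seminorms by blast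
  then show ?thesis unfolding env_norm_def
    using s by (intro cSup_upper) (auto intro!: bdd_aboveI[of _ K])
qed

lemma env_norm_le:
  assumes "\<And>s. cstar_seminorm s \<Longrightarrow> s x \<le> K"
  shows "env_norm x \<le> K"
  unfolding env_norm_def using assms cstar_seminorm_zero by (intro cSup_least) auto

lemma cstar_seminorm_env_norm: "cstar_seminorm (env_norm :: 'a::enveloped_star_algebra \<Rightarrow> real)"
proof -
  have nn: "0 \<le> env_norm x" for x :: 'a
    using le_env_norm[OF cstar_seminorm_zero, of x] by simp
  have 1: "env_norm (x + y) \<le> env_norm x + env_norm y" for x y :: 'a
    by (rule env_norm_le) (rule order_trans[OF cstar_seminormD(1)], assumption, rule add_mono; rule le_env_norm)
  have 2: "env_norm (c *\<^sub>C x) \<le> cmod c * env_norm x" for c and x :: 'a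
    by (rule env_norm_le) (simp add: cstar_seminormD(2) le_env_norm mult_left_mono)
  have 3: "env_norm (c *\<^sub>C x) = cmod c * env_norm x" for c and x :: 'a
  proof (cases "c = 0")
    case True
    then show ?thesis using 2[of c x] nn[of "c *\<^sub>C x"] by simp
  next
    case False
    have "env_norm x = env_norm (inverse c *\<^sub>C c *\<^sub>C x)"
      using False by (simp add: scaleC_scaleC scaleC_one)
    also have "\<dots> \<le> inverse (cmod c) * env_norm (c *\<^sub>C x)"
      using 2 by (metis norm_inverse)
    finally have "cmod c * env_norm x \<le> env_norm (c *\<^sub>C x)"
      using False by (simp add: field_simps)
    with 2 show ?thesis by (meson order_antisym)
  qed
  have 4: "env_norm (x * y) \<le> env_norm x * env_norm y" for x y :: 'a
  proof (rule env_norm_le)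
    fix s :: "'a \<Rightarrow> real" assume s: "cstar_seminorm s"
    have "s (x * y) \<le> s x * s y" using cstar_seminormD(3) s by blast
    also have "\<dots> \<le> env_norm x * env_norm y"
      by (rule mult_mono[OF le_env_norm[OF s] le_env_norm[OF s] nn cstar_seminorm_nonneg[OF s]])
    finally show "s (x * y) \<le> env_norm x * env_norm y" .
  qed
  have 5: "env_norm (star x) \<le> env_norm x" for x :: 'a
    by (rule env_norm_le) (simp add: cstar_seminorm_star le_env_norm)
  have 6: "env_norm (star x * x) = (env_norm x)\<^sup>2" for x :: 'a
  proof (rule antisym)
    show "env_norm (star x * x) \<le> (env_norm x)\<^sup>2"
      using order_trans[OF 4[of "star x" x] mult_right_mono[OF 5[of x] nn[of x]]]
      by (simp add: power2_eq_square)
    have "env_norm x \<le> sqrt (env_norm (star x * x))"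
    proof (rule env_norm_le)
      fix s :: "'a \<Rightarrow> real" assume s: "cstar_seminorm s"
      have "(s x)\<^sup>2 \<le> env_norm (star x * x)"
        using le_env_norm[OF s, of "star x * x"] cstar_seminormD(4)[OF s] by simp
      then show "s x \<le> sqrt (env_norm (star x * x))"
        by (simp add: real_le_rsqrt)
    qed
    then have "(env_norm x)\<^sup>2 \<le> (sqrt (env_norm (star x * x)))\<^sup>2"
      using nn[of x] by (rule power_mono)
    then show "(env_norm x)\<^sup>2 \<le> env_norm (star x * x)"
      using nn by simp
  qed
  show ?thesis unfolding cstar_seminorm_def using 1 3 4 6 by blast
qed

lemmas env_norm_add = cstar_seminormD(1)[OF cstar_seminorm_env_norm]
  and env_norm_scaleC = cstar_seminormD(2)[OF cstar_seminorm_env_norm]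
  and env_norm_mult = cstar_seminormD(3)[OF cstar_seminorm_env_norm]
  and env_norm_cstar = cstar_seminormD(4)[OF cstar_seminorm_env_norm]
  and env_norm_0 = cstar_seminorm_0[OF cstar_seminorm_env_norm]
  and env_norm_minus = cstar_seminorm_minus[OF cstar_seminorm_env_norm]
  and env_norm_nonneg = cstar_seminorm_nonneg[OF cstar_seminorm_env_norm]
  and env_norm_star = cstar_seminorm_star[OF cstar_seminorm_env_norm]

lemma env_norm_diff_commute: "env_norm (x - y) = env_norm (y - x)"
  for x y :: "'a::enveloped_star_algebra"
  by (metis env_norm_minus minus_diff_eq)

lemma env_norm_triangle: "env_norm (x - z) \<le> env_norm (x - y) + env_norm (y - z)"
  for x y z :: "'a::enveloped_star_algebra"
  using env_norm_add[of "x - y" "y - z"] by simp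

lemma env_norm_abs_diff: "\<bar>env_norm x - env_norm y\<bar> \<le> env_norm (x - y)"
  for x y :: "'a::enveloped_star_algebra"
  using env_norm_add[of "x - y" y] env_norm_add[of "y - x" x] env_norm_diff_commute[of x y] by simp

definition env_Cauchy :: "(nat \<Rightarrow> 'a::complex_star_algebra) \<Rightarrow> bool"
  where "env_Cauchy X \<longleftrightarrow> (\<forall>e>0. \<exists>N. \<forall>m\<ge>N. \<forall>n\<ge>N. env_norm (X m - X n) < e)"

definition env_rel :: "(nat \<Rightarrow> 'a::complex_star_algebra) \<Rightarrow> (nat \<Rightarrow> 'a) \<Rightarrow> bool"
  where "env_rel X Y \<longleftrightarrow> env_Cauchy X \<and> env_Cauchy Y \<and> (\<lambda>n. env_norm (X n - Y n)) \<longlonglongrightarrow> 0"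

lemma env_Cauchy_const: "env_Cauchy (\<lambda>_. x)" for x :: "'a::enveloped_star_algebra"
  by (simp add: env_Cauchy_def env_norm_0)

lemma tendsto_0_le: 
  assumes "g \<longlonglongrightarrow> (0::real)" "\<And>n. 0 \<le> f n" "\<And>n. f n \<le> g n" shows "f \<longlonglongrightarrow> 0"
  by (rule tendsto_sandwich[OF _ _ tendsto_const assms(1)]) (use assms in auto)

lemma env_rel_refl: "env_rel X X \<longleftrightarrow> env_Cauchy X"
  for X :: "nat \<Rightarrow> 'a::enveloped_star_algebra"
  by (simp add: env_rel_def env_norm_0)

lemma env_rel_part_equivp: "part_equivp (env_rel :: (nat \<Rightarrow> 'a::enveloped_star_algebra) \<Rightarrow> _)"
proof (rule part_equivpI)
  show "\<exists>X :: nat \<Rightarrow> 'a. env_rel X X"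
    using env_Cauchy_const env_rel_refl by blast
  show "symp (env_rel :: (nat \<Rightarrow> 'a) \<Rightarrow> _)"
    by (auto simp: symp_def env_rel_def env_norm_diff_commute)
  show "transp (env_rel :: (nat \<Rightarrow> 'a) \<Rightarrow> _)"
  proof (rule transpI)
    fix X Y Z :: "nat \<Rightarrow> 'a"
    assume XY: "env_rel X Y" and YZ: "env_rel Y Z"
    then have "(\<lambda>n. env_norm (X n - Y n) + env_norm (Y n - Z n)) \<longlonglongrightarrow> 0"
      by (auto simp: env_rel_def intro!: tendsto_add_zero)
    then have "(\<lambda>n. env_norm (X n - Z n)) \<longlonglongrightarrow> 0"
      by (rule tendsto_0_le) (auto simp: env_norm_nonneg env_norm_triangle)
    with XY YZ show "env_rel X Z" by (simp add: env_rel_def)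
  qed
qed

quotient_type (overloaded) 'a cstar_envelope = "nat \<Rightarrow> 'a::enveloped_star_algebra" / partial: env_rel
  by (rule env_rel_part_equivp)

lemma env_Cauchy_bounded:
  assumes "env_Cauchy (X :: nat \<Rightarrow> 'a::enveloped_star_algebra)"
  obtains K where "0 < K" "\<And>n. env_norm (X n) \<le> K"
proof -
  obtain N where N: "\<And>m n. m \<ge> N \<Longrightarrow> n \<ge> N \<Longrightarrow> env_norm (X m - X n) < 1"
    using assms unfolding env_Cauchy_def by (meson zero_less_one)
  define K where "K = (\<Sum>n\<le>N. env_norm (X n)) + 1"
  have S: "env_norm (X n) \<le> (\<Sum>n\<le>N. env_norm (X n))" if "n \<le> N" for n
    using that by (intro member_le_sum) (auto simp: env_norm_nonneg)
  have "env_norm (X n) \<le> K" for n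
  proof (cases "n \<le> N")
    case True
    then show ?thesis using S[of n] by (simp add: K_def)
  next
    case False
    then have "env_norm (X n - X N) < 1" using N by simp
    with S[of N] env_norm_add[of "X n - X N" "X N"] show ?thesis by (simp add: K_def)
  qed
  moreover have "0 < K" using S[of N] env_norm_nonneg[of "X N"] by (simp add: K_def)
  ultimately show thesis using that by blast
qed

lemma env_Cauchy_imp_Cauchy:
  assumes "env_Cauchy (X :: nat \<Rightarrow> 'a::enveloped_star_algebra)"
  shows "convergent (\<lambda>n. env_norm (X n))"
proof -
  have "Cauchy (\<lambda>n. env_norm (X n))"
    unfolding Cauchy_def dist_real_def
    using assms env_norm_abs_diff unfolding env_Cauchy_def by (meson order_le_less_trans)
  then show ?thesis by (rule Cauchy_convergent)
qed

lemma env_Cauchy_add: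
  assumes "env_Cauchy X" "env_Cauchy (Y :: nat \<Rightarrow> 'a::enveloped_star_algebra)"
  shows "env_Cauchy (\<lambda>n. X n + Y n)"
  unfolding env_Cauchy_def
proof (intro allI impI)
  fix e :: real assume "0 < e"
  then have e: "0 < e / 2" by simp
  obtain M N where "\<forall>m\<ge>M. \<forall>n\<ge>M. env_norm (X m - X n) < e / 2"
    "\<forall>m\<ge>N. \<forall>n\<ge>N. env_norm (Y m - Y n) < e / 2"
    using assms e unfolding env_Cauchy_def by blast
  moreover have "env_norm (X m + Y m - (X n + Y n)) \<le> env_norm (X m - X n) + env_norm (Y m - Y n)" for m n
    using env_norm_add[of "X m - X n" "Y m - Y n"] by (simp add: algebra_simps)
  ultimately have "\<forall>m\<ge>max M N. \<forall>n\<ge>max M N. env_norm (X m + Y m - (X n + Y n)) < e"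
    by (smt (verit) max.bounded_iff field_sum_of_halves)
  then show "\<exists>N. \<forall>m\<ge>N. \<forall>n\<ge>N. env_norm (X m + Y m - (X n + Y n)) < e" ..
qed

lemma env_Cauchy_lipschitz:
  assumes X: "env_Cauchy (X :: nat \<Rightarrow> 'a::enveloped_star_algebra)"
    and f: "\<And>m n. env_norm (Y m - Y n :: 'a) \<le> K * env_norm (X m - X n)"
  shows "env_Cauchy Y"
  unfolding env_Cauchy_def
proof (intro allI impI)
  fix e :: real assume "0 < e"
  define L where "L = \<bar>K\<bar> + 1"
  have f': "env_norm (Y m - Y n) \<le> L * env_norm (X m - X n)" for m n
    using f[of m n] by (smt (verit) L_def env_norm_nonneg mult_right_mono)
  have "0 < e / L" using \<open>0 < e\<close> by (simp add: L_def)
  then obtain N where N: "\<forall>m\<ge>N. \<forall>n\<ge>N. env_norm (X m - X n) < e / L"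
    using X unfolding env_Cauchy_def by blast
  have "env_norm (Y m - Y n) < e" if "m \<ge> N" "n \<ge> N" for m n
  proof -
    have "L * env_norm (X m - X n) < e"
      using N that by (simp add: L_def field_simps)
    with f' show ?thesis using order_le_less_trans by blast
  qed
  then show "\<exists>N. \<forall>m\<ge>N. \<forall>n\<ge>N. env_norm (Y m - Y n) < e" by blast
qed

lemma env_Cauchy_minus: "env_Cauchy X \<Longrightarrow> env_Cauchy (\<lambda>n. - X n)"
  for X :: "nat \<Rightarrow> 'a::enveloped_star_algebra"
  by (erule env_Cauchy_lipschitz[where K = 1])
    (metis env_norm_diff_commute minus_diff_minus env_norm_minus mult_1 order_refl)

lemma env_Cauchy_scaleC: "env_Cauchy X \<Longrightarrow> env_Cauchy (\<lambda>n. c *\<^sub>C X n)"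
  for X :: "nat \<Rightarrow> 'a::enveloped_star_algebra"
  by (erule env_Cauchy_lipschitz[where K = "cmod c"])
    (simp add: env_norm_scaleC flip: scaleC_diff_right)

lemma env_Cauchy_star: "env_Cauchy X \<Longrightarrow> env_Cauchy (\<lambda>n. star (X n))"
  for X :: "nat \<Rightarrow> 'a::enveloped_star_algebra"
  by (erule env_Cauchy_lipschitz[where K = 1]) (simp add: env_norm_star flip: star_diff)

lemma env_norm_mult_diff:
  "env_norm (x * y - x' * y') \<le> env_norm x * env_norm (y - y') + env_norm (x - x') * env_norm y'"
  for x y x' y' :: "'a::enveloped_star_algebra"
proof -
  have "x * y - x' * y' = x * (y - y') + (x - x') * y'" by (simp add: algebra_simps)
  then have "env_norm (x * y - x' * y') \<le> env_norm (x * (y - y')) + env_norm ((x - x') * y')"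
    using env_norm_add by metis
  with env_norm_mult[of x "y - y'"] env_norm_mult[of "x - x'" y'] show ?thesis by linarith
qed

lemma env_norm_mult_diff_le:
  fixes x y x' y' :: "'a::enveloped_star_algebra"
  assumes "env_norm x \<le> K" "env_norm y' \<le> L"
  shows "env_norm (x * y - x' * y') \<le> K * env_norm (y - y') + L * env_norm (x - x')"
  using env_norm_mult_diff[of x y x' y'] assms
    mult_right_mono[OF assms(1) env_norm_nonneg[of "y - y'"]]
    mult_right_mono[OF assms(2) env_norm_nonneg[of "x - x'"]]
  by (simp add: mult.commute)

lemma env_Cauchy_mult:
  assumes X: "env_Cauchy X" and Y: "env_Cauchy (Y :: nat \<Rightarrow> 'a::enveloped_star_algebra)"
  shows "env_Cauchy (\<lambda>n. X n * Y n)"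
  unfolding env_Cauchy_def
proof (intro allI impI)
  fix e :: real assume "0 < e"
  obtain K where K: "0 < K" "\<And>n. env_norm (X n) \<le> K" using env_Cauchy_bounded[OF X] by blast
  obtain L where L: "0 < L" "\<And>n. env_norm (Y n) \<le> L" using env_Cauchy_bounded[OF Y] by blast
  have "0 < e / (2 * K)" "0 < e / (2 * L)" using \<open>0 < e\<close> K L by auto
  then obtain M N where M: "\<forall>m\<ge>M. \<forall>n\<ge>M. env_norm (X m - X n) < e / (2 * L)"
    and N: "\<forall>m\<ge>N. \<forall>n\<ge>N. env_norm (Y m - Y n) < e / (2 * K)"
    using X Y unfolding env_Cauchy_def by blast
  have "env_norm (X m * Y m - X n * Y n) < e" if "m \<ge> max M N" "n \<ge> max M N" for m n
  proof -
    have "K * env_norm (Y m - Y n) < e / 2" "L * env_norm (X m - X n) < e / 2"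
      using M N that K(1) L(1) by (simp_all add: field_simps)
    with env_norm_mult_diff_le[OF K(2)[of m] L(2)[of n], of "Y m" "X n"]
    show ?thesis by linarith
  qed
  then show "\<exists>N. \<forall>m\<ge>N. \<forall>n\<ge>N. env_norm (X m * Y m - X n * Y n) < e" by blast
qed

instantiation cstar_envelope :: (enveloped_star_algebra) complex_star_algebra
begin

lift_definition zero_cstar_envelope :: "'a cstar_envelope" is "\<lambda>_. 0"
  by (simp add: env_rel_refl env_Cauchy_const)

lift_definition one_cstar_envelope :: "'a cstar_envelope" is "\<lambda>_. 1"
  by (simp add: env_rel_refl env_Cauchy_const)

lift_definition plus_cstar_envelope :: "'a cstar_envelope \<Rightarrow> 'a cstar_envelope \<Rightarrow> 'a cstar_envelope"
  is "\<lambda>X Y n. X n + Y n"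
proof -
  fix X X' Y Y' :: "nat \<Rightarrow> 'a"
  assume a: "env_rel X X'" "env_rel Y Y'"
  then have "(\<lambda>n. env_norm (X n - X' n) + env_norm (Y n - Y' n)) \<longlonglongrightarrow> 0"
    by (auto simp: env_rel_def intro!: tendsto_add_zero)
  then have "(\<lambda>n. env_norm (X n + Y n - (X' n + Y' n))) \<longlonglongrightarrow> 0"
    by (rule tendsto_0_le) (auto simp: env_norm_nonneg add_diff_add env_norm_add)
  with a show "env_rel (\<lambda>n. X n + Y n) (\<lambda>n. X' n + Y' n)"
    by (simp add: env_rel_def env_Cauchy_add)
qed

lift_definition uminus_cstar_envelope :: "'a cstar_envelope \<Rightarrow> 'a cstar_envelope"
  is "\<lambda>X n. - X n"
proof -
  fix X Y :: "nat \<Rightarrow> 'a"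
  assume a: "env_rel X Y"
  have "env_norm (- X n - - Y n) = env_norm (X n - Y n)" for n
    by (metis env_norm_diff_commute minus_diff_minus env_norm_minus)
  with a show "env_rel (\<lambda>n. - X n) (\<lambda>n. - Y n)"
    by (simp add: env_rel_def env_Cauchy_minus)
qed

definition minus_cstar_envelope :: "'a cstar_envelope \<Rightarrow> 'a cstar_envelope \<Rightarrow> 'a cstar_envelope"
  where "minus_cstar_envelope x y = x + - y"

lift_definition times_cstar_envelope :: "'a cstar_envelope \<Rightarrow> 'a cstar_envelope \<Rightarrow> 'a cstar_envelope"
  is "\<lambda>X Y n. X n * Y n"
proof -
  fix X X' Y Y' :: "nat \<Rightarrow> 'a"
  assume a: "env_rel X X'" "env_rel Y Y'"
  obtain K where K: "\<And>n. env_norm (X n) \<le> K" using a env_Cauchy_bounded env_rel_def by metis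
  obtain L where L: "\<And>n. env_norm (Y' n) \<le> L" using a env_Cauchy_bounded env_rel_def by metis
  have "(\<lambda>n. K * env_norm (Y n - Y' n) + L * env_norm (X n - X' n)) \<longlonglongrightarrow> 0"
    using a by (auto simp: env_rel_def intro!: tendsto_add_zero tendsto_mult_right_zero)
  then have "(\<lambda>n. env_norm (X n * Y n - X' n * Y' n)) \<longlonglongrightarrow> 0"
    by (rule tendsto_0_le) (auto simp: env_norm_nonneg env_norm_mult_diff_le K L)
  with a show "env_rel (\<lambda>n. X n * Y n) (\<lambda>n. X' n * Y' n)"
    by (simp add: env_rel_def env_Cauchy_mult)
qed

lift_definition scaleC_cstar_envelope :: "complex \<Rightarrow> 'a cstar_envelope \<Rightarrow> 'a cstar_envelope"
  is "\<lambda>c X n. c *\<^sub>C X n"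
  by (auto simp: env_rel_def env_Cauchy_scaleC env_norm_scaleC intro: tendsto_mult_right_zero
      simp flip: scaleC_diff_right)

lift_definition star_cstar_envelope :: "'a cstar_envelope \<Rightarrow> 'a cstar_envelope"
  is "\<lambda>X n. star (X n)"
  by (auto simp: env_rel_def env_Cauchy_star env_norm_star simp flip: star_diff)

instance
proof
  fix x y z :: "'a cstar_envelope" and c d :: complex
  have *: "env_rel X Y" if "env_Cauchy X" "X = Y" for X Y :: "nat \<Rightarrow> 'a"
    using that by (simp add: env_rel_refl)
  note C = env_Cauchy_add env_Cauchy_mult env_Cauchy_star env_Cauchy_scaleC env_Cauchy_const
    env_Cauchy_minus
  note [simp] = env_rel_refl
  show "x + y + z = x + (y + z)" by transfer (rule *; auto intro!: C simp: add.assoc)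
  show "x + y = y + x" by transfer (rule *; auto intro!: C simp: add.commute)
  show "0 + x = x" by transfer (rule *; auto intro!: C)
  show "- x + x = 0" by transfer (rule *; auto intro!: C)
  show "x - y = x + - y" by (rule minus_cstar_envelope_def)
  show "x * y * z = x * (y * z)" by transfer (rule *; auto intro!: C simp: mult.assoc)
  show "1 * x = x" by transfer (rule *; auto intro!: C)
  show "x * 1 = x" by transfer (rule *; auto intro!: C)
  show "(x + y) * z = x * z + y * z" by transfer (rule *; auto intro!: C simp: distrib_right)
  show "x * (y + z) = x * y + x * z" by transfer (rule *; auto intro!: C simp: distrib_left)
  show "c *\<^sub>C (x + y) = c *\<^sub>C x + c *\<^sub>C y" by transfer (rule *; auto intro!: C simp: scaleC_add_right)
  show "(c + d) *\<^sub>C x = c *\<^sub>C x + d *\<^sub>C x" by transfer (rule *; auto intro!: C simp: scaleC_add_left)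
  show "c *\<^sub>C d *\<^sub>C x = (c * d) *\<^sub>C x" by transfer (rule *; auto intro!: C simp: scaleC_scaleC)
  show "1 *\<^sub>C x = x" by transfer (rule *; auto intro!: C simp: scaleC_one)
  show "c *\<^sub>C x * y = c *\<^sub>C (x * y)" by transfer (rule *; auto intro!: C simp: mult_scaleC_left)
  show "x * c *\<^sub>C y = c *\<^sub>C (x * y)" by transfer (rule *; auto intro!: C simp: mult_scaleC_right)
  show "star (star x) = x" by transfer (rule *; auto intro!: C simp: star_star)
  show "star (x + y) = star x + star y" by transfer (rule *; auto intro!: C simp: star_add)
  show "star (c *\<^sub>C x) = cnj c *\<^sub>C star x" by transfer (rule *; auto intro!: C simp: star_scaleC)
  show "star (x * y) = star y * star x" by transfer (rule *; auto intro!: C simp: star_mult)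
qed

end

lift_definition to_envelope :: "'a::enveloped_star_algebra \<Rightarrow> 'a cstar_envelope" is "\<lambda>x _. x"
  by (simp add: env_rel_refl env_Cauchy_const)

instantiation cstar_envelope :: (enveloped_star_algebra) real_normed_algebra
begin

lift_definition norm_cstar_envelope :: "'a cstar_envelope \<Rightarrow> real"
  is "\<lambda>X. lim (\<lambda>n. env_norm (X n))"
proof -
  fix X Y :: "nat \<Rightarrow> 'a"
  assume a: "env_rel X Y"
  then have X: "env_Cauchy X" and Y: "env_Cauchy Y" and XY: "(\<lambda>n. env_norm (X n - Y n)) \<longlonglongrightarrow> 0"
    by (simp_all only: env_rel_def)
  obtain l where l: "(\<lambda>n. env_norm (Y n)) \<longlonglongrightarrow> l"
    using env_Cauchy_imp_Cauchy[OF Y] unfolding convergent_def by (rule exE)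
  have "(\<lambda>n. env_norm (X n) - env_norm (Y n)) \<longlonglongrightarrow> 0"
    by (rule Lim_null_comparison[OF always_eventually XY]) (simp only: real_norm_def env_norm_abs_diff simp_thms)
  from tendsto_add[OF this l] have "(\<lambda>n. env_norm (X n)) \<longlonglongrightarrow> l" by simp
  then show "lim (\<lambda>n. env_norm (X n)) = lim (\<lambda>n. env_norm (Y n))"
    by (simp only: limI[OF l] limI)
qed

definition scaleR_cstar_envelope :: "real \<Rightarrow> 'a cstar_envelope \<Rightarrow> 'a cstar_envelope"
  where "scaleR_cstar_envelope r x = complex_of_real r *\<^sub>C x"
definition sgn_cstar_envelope :: "'a cstar_envelope \<Rightarrow> 'a cstar_envelope"
  where "sgn_cstar_envelope x = inverse (norm x) *\<^sub>R x"
definition dist_cstar_envelope :: "'a cstar_envelope \<Rightarrow> 'a cstar_envelope \<Rightarrow> real"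
  where "dist_cstar_envelope x y = norm (x - y)"
definition uniformity_cstar_envelope :: "('a cstar_envelope \<times> 'a cstar_envelope) filter"
  where "uniformity_cstar_envelope = (INF e\<in>{0<..}. principal {(x, y). dist x y < e})"
definition open_cstar_envelope :: "'a cstar_envelope set \<Rightarrow> bool"
  where "open_cstar_envelope U \<longleftrightarrow> (\<forall>x\<in>U. \<forall>\<^sub>F (x', y) in uniformity. x' = x \<longrightarrow> y \<in> U)"

lemma norm_abs_tendsto:
  assumes "env_Cauchy (X :: nat \<Rightarrow> 'a)"
  shows "(\<lambda>n. env_norm (X n)) \<longlonglongrightarrow> norm (abs_cstar_envelope X)"
proof -
  have X: "env_rel X X" using assms by (simp only: env_rel_refl)
  show ?thesis
    unfolding norm_cstar_envelope.abs_eq[OF X]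
    using env_Cauchy_imp_Cauchy[OF assms] by (rule convergent_LIMSEQ_iff[THEN iffD1])
qed

lemma abs_cases:
  obtains X where "env_Cauchy X" "(x :: 'a cstar_envelope) = abs_cstar_envelope X"
proof -
  have "env_Cauchy (rep_cstar_envelope x)"
    using Quotient_rep_reflp[OF Quotient_cstar_envelope, of x] by (simp add: env_rel_refl)
  then show thesis
    using that Quotient_abs_rep[OF Quotient_cstar_envelope, of x] by metis
qed

lemma norm_env: "norm (to_envelope (x :: 'a)) = env_norm x"
  unfolding to_envelope.abs_eq
  using LIMSEQ_unique[OF norm_abs_tendsto[OF env_Cauchy_const, of x] tendsto_const] .

lemma abs_eqs:
  assumes "env_Cauchy (X :: nat \<Rightarrow> 'a)"
  shows "c *\<^sub>C abs_cstar_envelope X = abs_cstar_envelope (\<lambda>n. c *\<^sub>C X n)"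
    "star (abs_cstar_envelope X) = abs_cstar_envelope (\<lambda>n. star (X n))"
    "- abs_cstar_envelope X = abs_cstar_envelope (\<lambda>n. - X n)"
    "env_Cauchy Y \<Longrightarrow> abs_cstar_envelope X + abs_cstar_envelope Y = abs_cstar_envelope (\<lambda>n. X n + Y n)"
    "env_Cauchy Y \<Longrightarrow> abs_cstar_envelope X * abs_cstar_envelope Y = abs_cstar_envelope (\<lambda>n. X n * Y n)"
    "env_Cauchy Y \<Longrightarrow> abs_cstar_envelope X - abs_cstar_envelope Y = abs_cstar_envelope (\<lambda>n. X n - Y n)"
proof -
  have X: "env_rel X X" using assms by (simp only: env_rel_refl)
  have Y: "env_rel Y Y" if "env_Cauchy Y" for Y :: "nat \<Rightarrow> 'a" using that by (simp only: env_rel_refl)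
  show "c *\<^sub>C abs_cstar_envelope X = abs_cstar_envelope (\<lambda>n. c *\<^sub>C X n)"
    "star (abs_cstar_envelope X) = abs_cstar_envelope (\<lambda>n. star (X n))"
    by (simp_all only: scaleC_cstar_envelope.abs_eq[OF X] star_cstar_envelope.abs_eq[OF X])
  have uminus: "- abs_cstar_envelope X = abs_cstar_envelope (\<lambda>n. - X n)"
    if "env_Cauchy X" for X :: "nat \<Rightarrow> 'a"
    by (rule uminus_cstar_envelope.abs_eq[OF Y[OF that]])
  have plus: "abs_cstar_envelope X + abs_cstar_envelope Y = abs_cstar_envelope (\<lambda>n. X n + Y n)"
    if "env_Cauchy Y" for Y
    by (rule plus_cstar_envelope.abs_eq[OF X Y[OF that]])
  show "- abs_cstar_envelope X = abs_cstar_envelope (\<lambda>n. - X n)" by (rule uminus[OF assms])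
  show "abs_cstar_envelope X + abs_cstar_envelope Y = abs_cstar_envelope (\<lambda>n. X n + Y n)"
    if "env_Cauchy Y" by (rule plus[OF that])
  show "abs_cstar_envelope X * abs_cstar_envelope Y = abs_cstar_envelope (\<lambda>n. X n * Y n)"
    if "env_Cauchy Y"
    by (rule times_cstar_envelope.abs_eq[OF X Y[OF that]])
  show "abs_cstar_envelope X - abs_cstar_envelope Y = abs_cstar_envelope (\<lambda>n. X n - Y n)"
    if "env_Cauchy Y"
    unfolding minus_cstar_envelope_def uminus[OF that] plus[OF env_Cauchy_minus[OF that]] by simp
qed

lemma norm_scaleC_envelope: "norm (c *\<^sub>C (x :: 'a cstar_envelope)) = cmod c * norm x"
proof -
  obtain X where X: "env_Cauchy X" "x = abs_cstar_envelope X" by (rule abs_cases)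
  show ?thesis
    unfolding X(2) abs_eqs(1)[OF X(1)]
    using LIMSEQ_unique[OF norm_abs_tendsto[OF env_Cauchy_scaleC[OF X(1)], of c, unfolded env_norm_scaleC]
      tendsto_mult[OF tendsto_const norm_abs_tendsto[OF X(1)], of "cmod c"]] .
qed

instance
proof
  fix x y :: "'a cstar_envelope" and r s :: real
  show "r *\<^sub>R (x + y) = r *\<^sub>R x + r *\<^sub>R y" "(r + s) *\<^sub>R x = r *\<^sub>R x + s *\<^sub>R x"
    "r *\<^sub>R s *\<^sub>R x = (r * s) *\<^sub>R x" "1 *\<^sub>R x = x" "r *\<^sub>R x * y = r *\<^sub>R (x * y)"
    "x * r *\<^sub>R y = r *\<^sub>R (x * y)"
    by (simp_all add: scaleR_cstar_envelope_def scaleC_add_right scaleC_add_left scaleC_scaleC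
        scaleC_one mult_scaleC_left mult_scaleC_right)
  obtain X where X: "env_Cauchy X" "x = abs_cstar_envelope X" by (rule abs_cases)
  obtain Y where Y: "env_Cauchy Y" "y = abs_cstar_envelope Y" by (rule abs_cases)
  note nX = norm_abs_tendsto[OF X(1)] and nY = norm_abs_tendsto[OF Y(1)]
  show "norm (x + y) \<le> norm x + norm y"
    unfolding X(2) Y(2) abs_eqs(4)[OF X(1) Y(1)]
    by (rule LIMSEQ_le[OF norm_abs_tendsto[OF env_Cauchy_add[OF X(1) Y(1)]] tendsto_add[OF nX nY]])
      (simp add: env_norm_add)
  show "norm (x * y) \<le> norm x * norm y"
    unfolding X(2) Y(2) abs_eqs(5)[OF X(1) Y(1)]
    by (rule LIMSEQ_le[OF norm_abs_tendsto[OF env_Cauchy_mult[OF X(1) Y(1)]] tendsto_mult[OF nX nY]])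
      (simp add: env_norm_mult)
  show "norm (r *\<^sub>R x) = \<bar>r\<bar> * norm x"
    by (simp add: scaleR_cstar_envelope_def norm_scaleC_envelope)
  show "norm x = 0 \<longleftrightarrow> x = 0"
  proof
    assume "norm x = 0"
    with nX have "(\<lambda>n. env_norm (X n)) \<longlonglongrightarrow> 0" by (simp only: X(2))
    then have "env_rel X (\<lambda>_. 0)"
      using X(1) by (simp add: env_rel_def env_Cauchy_const)
    then have "abs_cstar_envelope X = abs_cstar_envelope (\<lambda>_. 0)"
      by (rule Quotient_rel_abs[OF Quotient_cstar_envelope])
    then show "x = 0" by (simp only: X(2) zero_cstar_envelope.abs_eq)
  next
    assume "x = 0"
    then show "norm x = 0"
      using norm_scaleC_envelope[of 0 x] by (simp add: scaleC_0_right)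
  qed
qed (fact sgn_cstar_envelope_def dist_cstar_envelope_def uniformity_cstar_envelope_def
    open_cstar_envelope_def)+

end

lemma env_diff: "to_envelope x - to_envelope y = to_envelope (x - y)"
  unfolding to_envelope.abs_eq by (rule abs_eqs(6)[OF env_Cauchy_const env_Cauchy_const])

lemma norm_diff_env_tendsto:
  assumes "env_Cauchy (X :: nat \<Rightarrow> 'a::enveloped_star_algebra)"
  shows "(\<lambda>n. norm (abs_cstar_envelope X - to_envelope (X n))) \<longlonglongrightarrow> 0"
proof (rule LIMSEQ_I)
  fix e :: real assume "0 < e"
  then have "0 < e / 2" by simp
  then obtain N where N: "\<forall>m\<ge>N. \<forall>n\<ge>N. env_norm (X m - X n) < e / 2"
    using assms unfolding env_Cauchy_def by blast
  have "norm (abs_cstar_envelope X - to_envelope (X n)) < e" if "n \<ge> N" for n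
  proof -
    have c: "env_Cauchy (\<lambda>m. X m - X n)"
      using env_Cauchy_add[OF assms env_Cauchy_minus[OF env_Cauchy_const[of "X n"]]] by simp
    have eq: "abs_cstar_envelope X - to_envelope (X n) = abs_cstar_envelope (\<lambda>m. X m - X n)"
      unfolding to_envelope.abs_eq by (rule abs_eqs(6)[OF assms env_Cauchy_const])
    have "env_norm (X m - X n) \<le> e / 2" if "m \<ge> N" for m
      using N that \<open>n \<ge> N\<close> by (intro less_imp_le) blast
    then have "norm (abs_cstar_envelope X - to_envelope (X n)) \<le> e / 2"
      unfolding eq by (intro LIMSEQ_le_const2[OF norm_abs_tendsto[OF c]]) blast
    with \<open>0 < e\<close> show ?thesis by simp
  qed
  then show "\<exists>N. \<forall>n\<ge>N. norm (norm (abs_cstar_envelope X - to_envelope (X n)) - 0) < e"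
    by auto
qed

instance cstar_envelope :: (enveloped_star_algebra) banach
proof
  fix Z :: "nat \<Rightarrow> 'a cstar_envelope"
  assume Z: "Cauchy Z"
  have "\<exists>x. norm (Z k - to_envelope x) < 1 / (real k + 1)" for k
  proof -
    obtain X where X: "env_Cauchy X" "Z k = abs_cstar_envelope X" by (rule abs_cases)
    have "0 < 1 / (real k + 1)" by simp
    from LIMSEQ_D[OF norm_diff_env_tendsto[OF X(1)] this] show ?thesis
      unfolding X(2) diff_0_right real_norm_def abs_norm_cancel by (meson order_refl)
  qed
  then obtain x where x: "\<And>k. norm (Z k - to_envelope (x k)) < 1 / (real k + 1)" by metis
  have "(\<lambda>k. 1 / (real k + 1)) \<longlonglongrightarrow> 0" by (use LIMSEQ_inverse_real_of_nat in \<open>simp add: inverse_eq_divide add.commute\<close>)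
  then have Zx: "(\<lambda>k. Z k - to_envelope (x k)) \<longlonglongrightarrow> 0"
    by (rule Lim_null_comparison[rotated]) (intro always_eventually allI less_imp_le x)
  then have D: "Cauchy (\<lambda>k. Z k - to_envelope (x k))" by (rule LIMSEQ_imp_Cauchy)
  have c: "env_Cauchy x"
    unfolding env_Cauchy_def
  proof (intro allI impI)
    fix e :: real assume "0 < e"
    then have "0 < e / 2" by simp
    then obtain M N where M: "\<forall>m\<ge>M. \<forall>n\<ge>M. norm (Z m - Z n) < e / 2"
      and N: "\<forall>m\<ge>N. \<forall>n\<ge>N. norm ((Z m - to_envelope (x m)) - (Z n - to_envelope (x n))) < e / 2"
      using Z D unfolding Cauchy_iff by meson
    have "env_norm (x m - x n) < e" if "m \<ge> max M N" "n \<ge> max M N" for m n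
    proof -
      have "to_envelope (x m) - to_envelope (x n) = (Z m - Z n) - ((Z m - to_envelope (x m)) - (Z n - to_envelope (x n)))"
        by simp
      then have "norm (to_envelope (x m) - to_envelope (x n))
          \<le> norm (Z m - Z n) + norm ((Z m - to_envelope (x m)) - (Z n - to_envelope (x n)))"
        by (metis norm_triangle_ineq4)
      moreover have "norm (Z m - Z n) < e / 2"
        "norm ((Z m - to_envelope (x m)) - (Z n - to_envelope (x n))) < e / 2"
        using M N that by auto
      ultimately show ?thesis by (simp add: env_diff norm_env)
    qed
    then show "\<exists>N. \<forall>m\<ge>N. \<forall>n\<ge>N. env_norm (x m - x n) < e" by blast
  qed
  have "(\<lambda>k. abs_cstar_envelope x - to_envelope (x k)) \<longlonglongrightarrow> 0"
    by (rule tendsto_norm_zero_cancel[OF norm_diff_env_tendsto[OF c]])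
  from tendsto_diff[OF Zx this] have "(\<lambda>k. Z k - abs_cstar_envelope x) \<longlonglongrightarrow> 0" by simp
  then show "convergent Z" unfolding convergent_def using LIM_zero_cancel by blast
qed

instance cstar_envelope :: (enveloped_star_algebra) cstar_algebra
proof
  fix x :: "'a cstar_envelope" and r :: real and c :: complex
  show "r *\<^sub>R x = complex_of_real r *\<^sub>C x"
    by (simp add: scaleR_cstar_envelope_def)
  show "norm (c *\<^sub>C x) = cmod c * norm x"
    by (rule norm_scaleC_envelope)
  obtain X where X: "env_Cauchy X" "x = abs_cstar_envelope X" by (rule abs_cases)
  show "norm (star x * x) = (norm x)\<^sup>2"
    unfolding X(2) abs_eqs(2)[OF X(1)] abs_eqs(5)[OF env_Cauchy_star[OF X(1)] X(1)]
    using LIMSEQ_unique[OF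
        norm_abs_tendsto[OF env_Cauchy_mult[OF env_Cauchy_star[OF X(1)] X(1)], unfolded env_norm_cstar]
        tendsto_power[OF norm_abs_tendsto[OF X(1)], of 2]] .
qed

lemma abs_gbinomial_half_le_one: "\<bar>(1/2 :: real) gchoose n\<bar> \<le> 1"
proof (induction n)
  case (Suc n)
  have "(1/2 :: real) gchoose Suc n = ((1/2 - real n) / real (Suc n)) * ((1/2) gchoose n)"
    using gbinomial_mult_1[of "1/2 :: real" n] by (simp add: field_simps)
  moreover have "\<bar>(1/2 - real n) / real (Suc n)\<bar> \<le> 1" by (simp add: abs_le_iff field_simps)
  ultimately show ?case using Suc
    by (metis abs_ge_zero abs_mult mult_le_one)
qed simp

lemma cstar_seminorm_norm: "cstar_seminorm (norm :: 'a::cstar_algebra \<Rightarrow> real)"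
  unfolding cstar_seminorm_def
  by (simp add: norm_triangle_ineq norm_scaleC norm_mult_ineq cstar_identity)

lemma norm_star: "norm (star x) = norm (x :: 'a::cstar_algebra)"
  by (rule cstar_seminorm_star[OF cstar_seminorm_norm])

lemma star_scaleR: "star (r *\<^sub>R x) = r *\<^sub>R star (x :: 'a::cstar_algebra)"
  by (simp add: scaleR_eq_scaleC star_scaleC)

lemma bounded_linear_star: "bounded_linear (star :: 'a::cstar_algebra \<Rightarrow> 'a)"
  by (rule bounded_linear_intro[where K = 1]) (simp_all add: star_add star_scaleR norm_star)

lemma star_power: "star (x ^ n) = star (x :: 'a::complex_star_algebra) ^ n"
  by (induction n) (simp_all add: star_1 star_mult power_commutes)

lemma norm_power_le: "norm (x ^ n) \<le> norm (x :: 'a::cstar_algebra) ^ n"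
proof (induction n)
  case 0
  show ?case by (simp add: cstar_seminorm_one_le[OF cstar_seminorm_norm])
next
  case (Suc n)
  have "norm (x * x ^ n) \<le> norm x * norm (x ^ n)" by (rule norm_mult_ineq)
  also have "\<dots> \<le> norm x * norm x ^ n" by (rule mult_left_mono[OF Suc norm_ge_zero])
  finally show ?case by simp
qed

lemma selfadjoint_sqrt_exists:
  fixes a :: "'a::cstar_algebra"
  assumes "norm a < 1" "star a = a"
  shows "\<exists>b. star b = b \<and> a * b = b * a \<and> b * b = 1 - a * a"
proof -
  define x where "x = a * a"
  have nx: "norm x < 1"
    using cstar_identity[of a] assms unfolding x_def by (simp add: abs_square_less_1)
  have sx: "star x = x" unfolding x_def by (simp add: star_mult assms(2))
  define c where "c n = (-1) ^ n * ((1/2 :: real) gchoose n)" for n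
  define f where "f n = c n *\<^sub>R x ^ n" for n
  have "norm (f n) \<le> norm x ^ n" for n
  proof -
    have "norm (f n) \<le> 1 * norm (x ^ n)"
      unfolding f_def c_def norm_scaleR
      by (rule mult_right_mono) (simp_all add: abs_mult abs_gbinomial_half_le_one)
    with norm_power_le[of x n] show ?thesis by simp
  qed
  then have sm: "summable (\<lambda>n. norm (f n))"
    by (intro summable_comparison_test[OF _ summable_geometric[of "norm x"]]) (auto simp: nx)
  then have sf: "summable f" by (rule summable_norm_cancel)
  define b where "b = suminf f"
  have star_f: "star (f n) = f n" for n
    by (simp add: f_def star_scaleR star_power sx)
  have "star b = suminf (\<lambda>n. star (f n))"
    unfolding b_def by (rule bounded_linear.suminf[OF bounded_linear_star sf])
  then have "star b = b"
    unfolding star_f b_def .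
  moreover have "a * b = b * a"
  proof -
    have "a * x ^ n = x ^ n * a" for n
      by (rule power_commuting_commutes[symmetric]) (simp add: x_def mult.assoc)
    then show ?thesis
      unfolding b_def suminf_mult[OF sf, symmetric] suminf_mult2[OF sf] by (simp add: f_def)
  qed
  moreover have "b * b = 1 - a * a"
  proof -
    have cc: "(\<Sum>i\<le>k. c i * c (k - i)) = (-1) ^ k * ((1 :: real) gchoose k)" for k
    proof -
      have "(\<Sum>i\<le>k. c i * c (k - i))
          = (\<Sum>i\<le>k. (-1) ^ k * (((1/2) gchoose i) * ((1/2) gchoose (k - i))))"
      proof (rule sum.cong)
        fix i assume "i \<in> {..k}"
        then have "(-1 :: real) ^ k = (-1) ^ i * (-1) ^ (k - i)"
          by (simp flip: power_add)
        then show "c i * c (k - i) = (-1) ^ k * (((1/2) gchoose i) * ((1/2) gchoose (k - i)))"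
          by (simp add: c_def)
      qed simp
      also have "\<dots> = (-1) ^ k * ((1/2 + 1/2) gchoose k)"
        unfolding gbinomial_Vandermonde[symmetric] sum_distrib_left[symmetric] atLeast0AtMost ..
      finally show ?thesis by simp
    qed
    have "b * b = suminf (\<lambda>k. \<Sum>i\<le>k. f i * f (k - i))"
      unfolding b_def by (rule Cauchy_product[OF sm sm])
    also have "\<dots> = suminf (\<lambda>k. ((-1) ^ k * ((1 :: real) gchoose k)) *\<^sub>R x ^ k)"
    proof (rule arg_cong[where f = suminf], rule ext)
      fix k
      have "(\<Sum>i\<le>k. f i * f (k - i)) = (\<Sum>i\<le>k. (c i * c (k - i)) *\<^sub>R x ^ k)"
        by (rule sum.cong) (simp_all add: f_def flip: power_add)
      then show "(\<Sum>i\<le>k. f i * f (k - i)) = ((-1) ^ k * ((1 :: real) gchoose k)) *\<^sub>R x ^ k"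
        by (simp add: cc flip: scaleR_sum_left)
    qed
    also have "\<dots> = (\<Sum>k\<in>{0, 1}. ((-1) ^ k * ((1 :: real) gchoose k)) *\<^sub>R x ^ k)"
    proof (rule suminf_finite)
      fix k :: nat assume "k \<notin> {0, 1}"
      then have "(1 :: real) gchoose k = 0"
        using binomial_gbinomial[of 1 k, where 'a = real] by (cases k) (auto simp: binomial_eq_0)
      then show "((-1) ^ k * ((1 :: real) gchoose k)) *\<^sub>R x ^ k = 0" by simp
    qed simp
    finally show ?thesis by (simp add: x_def)
  qed
  ultimately show ?thesis by blast
qed

lemma cstar_seminorm_le_norm_selfadjoint:
  fixes a :: "'a::cstar_algebra"
  assumes s: "cstar_seminorm s" and a: "star a = a"
  shows "s a \<le> norm a"
proof -
  have one: "s a \<le> 1" if h: "norm a < 1" "star a = a" for a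
  proof -
    obtain b where b: "star b = b" "a * b = b * a" "b * b = 1 - a * a"
      using selfadjoint_sqrt_exists[OF h] by blast
    define u where "u = a + \<i> *\<^sub>C b"
    have su: "star u = a + (- \<i>) *\<^sub>C b"
      by (simp add: u_def star_add star_scaleC b that)
    have "star u * u = a * a + b * b + (\<i> *\<^sub>C (a * b) + (- \<i>) *\<^sub>C (a * b))"
      unfolding su unfolding u_def
      by (simp add: distrib_left distrib_right mult_scaleC_left mult_scaleC_right scaleC_scaleC scaleC_add_right
          scaleC_one b(2) add_ac)
    also have "\<dots> = 1"
      unfolding scaleC_add_left[symmetric] by (simp add: scaleC_0_left b(3))
    finally have "(s u)\<^sup>2 \<le> 1"
      using cstar_seminormD(4)[OF s, of u] cstar_seminorm_one_le[OF s] by simp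
    then have u1: "s u \<le> 1"
      by (simp add: power2_le_iff_abs_le cstar_seminorm_nonneg[OF s] abs_square_le_1)
    have "a = (1/2) *\<^sub>C (u + star u)"
      unfolding su unfolding u_def
      by (simp add: scaleC_add_right scaleC_scaleC add_ac flip: scaleC_add_left)
        (simp add: scaleC_add_right scaleC_scaleC scaleC_one scaleC_0_left flip: scaleC_add_left add.assoc)
    then have "s a = s (u + star u) / 2"
      using cstar_seminormD(2)[OF s, of "1/2" "u + star u"] by simp
    also have "\<dots> \<le> (s u + s (star u)) / 2"
      using cstar_seminormD(1)[OF s, of u "star u"] by simp
    finally show ?thesis using u1 by (simp add: cstar_seminorm_star[OF s])
  qed
  show ?thesis
  proof (rule dense_ge)
    fix r assume r: "norm a < r"
    then have r0: "0 < r" using norm_ge_zero order_le_less_trans by blast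
    have "s ((1/r) *\<^sub>R a) \<le> 1"
      using r r0 a by (intro one) (auto simp: star_scaleR)
    moreover have "s ((1/r) *\<^sub>R a) = s a / r"
      using r0 cstar_seminormD(2)[OF s, of "complex_of_real (1/r)" a]
      by (simp add: scaleR_eq_scaleC norm_divide)
    ultimately show "s a \<le> r" using r0 by (simp add: field_simps)
  qed
qed

lemma cstar_seminorm_le_norm:
  fixes a :: "'a::cstar_algebra"
  assumes s: "cstar_seminorm s"
  shows "s a \<le> norm a"
proof -
  have "(s a)\<^sup>2 = s (star a * a)" by (simp add: cstar_seminormD(4)[OF s])
  also have "\<dots> \<le> norm (star a * a)"
    by (rule cstar_seminorm_le_norm_selfadjoint[OF s]) (simp add: star_mult star_star)
  also have "\<dots> = (norm a)\<^sup>2" by (rule cstar_identity)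
  finally show ?thesis by (rule power2_le_imp_le) simp
qed

definition two_sided_ideal :: "'a::ring_1 set \<Rightarrow> bool"
  where "two_sided_ideal J \<longleftrightarrow>
    0 \<in> J \<and> (\<forall>x\<in>J. \<forall>y\<in>J. x + y \<in> J) \<and> (\<forall>a. \<forall>x\<in>J. a * x \<in> J \<and> x * a \<in> J)"

definition ideal_generated :: "'a::ring_1 set \<Rightarrow> 'a set"
  where "ideal_generated S = \<Inter>{J. two_sided_ideal J \<and> S \<subseteq> J}"

text \<open>
  \<^typ>\<open>'m \<Rightarrow>\<^sub>0 complex\<close> is the monoid algebra of \<open>'m\<close>; as its multiplication is convolution along \<open>+\<close>,
  the monoids below, although not commutative, are written additively.
\<close>

class star_monoid = monoid_add +
  fixes adj :: "'a \<Rightarrow> 'a"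
  assumes adj_adj: "adj (adj x) = x"
    and adj_add: "adj (x + y) = adj y + adj x"

abbreviation monomial :: "'m \<Rightarrow> 'm \<Rightarrow>\<^sub>0 complex"
  where "monomial k \<equiv> Poly_Mapping.single k 1"

definition scale_poly :: "complex \<Rightarrow> ('m \<Rightarrow>\<^sub>0 complex) \<Rightarrow> ('m \<Rightarrow>\<^sub>0 complex)"
  where "scale_poly c f = Poly_Mapping.map ((*) c) f"

lift_definition star_poly :: "('m::star_monoid \<Rightarrow>\<^sub>0 complex) \<Rightarrow> ('m \<Rightarrow>\<^sub>0 complex)"
  is "\<lambda>f k. cnj (f (adj k))"
proof -
  fix f :: "'m \<Rightarrow> complex"
  assume "finite {x. f x \<noteq> 0}"
  then have "finite (adj ` {x. f x \<noteq> 0})" by blast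
  moreover have "{k. cnj (f (adj k)) \<noteq> 0} \<subseteq> adj ` {x. f x \<noteq> 0}"
    by (auto simp: image_iff) (metis adj_adj)
  ultimately show "finite {k. cnj (f (adj k)) \<noteq> 0}" by (rule finite_subset[rotated])
qed

text \<open>Congruence modulo the two-sided \<^emph>\<open>*\<close>-ideal generated by \<open>S\<close>.\<close>

definition star_ideal_cong ::
  "('m::star_monoid \<Rightarrow>\<^sub>0 complex) set \<Rightarrow> ('m \<Rightarrow>\<^sub>0 complex) \<Rightarrow> ('m \<Rightarrow>\<^sub>0 complex) \<Rightarrow> bool"
  where "star_ideal_cong S f g \<longleftrightarrow> f - g \<in> ideal_generated (S \<union> star_poly ` S)"

lemma lookup_scale_poly [simp]: "Poly_Mapping.lookup (scale_poly c x) k = c * Poly_Mapping.lookup x k"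
  by (simp add: scale_poly_def map.rep_eq when_def)

lemma scale_poly_conv_mult: "scale_poly c x = Poly_Mapping.single 0 c * (x :: 'm::monoid_add \<Rightarrow>\<^sub>0 complex)"
  by (simp add: scale_poly_def mult_map_scale_conv_mult)

lemma poly_mapping_single_induct:
  assumes "P 0" "\<And>k c x. P x \<Longrightarrow> P (Poly_Mapping.single k c + x)"
  shows "P (x :: 'm \<Rightarrow>\<^sub>0 complex)"
proof -
  have "P (\<Sum>k\<in>K. Poly_Mapping.single k (Poly_Mapping.lookup x k))" if "finite K" for K
    using that by (induction) (auto intro: assms)
  moreover have "(\<Sum>k\<in>Poly_Mapping.keys x. Poly_Mapping.single k (Poly_Mapping.lookup x k)) = x"
    by (rule poly_mapping_eqI) (auto simp: lookup_sum lookup_single when_def in_keys_iff)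
  ultimately show ?thesis by (metis finite_keys)
qed

lemma scale_poly_mult_left: "scale_poly c x * y = scale_poly c (x * (y :: 'm::monoid_add \<Rightarrow>\<^sub>0 complex))"
  by (simp add: scale_poly_conv_mult mult.assoc)

lemma single_0_central: "Poly_Mapping.single 0 c * x = x * Poly_Mapping.single 0 (c::complex)"
  for x :: "'m::monoid_add \<Rightarrow>\<^sub>0 complex"
  by (induction x rule: poly_mapping_single_induct) (auto simp: mult_single algebra_simps)

lemma scale_poly_mult_right: "x * scale_poly c y = scale_poly c (x * (y :: 'm::monoid_add \<Rightarrow>\<^sub>0 complex))"
  by (metis (no_types) scale_poly_conv_mult single_0_central mult.assoc)

lemma scale_poly_add: "scale_poly c (x + y) = scale_poly c x + scale_poly c y"
  and scale_poly_diff: "scale_poly c (x - y) = scale_poly c x - scale_poly c y"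
  and scale_poly_add_left: "scale_poly (c + d) x = scale_poly c x + scale_poly d x"
  and scale_poly_scale_poly: "scale_poly c (scale_poly d x) = scale_poly (c * d) x"
  and scale_poly_one: "scale_poly 1 x = x"
  by (rule poly_mapping_eqI; simp add: lookup_add lookup_minus algebra_simps)+

lemma scale_poly_single: "scale_poly c (Poly_Mapping.single k d) = Poly_Mapping.single k (c * d)"
  by (rule poly_mapping_eqI) (simp add: lookup_single when_def)

lemma star_poly_add: "star_poly (x + y) = star_poly x + star_poly y"
  by transfer auto

lemma star_poly_diff: "star_poly (x - y) = star_poly x - star_poly y"
  by transfer auto

lemma star_poly_star_poly: "star_poly (star_poly x) = x"
  by transfer (simp add: adj_adj)

lemma star_poly_scale_poly: "star_poly (scale_poly c x) = scale_poly (cnj c) (star_poly x)"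
  by (rule poly_mapping_eqI) (simp add: star_poly.rep_eq)

lemma star_poly_single: "star_poly (Poly_Mapping.single k c) = Poly_Mapping.single (adj k) (cnj c)"
  by (rule poly_mapping_eqI) (auto simp: star_poly.rep_eq lookup_single when_def adj_adj)

lemma star_poly_0: "star_poly 0 = 0"
  by transfer simp

lemma star_poly_mult: "star_poly (x * y) = star_poly y * star_poly x"
proof (induction x rule: poly_mapping_single_induct)
  case 1
  then show ?case by (simp add: star_poly_0)
next
  case (2 k c x)
  have "star_poly (Poly_Mapping.single k c * y) = star_poly y * star_poly (Poly_Mapping.single k c)"
    by (induction y rule: poly_mapping_single_induct)
      (simp_all add: star_poly_0 star_poly_add star_poly_single mult_single adj_add algebra_simps)
  with 2 show ?case by (simp add: star_poly_add algebra_simps)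
qed

lemma two_sided_ideal_generated: "two_sided_ideal (ideal_generated S)"
  unfolding two_sided_ideal_def ideal_generated_def by blast

lemma ideal_generated_superset: "S \<subseteq> ideal_generated S"
  unfolding ideal_generated_def by blast

lemma ideal_generated_least: "two_sided_ideal J \<Longrightarrow> S \<subseteq> J \<Longrightarrow> ideal_generated S \<subseteq> J"
  unfolding ideal_generated_def by blast

lemma ideal_generated_closed:
  shows "0 \<in> ideal_generated S"
    and "x \<in> ideal_generated S \<Longrightarrow> y \<in> ideal_generated S \<Longrightarrow> x + y \<in> ideal_generated S"
    and "x \<in> ideal_generated S \<Longrightarrow> a * x \<in> ideal_generated S"
    and "x \<in> ideal_generated S \<Longrightarrow> x * a \<in> ideal_generated S"
  using two_sided_ideal_generated[of S] unfolding two_sided_ideal_def by blast+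

lemma ideal_generated_uminus: "x \<in> ideal_generated S \<Longrightarrow> - x \<in> ideal_generated S"
  using ideal_generated_closed(3)[of x S "-1"] by simp

lemma star_poly_ideal:
  assumes "x \<in> ideal_generated (S \<union> star_poly ` S)"
  shows "star_poly x \<in> ideal_generated (S \<union> star_poly ` S)" (is "_ \<in> ?I")
proof -
  have "two_sided_ideal {x. star_poly x \<in> ?I}"
    unfolding two_sided_ideal_def
    by (auto simp: star_poly_0 star_poly_add star_poly_mult intro: ideal_generated_closed)
  moreover have "S \<union> star_poly ` S \<subseteq> {x. star_poly x \<in> ?I}"
    using ideal_generated_superset[of "S \<union> star_poly ` S"] by (auto simp: star_poly_star_poly)
  ultimately have "?I \<subseteq> {x. star_poly x \<in> ?I}"
    by (rule ideal_generated_least)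
  with assms show ?thesis by blast
qed

lemma star_ideal_cong_refl [simp]: "star_ideal_cong S f f"
  by (simp add: star_ideal_cong_def ideal_generated_closed)

lemma star_ideal_cong_equivp: "equivp (star_ideal_cong S)"
proof (rule equivpI)
  show "reflp (star_ideal_cong S)" by (simp add: reflp_def)
  show "symp (star_ideal_cong S)"
    unfolding symp_def star_ideal_cong_def using ideal_generated_uminus by fastforce
  show "transp (star_ideal_cong S)"
  proof (rule transpI)
    fix x y z assume "star_ideal_cong S x y" "star_ideal_cong S y z"
    then have "(x - y) + (y - z) \<in> ideal_generated (S \<union> star_poly ` S)"
      unfolding star_ideal_cong_def by (rule ideal_generated_closed)
    then show "star_ideal_cong S x z" by (simp add: star_ideal_cong_def)
  qed
qed

lemma star_ideal_cong_relator: "r \<in> S \<Longrightarrow> star_ideal_cong S r 0"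
  using ideal_generated_superset[of "S \<union> star_poly ` S"] by (auto simp: star_ideal_cong_def)

lemma star_ideal_cong_ops:
  assumes "star_ideal_cong S f f'" "star_ideal_cong S g g'"
  shows "star_ideal_cong S (f + g) (f' + g')" "star_ideal_cong S (f - g) (f' - g')"
    "star_ideal_cong S (f * g) (f' * g')"
proof -
  have *: "x - y \<in> ideal_generated T" if "x \<in> ideal_generated T" "y \<in> ideal_generated T"
    for x y and T :: "('a \<Rightarrow>\<^sub>0 complex) set"
    using ideal_generated_closed(2)[OF that(1) ideal_generated_uminus[OF that(2)]] by simp
  note c = ideal_generated_closed(2)[OF assms[unfolded star_ideal_cong_def]]
    *[OF assms[unfolded star_ideal_cong_def]]
  show "star_ideal_cong S (f + g) (f' + g')" "star_ideal_cong S (f - g) (f' - g')"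
    using c by (simp_all add: star_ideal_cong_def algebra_simps)
  have "(f - f') * g + f' * (g - g') \<in> ideal_generated (S \<union> star_poly ` S)"
    using assms unfolding star_ideal_cong_def
    by (intro ideal_generated_closed(2) ideal_generated_closed(3) ideal_generated_closed(4))
  then show "star_ideal_cong S (f * g) (f' * g')"
    by (simp add: star_ideal_cong_def algebra_simps)
qed

lemma star_ideal_cong_ops1:
  assumes "star_ideal_cong S f f'"
  shows "star_ideal_cong S (- f) (- f')" "star_ideal_cong S (scale_poly c f) (scale_poly c f')"
    "star_ideal_cong S (star_poly f) (star_poly f')"
  using star_ideal_cong_ops(2)[OF star_ideal_cong_refl[of S 0] assms]
    star_ideal_cong_ops(3)[OF star_ideal_cong_refl[of S "Poly_Mapping.single 0 c"] assms]
    star_poly_ideal assms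
  by (auto simp: scale_poly_conv_mult star_ideal_cong_def simp flip: star_poly_diff)

lemmas star_poly_algebra_simps = scale_poly_add scale_poly_add_left scale_poly_scale_poly scale_poly_one
  scale_poly_mult_left scale_poly_mult_right star_poly_star_poly star_poly_add star_poly_scale_poly
  star_poly_mult

datatype 'v word = Word (letters: "'v list")

instantiation word :: (type) monoid_add
begin
definition zero_word :: "'a word" where "zero_word = Word []"
definition plus_word :: "'a word \<Rightarrow> 'a word \<Rightarrow> 'a word"
  where "plus_word u v = Word (letters u @ letters v)"
instance by standard (simp_all add: zero_word_def plus_word_def)
end

text \<open>
  The universal unital \<^emph>\<open>*\<close>-algebra generated by two projections is the quotient of the free unital
  \<^emph>\<open>*\<close>-algebra, i.e. the free algebra on \<open>p, q, p\<^sup>*, q\<^sup>*\<close>, by the relations \<open>p\<^sup>2 = p\<^sup>* = p\<close> and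
  \<open>q\<^sup>2 = q\<^sup>* = q\<close>; the universal \<open>C\<^sup>*\<close>-algebra is its envelope.
\<close>

datatype proj_letter = Let_p | Let_q | Let_p_star | Let_q_star

primrec letter_star :: "proj_letter \<Rightarrow> proj_letter"
  where "letter_star Let_p = Let_p_star" | "letter_star Let_q = Let_q_star"
  | "letter_star Let_p_star = Let_p" | "letter_star Let_q_star = Let_q"

class involution =
  fixes invol :: "'a \<Rightarrow> 'a"
  assumes invol_invol: "invol (invol x) = x"

instantiation proj_letter :: involution
begin
definition invol_proj_letter :: "proj_letter \<Rightarrow> proj_letter" where "invol_proj_letter = letter_star"
instance
proof
  show "invol (invol x) = x" for x :: proj_letter
    by (cases x) (simp_all add: invol_proj_letter_def)
qed
end

instantiation word :: (involution) star_monoid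
begin
definition adj_word :: "'a word \<Rightarrow> 'a word" where "adj_word w = Word (rev (map invol (letters w)))"
instance
  by standard (simp_all add: adj_word_def plus_word_def rev_map[symmetric] o_def invol_invol)
end

definition proj_relators :: "(proj_letter word \<Rightarrow>\<^sub>0 complex) set"
  where "proj_relators =
    (let p = monomial (Word [Let_p]); p' = monomial (Word [Let_p_star]);
         q = monomial (Word [Let_q]); q' = monomial (Word [Let_q_star])
     in {p\<^sup>2 - p, p' - p, q\<^sup>2 - q, q' - q})"

quotient_type proj_alg = "proj_letter word \<Rightarrow>\<^sub>0 complex" / "star_ideal_cong proj_relators"
  by (rule star_ideal_cong_equivp)

instantiation proj_alg :: complex_star_algebra
begin
lift_definition zero_proj_alg :: proj_alg is 0 .
lift_definition one_proj_alg :: proj_alg is 1 .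
lift_definition plus_proj_alg :: "proj_alg \<Rightarrow> proj_alg \<Rightarrow> proj_alg" is "(+)"
  by (rule star_ideal_cong_ops)
lift_definition minus_proj_alg :: "proj_alg \<Rightarrow> proj_alg \<Rightarrow> proj_alg" is "(-)"
  by (rule star_ideal_cong_ops)
lift_definition uminus_proj_alg :: "proj_alg \<Rightarrow> proj_alg" is uminus
  by (rule star_ideal_cong_ops1)
lift_definition times_proj_alg :: "proj_alg \<Rightarrow> proj_alg \<Rightarrow> proj_alg" is "(*)"
  by (rule star_ideal_cong_ops)
lift_definition scaleC_proj_alg :: "complex \<Rightarrow> proj_alg \<Rightarrow> proj_alg" is scale_poly
  by (rule star_ideal_cong_ops1)
lift_definition star_proj_alg :: "proj_alg \<Rightarrow> proj_alg" is star_poly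
  by (rule star_ideal_cong_ops1)
instance
  by standard (transfer; simp add: star_poly_algebra_simps algebra_simps; fail)+
end

lift_definition proj_monomial :: "proj_letter list \<Rightarrow> proj_alg" is "\<lambda>w. monomial (Word w)" .

lemma proj_monomial_mult: "proj_monomial u * proj_monomial v = proj_monomial (u @ v)"
  by transfer (simp add: mult_single plus_word_def)

lemma star_proj_monomial: "star (proj_monomial w) = proj_monomial (rev (map letter_star w))"
  by transfer (simp add: star_poly_single adj_word_def invol_proj_letter_def)

lemma proj_monomial_Nil: "proj_monomial [] = 1"
  by transfer (simp flip: zero_word_def)

lemma proj_relations:
  "proj_monomial [Let_p] * proj_monomial [Let_p] = proj_monomial [Let_p]"
  "proj_monomial [Let_p_star] = proj_monomial [Let_p]"
  "proj_monomial [Let_q] * proj_monomial [Let_q] = proj_monomial [Let_q]"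
  "proj_monomial [Let_q_star] = proj_monomial [Let_q]"
proof -
  have *: "star_ideal_cong proj_relators x y" if "x - y \<in> proj_relators" for x y
    using star_ideal_cong_relator[OF that] by (simp add: star_ideal_cong_def)
  show "proj_monomial [Let_p] * proj_monomial [Let_p] = proj_monomial [Let_p]"
    "proj_monomial [Let_p_star] = proj_monomial [Let_p]"
    "proj_monomial [Let_q] * proj_monomial [Let_q] = proj_monomial [Let_q]"
    "proj_monomial [Let_q_star] = proj_monomial [Let_q]"
    by (transfer; rule *; simp add: proj_relators_def Let_def power2_eq_square)+
qed

lemma cstar_seminorm_proj_monomial_le:
  assumes s: "cstar_seminorm s" shows "s (proj_monomial w) \<le> 1"
proof (induction w)
  case Nil
  show ?case by (simp add: proj_monomial_Nil cstar_seminorm_one_le[OF s])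
next
  case (Cons a w)
  have p: "s (proj_monomial [Let_p]) \<le> 1"
    using cstar_seminormD(4)[OF s, of "proj_monomial [Let_p]"]
    by (intro real_idempotent_le_one) (simp add: star_proj_monomial proj_relations power2_eq_square)
  have q: "s (proj_monomial [Let_q]) \<le> 1"
    using cstar_seminormD(4)[OF s, of "proj_monomial [Let_q]"]
    by (intro real_idempotent_le_one) (simp add: star_proj_monomial proj_relations power2_eq_square)
  have "s (proj_monomial [a]) \<le> 1"
    by (cases a) (simp_all add: p q proj_relations)
  then have "s (proj_monomial [a]) * s (proj_monomial w) \<le> 1"
    using Cons by (simp add: mult_le_one cstar_seminorm_nonneg[OF s])
  then show ?case
    using cstar_seminormD(3)[OF s, of "proj_monomial [a]" "proj_monomial w"]
    by (simp add: proj_monomial_mult)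
qed

instance proj_alg :: enveloped_star_algebra
proof
  fix x :: proj_alg
  show "\<exists>K. \<forall>s. cstar_seminorm s \<longrightarrow> s x \<le> K"
  proof (induction x)
    case (1 f)
    show ?case
    proof (induction f rule: poly_mapping_single_induct)
      case 1
      then show ?case
        by (auto intro!: exI[of _ 0] simp: cstar_seminorm_0 simp flip: zero_proj_alg.abs_eq)
    next
      case (2 k c f)
      then obtain K where K: "\<And>s. cstar_seminorm s \<Longrightarrow> s (abs_proj_alg f) \<le> K" by blast
      have eq: "abs_proj_alg (Poly_Mapping.single k c + f)
          = c *\<^sub>C proj_monomial (letters k) + abs_proj_alg f"
        by (simp add: proj_monomial.abs_eq scaleC_proj_alg.abs_eq plus_proj_alg.abs_eq scale_poly_single)
      have "s (c *\<^sub>C proj_monomial (letters k) + abs_proj_alg f) \<le> cmod c * 1 + K"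
        if s: "cstar_seminorm s" for s
        using cstar_seminormD(1)[OF s, of "c *\<^sub>C proj_monomial (letters k)" "abs_proj_alg f"] K[OF s]
          mult_left_mono[OF cstar_seminorm_proj_monomial_le[OF s, of "letters k"] norm_ge_zero[of c]]
        by (simp add: cstar_seminormD(2)[OF s])
      then show ?case unfolding eq by blast
    qed
  qed
qed

text \<open>
  The algebraic tensor product of \<open>'a\<close> and \<open>'b\<close> is the free vector space on pairs modulo bilinearity.
  That free vector space is the monoid algebra of the product of the multiplicative monoids of \<open>'a\<close>
  and \<open>'b\<close>, whose multiplication is \<open>(a \<otimes> b) (a' \<otimes> b') = a a' \<otimes> b b'\<close>. Multiplying a bilinearity
  relator by a simple tensor, or applying the involution to it, gives a multiple of such a relator
  again, so the linear span of the relators is already a two-sided \<^emph>\<open>*\<close>-ideal.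
\<close>

datatype ('a, 'b) simple_tensor = Simple_Tensor 'a 'b

instantiation simple_tensor :: (complex_star_algebra, complex_star_algebra) star_monoid
begin
definition zero_simple_tensor :: "('a, 'b) simple_tensor"
  where "zero_simple_tensor = Simple_Tensor 1 1"
fun plus_simple_tensor :: "('a, 'b) simple_tensor \<Rightarrow> ('a, 'b) simple_tensor \<Rightarrow> ('a, 'b) simple_tensor"
  where "plus_simple_tensor (Simple_Tensor a b) (Simple_Tensor a' b') = Simple_Tensor (a * a') (b * b')"
fun adj_simple_tensor :: "('a, 'b) simple_tensor \<Rightarrow> ('a, 'b) simple_tensor"
  where "adj_simple_tensor (Simple_Tensor a b) = Simple_Tensor (star a) (star b)"
instance
proof
  fix x y z :: "('a, 'b) simple_tensor"
  show "x + y + z = x + (y + z)" by (cases x; cases y; cases z) (simp add: mult.assoc)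
  show "0 + x = x" "x + 0 = x" by (cases x; simp add: zero_simple_tensor_def)+
  show "adj (adj x) = x" by (cases x) (simp add: star_star)
  show "adj (x + y) = adj y + adj x" by (cases x; cases y) (simp add: star_mult)
qed
end

definition bilinear_relators ::
  "(('a::complex_star_algebra, 'b::complex_star_algebra) simple_tensor \<Rightarrow>\<^sub>0 complex) set"
  where "bilinear_relators =
    (let t = (\<lambda>a b. monomial (Simple_Tensor a b)) in
      {t (a + a') b - t a b - t a' b | a a' b. True} \<union>
      {t a (b + b') - t a b - t a b' | a b b'. True} \<union>
      {t (c *\<^sub>C a) b - scale_poly c (t a b) | c a b. True} \<union>
      {t a (c *\<^sub>C b) - scale_poly c (t a b) | c a b. True})"

quotient_type (overloaded) ('a, 'b) alg_tensor =
  "('a::complex_star_algebra, 'b::complex_star_algebra) simple_tensor \<Rightarrow>\<^sub>0 complex" /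
  "star_ideal_cong bilinear_relators"
  by (rule star_ideal_cong_equivp)

instantiation alg_tensor :: (complex_star_algebra, complex_star_algebra) complex_star_algebra
begin
lift_definition zero_alg_tensor :: "('a, 'b) alg_tensor" is 0 .
lift_definition one_alg_tensor :: "('a, 'b) alg_tensor" is 1 .
lift_definition plus_alg_tensor :: "('a, 'b) alg_tensor \<Rightarrow> ('a, 'b) alg_tensor \<Rightarrow> ('a, 'b) alg_tensor" is "(+)"
  by (rule star_ideal_cong_ops)
lift_definition minus_alg_tensor :: "('a, 'b) alg_tensor \<Rightarrow> ('a, 'b) alg_tensor \<Rightarrow> ('a, 'b) alg_tensor" is "(-)"
  by (rule star_ideal_cong_ops)
lift_definition uminus_alg_tensor :: "('a, 'b) alg_tensor \<Rightarrow> ('a, 'b) alg_tensor" is uminus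
  by (rule star_ideal_cong_ops1)
lift_definition times_alg_tensor :: "('a, 'b) alg_tensor \<Rightarrow> ('a, 'b) alg_tensor \<Rightarrow> ('a, 'b) alg_tensor" is "(*)"
  by (rule star_ideal_cong_ops)
lift_definition scaleC_alg_tensor :: "complex \<Rightarrow> ('a, 'b) alg_tensor \<Rightarrow> ('a, 'b) alg_tensor" is scale_poly
  by (rule star_ideal_cong_ops1)
lift_definition star_alg_tensor :: "('a, 'b) alg_tensor \<Rightarrow> ('a, 'b) alg_tensor" is star_poly
  by (rule star_ideal_cong_ops1)
instance
  by standard (transfer; simp add: star_poly_algebra_simps algebra_simps; fail)+
end

lift_definition alg_tensor :: "'a::complex_star_algebra \<Rightarrow> 'b::complex_star_algebra \<Rightarrow> ('a, 'b) alg_tensor"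
  is "\<lambda>a b. monomial (Simple_Tensor a b)" .

lemma alg_tensor_bilinear:
  "alg_tensor (a + a') b = alg_tensor a b + alg_tensor a' b"
  "alg_tensor a (b + b') = alg_tensor a b + alg_tensor a b'"
  "alg_tensor (c *\<^sub>C a) b = c *\<^sub>C alg_tensor a b"
  "alg_tensor a (c *\<^sub>C b) = c *\<^sub>C alg_tensor a b"
proof -
  have *: "star_ideal_cong bilinear_relators x y" if "x - y \<in> bilinear_relators"
    for x y :: "('a, 'b) simple_tensor \<Rightarrow>\<^sub>0 complex"
    using star_ideal_cong_relator[OF that] by (simp add: star_ideal_cong_def)
  show "alg_tensor (a + a') b = alg_tensor a b + alg_tensor a' b"
    "alg_tensor a (b + b') = alg_tensor a b + alg_tensor a b'"
    "alg_tensor (c *\<^sub>C a) b = c *\<^sub>C alg_tensor a b"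
    "alg_tensor a (c *\<^sub>C b) = c *\<^sub>C alg_tensor a b"
    by (transfer, rule *, unfold bilinear_relators_def Let_def diff_diff_eq[symmetric], blast)+
qed

lemma alg_tensor_mult: "alg_tensor a b * alg_tensor a' b' = alg_tensor (a * a') (b * b')"
  by transfer (simp add: mult_single)

lemma star_alg_tensor: "star (alg_tensor a b) = alg_tensor (star a) (star b)"
  by transfer (simp add: star_poly_single)

lemma alg_tensor_1: "alg_tensor 1 1 = 1"
  by transfer (simp flip: zero_simple_tensor_def)

lemma cstar_seminorm_alg_tensor_le:
  fixes s :: "('a::cstar_algebra, 'b::cstar_algebra) alg_tensor \<Rightarrow> real"
  assumes s: "cstar_seminorm s"
  shows "s (alg_tensor a b) \<le> norm a * norm b"
proof -
  note d = cstar_seminormD[OF s]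
  have sq: "s (alg_tensor (star a * a) (star b * b)) = (s (alg_tensor a b))\<^sup>2" for a b
    using d(4)[of "alg_tensor a b"] by (simp add: star_alg_tensor alg_tensor_mult)
  have 1: "cstar_seminorm (\<lambda>a. s (alg_tensor a 1))"
    unfolding cstar_seminorm_def
    using d(3)[of "alg_tensor _ 1" "alg_tensor _ 1"] sq[of _ 1]
    by (simp add: alg_tensor_bilinear d(1,2) alg_tensor_mult star_1)
  have 2: "cstar_seminorm (\<lambda>b. s (alg_tensor 1 b))"
    unfolding cstar_seminorm_def
    using d(3)[of "alg_tensor 1 _" "alg_tensor 1 _"] sq[of 1]
    by (simp add: alg_tensor_bilinear d(1,2) alg_tensor_mult star_1)
  have "s (alg_tensor a b) \<le> s (alg_tensor a 1) * s (alg_tensor 1 b)"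
    using d(3)[of "alg_tensor a 1" "alg_tensor 1 b"] by (simp add: alg_tensor_mult)
  also have "\<dots> \<le> norm a * norm b"
    by (rule mult_mono[OF cstar_seminorm_le_norm[OF 1] cstar_seminorm_le_norm[OF 2]
          norm_ge_zero cstar_seminorm_nonneg[OF s]])
  finally show ?thesis .
qed

instance alg_tensor :: (cstar_algebra, cstar_algebra) enveloped_star_algebra
proof
  fix x :: "('a, 'b) alg_tensor"
  show "\<exists>K. \<forall>s. cstar_seminorm s \<longrightarrow> s x \<le> K"
  proof (induction x)
    case (1 f)
    show ?case
    proof (induction f rule: poly_mapping_single_induct)
      case 1
      then show ?case
        by (auto intro!: exI[of _ 0] simp: cstar_seminorm_0 simp flip: zero_alg_tensor.abs_eq)
    next
      case (2 k c f)
      then obtain K where K: "\<And>s. cstar_seminorm s \<Longrightarrow> s (abs_alg_tensor f) \<le> K" by blast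
      obtain a b where k: "k = Simple_Tensor a b" by (cases k)
      have eq: "abs_alg_tensor (Poly_Mapping.single k c + f)
          = c *\<^sub>C alg_tensor a b + abs_alg_tensor f"
        by (simp add: k alg_tensor.abs_eq scaleC_alg_tensor.abs_eq plus_alg_tensor.abs_eq scale_poly_single)
      have "s (c *\<^sub>C alg_tensor a b + abs_alg_tensor f) \<le> cmod c * (norm a * norm b) + K"
        if s: "cstar_seminorm s" for s
        using cstar_seminormD(1)[OF s, of "c *\<^sub>C alg_tensor a b" "abs_alg_tensor f"] K[OF s]
          mult_left_mono[OF cstar_seminorm_alg_tensor_le[OF s, of a b] norm_ge_zero[of c]]
        by (simp add: cstar_seminormD(2)[OF s])
      then show ?case unfolding eq by blast
    qed
  qed
qed

type_synonym two_proj_cstar = "proj_alg cstar_envelope"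

definition proj_p :: two_proj_cstar where "proj_p = to_envelope (proj_monomial [Let_p])"
definition proj_q :: two_proj_cstar where "proj_q = to_envelope (proj_monomial [Let_q])"

text \<open>
  The envelope of the algebraic tensor product is the maximal \<open>C\<^sup>*\<close>-tensor product. It agrees with the
  minimal one if one of the factors is nuclear, as the universal \<open>C\<^sup>*\<close>-algebra of two projections is.
\<close>

type_synonym ('a, 'b) cstar_tensor = "('a, 'b) alg_tensor cstar_envelope"

definition cstar_tensor :: "'a::cstar_algebra \<Rightarrow> 'b::cstar_algebra \<Rightarrow> ('a, 'b) cstar_tensor" (infixr "\<otimes>" 72)
  where "a \<otimes> b = to_envelope (alg_tensor a b)"

type_synonym two_proj_cstar3 = "(two_proj_cstar, (two_proj_cstar, two_proj_cstar) cstar_tensor) cstar_tensor"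

text \<open>
  The four elements of the index type \<^typ>\<open>4\<close> are \<open>1, 2, 3, 4\<close> (with \<open>4 = 0\<close>), and \<^const>\<open>vector\<close> lists the
  entries in this order.
\<close>

definition R_matrix :: "two_proj_cstar^4^4"
  where "R_matrix = (let p = proj_p; q = proj_q in vector
    [vector [p,     0,     1 - p, 0],
     vector [1 - p, 0,     p,     0],
     vector [0,     q,     0,     1 - q],
     vector [0,     1 - q, 0,     q]])"

definition M_matrix :: "two_proj_cstar3^4^4"
  where "M_matrix = (\<chi> i j. \<Sum>k\<in>UNIV. \<Sum>l\<in>UNIV.
    R_matrix $ i $ k \<otimes> R_matrix $ k $ l \<otimes> R_matrix $ l $ j)"

type_synonym 'n ncpoly = "('n \<times> 'n) word \<Rightarrow>\<^sub>0 complex"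

definition ncvar :: "'n \<Rightarrow> 'n \<Rightarrow> 'n ncpoly"
  where "ncvar i j = monomial (Word [(i, j)])"

text \<open>By convention the zero polynomial has degree \<open>0\<close>.\<close>

definition ncdegree :: "'n ncpoly \<Rightarrow> nat"
  where "ncdegree P = Max (insert 0 ((\<lambda>w. length (letters w)) ` Poly_Mapping.keys P))"

definition magic_relators :: "'n::finite ncpoly set"
  where "magic_relators =
    {(ncvar i j)\<^sup>2 - ncvar i j | i j. True} \<union>
    {(\<Sum>k\<in>UNIV. ncvar i k) - 1 | i. True} \<union>
    {(\<Sum>k\<in>UNIV. ncvar k j) - 1 | j. True} \<union>
    {ncvar i j * ncvar i k | i j k. j \<noteq> k} \<union>
    {ncvar j i * ncvar k i | i j k. j \<noteq> k}"

definition magic_ideal :: "'n::finite ncpoly set"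
  where "magic_ideal = ideal_generated magic_relators"

definition nceval :: "'d::complex_star_algebra^'n^'n \<Rightarrow> 'n::finite ncpoly \<Rightarrow> 'd"
  where "nceval D P = (\<Sum>w\<in>Poly_Mapping.keys P.
    Poly_Mapping.lookup P w *\<^sub>C prod_list (map (\<lambda>(i, j). D $ i $ j) (letters w)))"

definition separating :: "'d::cstar_algebra^'n^'n \<Rightarrow> 'n::finite ncpoly \<Rightarrow> bool"
  where "separating D P \<longleftrightarrow> P \<noteq> 0 \<and> nceval D P = 0 \<and> P \<notin> magic_ideal"

lemma nceval_superset:
  assumes "finite W" "Poly_Mapping.keys P \<subseteq> W"
  shows "nceval D P = (\<Sum>w\<in>W.
    Poly_Mapping.lookup P w *\<^sub>C prod_list (map (\<lambda>(i, j). D $ i $ j) (letters w)))"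
  unfolding nceval_def using assms
  by (intro sum.mono_neutral_left) (auto simp: in_keys_iff scaleC_0_left)

lemma nceval_add: "nceval D (P + Q) = nceval D P + nceval D Q"
proof -
  have "finite (Poly_Mapping.keys P \<union> Poly_Mapping.keys Q)" by simp
  note * = nceval_superset[OF this]
  show ?thesis
    by (subst (1 2 3) *) (auto simp: keys_add lookup_add scaleC_add_left sum.distrib)
qed

lemma nceval_single:
  "nceval D (Poly_Mapping.single w c) = c *\<^sub>C prod_list (map (\<lambda>(i, j). D $ i $ j) (letters w))"
  by (simp add: nceval_def scaleC_0_left)

lemma nceval_0: "nceval D 0 = 0"
  by (simp add: nceval_def)

lemma nceval_mult: "nceval D (P * Q) = nceval D P * nceval D Q"
proof (induction P rule: poly_mapping_single_induct)
  case 1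
  then show ?case by (simp add: nceval_0)
next
  case (2 k c P)
  have "nceval D (Poly_Mapping.single k c * Q) = nceval D (Poly_Mapping.single k c) * nceval D Q"
    by (induction Q rule: poly_mapping_single_induct)
      (simp_all add: nceval_0 nceval_add nceval_single mult_single plus_word_def distrib_left
        mult_scaleC_left mult_scaleC_right scaleC_scaleC mult.commute)
  with 2 show ?case by (simp add: nceval_add distrib_right)
qed

lemma nceval_1: "nceval D 1 = 1"
  using nceval_single[of D 0 1] by (simp add: scaleC_one) (simp add: zero_word_def)

lemma nceval_ncvar: "nceval D (ncvar i j) = D $ i $ j"
  by (simp add: ncvar_def nceval_single scaleC_one)

end

theory Submission
  imports Defs "HOL-Library.Multiset"
begin

text \<open>
  There is no separating polynomial of any degree. The quantum permutation group of four points is a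
  cocycle twist of \<open>SO(3)\<close>, and modulo the magic unitary ideal every polynomial is a combination of
  even words in four anticommuting letters \<open>q\<^sub>0, q\<^sub>1, q\<^sub>2, q\<^sub>3\<close> with \<open>q\<^sub>0\<^sup>2 + q\<^sub>1\<^sup>2 + q\<^sub>2\<^sup>2 + q\<^sub>3\<^sup>2 = 1\<close>,
  twisted by translations of the Klein four-group; so it is a combination of ordered monomials of even
  degree in which \<open>q\<^sub>0\<close> occurs at most once. The universal algebra of two projections corresponds to
  the subgroup \<open>O(2)\<close> of \<open>SO(3)\<close>, and the three tensor factors to rotations about two alternating
  axes. Every rotation is such a product, with its Euler angles. Hence the representations of the
  triple tensor product on \<open>\<complex>\<^sup>8\<close> given by three angles evaluate the monomials, up to sign, at every
  unit quaternion, and the monomials are linearly independent as functions on the three-sphere.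
\<close>

section \<open>Representations of enveloping algebras and tensor products\<close>

text \<open>The anticommutation comes from two different kinds of relations. A Fourier transform
  over the Klein four-group turns generators into pairs of letters. Equality of row and column sums
  lets the two letters of one pair anticommute; orthogonality within rows and columns lets the
  adjacent letters of two consecutive pairs anticommute. Only the multiset of letters then matters,
  up to sign. The completed tensor products are reached through finite-dimensional representations:
  the operator norm of one is a C*-seminorm, hence bounded by the enveloping norm, so the
  representation extends by continuity. The obstacle is that the representations of the three legs
  must still commute after the extension; for this reason every construction carries an inclusion of
  commutants. The sign with which a monomial is evaluated depends on the word and on the starting
  vector, but not on the angles. Vanishing in all these representations is therefore vanishing of
  fixed combinations of commutative monomials on the whole sphere.\<close>

lemma norm_vector_scalar_mult: "norm (c *s v) = cmod c * norm v"
  for v :: "complex^'n"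
  by (simp add: norm_vec_def L2_set_right_distrib[symmetric] norm_mult)

lemma inner_vector_scalar_mult: "(c *s v) \<bullet> w = v \<bullet> (cnj c *s w)"
  for v w :: "complex^'n"
  by (simp add: inner_vec_def inner_complex_def algebra_simps)

definition complex_linear :: "(complex^'n \<Rightarrow> complex^'m) \<Rightarrow> bool"
  where "complex_linear T \<longleftrightarrow> (\<forall>v w. T (v + w) = T v + T w) \<and> (\<forall>c v. T (c *s v) = c *s T v)"

lemma scaleR_eq_vector_scalar_mult: "r *\<^sub>R v = complex_of_real r *s v" for v :: "complex^'n"
  by (simp add: vec_eq_iff) (simp add: scaleR_conv_of_real)

lemma complex_linear_imp_linear: "complex_linear T \<Longrightarrow> linear T"
  by (rule linearI) (simp_all add: complex_linear_def scaleR_eq_vector_scalar_mult)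

lemma complex_linear_bounded: "complex_linear T \<Longrightarrow> bounded_linear T"
  using complex_linear_imp_linear linear_conv_bounded_linear by blast

lemma complex_linear_simps:
  assumes "complex_linear T"
  shows "T (v + w) = T v + T w" "T (c *s v) = c *s T v" "T 0 = 0" "T (sum f A) = (\<Sum>i\<in>A. T (f i))"
    "T (v - w) = T v - T w"
  using assms complex_linear_imp_linear[OF assms]
  by (auto simp: complex_linear_def linear_0 linear_sum linear_diff)

text \<open>Commuting with a fixed linear map survives sums, products and limits. Inclusions between
  commutants therefore carry commutation from the given operators over to a completed
  algebra.\<close>

definition commutant :: "('x \<Rightarrow> complex^'n \<Rightarrow> complex^'n) \<Rightarrow> (complex^'n \<Rightarrow> complex^'n) set"
  where "commutant f = {T. complex_linear T \<and> (\<forall>x v. f x (T v) = T (f x v))}"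

lemma commutantD:
  assumes "T \<in> commutant f" shows "complex_linear T" "f x (T v) = T (f x v)"
  using assms by (simp_all add: commutant_def)

text \<open>
  The real inner product of the library suffices to express the adjoint: for complex-linear maps the
  real and the complex adjoint coincide.
\<close>

definition star_rep :: "('a::complex_star_algebra \<Rightarrow> complex^'n \<Rightarrow> complex^'n) \<Rightarrow> bool"
  where "star_rep \<rho> \<longleftrightarrow>
    (\<forall>x y v. \<rho> (x + y) v = \<rho> x v + \<rho> y v) \<and>
    (\<forall>c x v. \<rho> (c *\<^sub>C x) v = c *s \<rho> x v) \<and>
    (\<forall>x y v. \<rho> (x * y) v = \<rho> x (\<rho> y v)) \<and>
    (\<forall>v. \<rho> 1 v = v) \<and>
    (\<forall>x. complex_linear (\<rho> x)) \<and>
    (\<forall>x v w. \<rho> x v \<bullet> w = v \<bullet> \<rho> (star x) w)"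

lemma star_repD:
  assumes "star_rep \<rho>"
  shows "\<rho> (x + y) v = \<rho> x v + \<rho> y v" "\<rho> (c *\<^sub>C x) v = c *s \<rho> x v"
    "\<rho> (x * y) v = \<rho> x (\<rho> y v)" "\<rho> 1 v = v" "complex_linear (\<rho> x)"
    "\<rho> x v \<bullet> w = v \<bullet> \<rho> (star x) w"
  using assms unfolding star_rep_def by blast+

lemma star_rep_0: "star_rep \<rho> \<Longrightarrow> \<rho> 0 v = 0"
  using star_repD(1)[of \<rho> 0 0 v] by simp

lemma star_rep_diff: "star_rep \<rho> \<Longrightarrow> \<rho> (x - y) v = \<rho> x v - \<rho> y v"
  using star_repD(1)[of \<rho> "x - y" y v] by simp

lemma star_rep_sum: "star_rep \<rho> \<Longrightarrow> \<rho> (sum f A) v = (\<Sum>i\<in>A. \<rho> (f i) v)"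
  by (induction A rule: infinite_finite_induct) (simp_all add: star_rep_0 star_repD(1))

text \<open>The half \<open>ge\<close> of the C*-identity is the Cauchy-Schwarz inequality for the
  inner product of \<open>v\<close> with \<open>\<rho> (star x * x) v\<close>. The other half is
  submultiplicativity plus invariance under \<open>star\<close>, which follows from
  \<open>ge\<close> by cancelling a factor.\<close>

lemma cstar_seminorm_onorm:
  fixes \<rho> :: "'a::complex_star_algebra \<Rightarrow> complex^'n \<Rightarrow> complex^'n"
  assumes \<rho>: "star_rep \<rho>"
  shows "cstar_seminorm (\<lambda>x. onorm (\<rho> x))"
proof -
  have bl: "bounded_linear (\<rho> x)" for x by (rule complex_linear_bounded[OF star_repD(5)[OF \<rho>]])
  note nn = onorm_pos_le[OF bl] and le = onorm[OF bl]
  have add: "onorm (\<rho> (x + y)) \<le> onorm (\<rho> x) + onorm (\<rho> y)" for x y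
  proof -
    have "\<rho> (x + y) = (\<lambda>v. \<rho> x v + \<rho> y v)" by (rule ext) (rule star_repD(1)[OF \<rho>])
    with onorm_triangle[OF bl bl, of x y] show ?thesis by simp
  qed
  have scale: "onorm (\<rho> (c *\<^sub>C x)) \<le> cmod c * onorm (\<rho> x)" for c x
    by (rule onorm_le)
      (use le[of x] in \<open>simp add: star_repD(2)[OF \<rho>] norm_vector_scalar_mult mult.assoc mult_left_mono\<close>)
  have scale': "onorm (\<rho> (c *\<^sub>C x)) = cmod c * onorm (\<rho> x)" for c x
  proof (cases "c = 0")
    case True
    then show ?thesis using scale[of 0 x] nn[of "0 *\<^sub>C x"] by simp
  next
    case False
    then have "onorm (\<rho> x) \<le> inverse (cmod c) * onorm (\<rho> (c *\<^sub>C x))"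
      using scale[of "inverse c" "c *\<^sub>C x"] by (simp add: scaleC_scaleC scaleC_one norm_inverse)
    with False scale[of c x] show ?thesis by (simp add: field_simps)
  qed
  have mult: "onorm (\<rho> (x * y)) \<le> onorm (\<rho> x) * onorm (\<rho> y)" for x y
  proof -
    have "\<rho> (x * y) = \<rho> x \<circ> \<rho> y" by (rule ext) (simp add: star_repD(3)[OF \<rho>])
    with onorm_compose[OF bl bl, of x y] show ?thesis by simp
  qed
  have ge: "(onorm (\<rho> x))\<^sup>2 \<le> onorm (\<rho> (star x * x))" for x
  proof -
    have "onorm (\<rho> x) \<le> sqrt (onorm (\<rho> (star x * x)))"
    proof (rule onorm_le)
      fix v
      have "(norm (\<rho> x v))\<^sup>2 = v \<bullet> \<rho> (star x * x) v"
        by (simp add: power2_norm_eq_inner star_repD(3,6)[OF \<rho>])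
      also have "\<dots> \<le> norm v * norm (\<rho> (star x * x) v)" by (rule norm_cauchy_schwarz)
      also have "\<dots> \<le> norm v * (onorm (\<rho> (star x * x)) * norm v)"
        by (rule mult_left_mono[OF le norm_ge_zero])
      also have "\<dots> = (sqrt (onorm (\<rho> (star x * x))) * norm v)\<^sup>2"
        using nn by (simp add: power_mult_distrib power2_eq_square)
      finally show "norm (\<rho> x v) \<le> sqrt (onorm (\<rho> (star x * x))) * norm v"
        by (rule power2_le_imp_le) (simp add: nn)
    qed
    then show ?thesis
      using power_mono[OF _ nn, of x "sqrt (onorm (\<rho> (star x * x)))" 2] nn by simp
  qed
  have star_le: "onorm (\<rho> x) \<le> onorm (\<rho> (star x))" for x
  proof (cases "onorm (\<rho> x) = 0")
    case False
    have "onorm (\<rho> x) * onorm (\<rho> x) \<le> onorm (\<rho> (star x)) * onorm (\<rho> x)"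
      using ge[of x] mult[of "star x" x] by (simp add: power2_eq_square)
    with False nn[of x] show ?thesis by (metis mult_le_cancel_right order_le_less)
  qed (use nn in simp)
  have star_eq: "onorm (\<rho> (star x)) = onorm (\<rho> x)" for x
    using star_le[of x] star_le[of "star x"] by (simp add: star_star)
  have "onorm (\<rho> (star x * x)) = (onorm (\<rho> x))\<^sup>2" for x
    using ge[of x] mult[of "star x" x] by (simp add: star_eq power2_eq_square)
  with add scale' mult show ?thesis
    unfolding cstar_seminorm_def by blast
qed

lemma norm_star_rep_le:
  fixes x :: "'a::enveloped_star_algebra"
  assumes "star_rep \<rho>"
  shows "norm (\<rho> x v) \<le> env_norm x * norm v"
proof -
  have "norm (\<rho> x v) \<le> onorm (\<rho> x) * norm v"
    by (rule onorm[OF complex_linear_bounded[OF star_repD(5)[OF assms]]])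
  also have "\<dots> \<le> env_norm x * norm v"
    by (rule mult_right_mono[OF le_env_norm[OF cstar_seminorm_onorm[OF assms]] norm_ge_zero])
  finally show ?thesis .
qed

text \<open>The limit is taken along a chosen representative; by \<open>envelope_rep_tendsto\<close>
  every representing Cauchy sequence yields the same value.\<close>

definition envelope_rep ::
  "('a::enveloped_star_algebra \<Rightarrow> complex^'n \<Rightarrow> complex^'n) \<Rightarrow> 'a cstar_envelope \<Rightarrow> complex^'n \<Rightarrow> complex^'n"
  where "envelope_rep \<rho> x v = lim (\<lambda>n. \<rho> (rep_cstar_envelope x n) v)"

lemma envelope_rep_tendsto:
  assumes \<rho>: "star_rep \<rho>" and X: "env_Cauchy X"
  shows "(\<lambda>n. \<rho> (X n) v) \<longlonglongrightarrow> envelope_rep \<rho> (abs_cstar_envelope X) v"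
proof -
  define R where "R = rep_cstar_envelope (abs_cstar_envelope X)"
  have rel: "env_rel R X"
    unfolding R_def by (rule Quotient_rep_abs[OF Quotient_cstar_envelope]) (simp add: env_rel_refl X)
  then have R: "env_Cauchy R" and lim: "(\<lambda>n. env_norm (R n - X n)) \<longlonglongrightarrow> 0"
    by (simp_all add: env_rel_def)
  have "Cauchy (\<lambda>n. \<rho> (R n) v)"
  proof (rule CauchyI)
    fix e :: real assume "0 < e"
    then have "0 < e / (norm v + 1)" by (simp add: add_nonneg_pos)
    then obtain N where N: "\<And>m n. m \<ge> N \<Longrightarrow> n \<ge> N \<Longrightarrow> env_norm (R m - R n) < e / (norm v + 1)"
      using R unfolding env_Cauchy_def by blast
    have "norm (\<rho> (R m) v - \<rho> (R n) v) < e" if "m \<ge> N" "n \<ge> N" for m n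
    proof -
      have "norm (\<rho> (R m) v - \<rho> (R n) v) \<le> env_norm (R m - R n) * norm v"
        using norm_star_rep_le[OF \<rho>, of "R m - R n" v] by (simp add: star_rep_diff[OF \<rho>])
      also have "\<dots> \<le> env_norm (R m - R n) * (norm v + 1)"
        by (rule mult_left_mono) (simp_all add: env_norm_nonneg)
      also have "\<dots> < e"
        using N[OF that] by (simp add: pos_less_divide_eq add_nonneg_pos)
      finally show ?thesis .
    qed
    then show "\<exists>N. \<forall>m\<ge>N. \<forall>n\<ge>N. norm (\<rho> (R m) v - \<rho> (R n) v) < e" by blast
  qed
  then have 1: "(\<lambda>n. \<rho> (R n) v) \<longlonglongrightarrow> envelope_rep \<rho> (abs_cstar_envelope X) v"
    unfolding envelope_rep_def R_def[symmetric]
    using Cauchy_convergent convergent_LIMSEQ_iff by blast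
  have "(\<lambda>n. env_norm (R n - X n) * norm v) \<longlonglongrightarrow> 0"
    using tendsto_mult_left_zero[OF lim] .
  then have "(\<lambda>n. \<rho> (R n) v - \<rho> (X n) v) \<longlonglongrightarrow> 0"
    by (rule Lim_null_comparison[rotated])
      (use norm_star_rep_le[OF \<rho>] in \<open>simp flip: star_rep_diff[OF \<rho>]\<close>)
  from tendsto_diff[OF 1 this] show ?thesis by simp
qed

lemma envelope_rep_to_envelope:
  assumes "star_rep \<rho>" shows "envelope_rep \<rho> (to_envelope x) v = \<rho> x v"
  unfolding to_envelope.abs_eq
  by (rule LIMSEQ_unique[OF envelope_rep_tendsto[OF assms env_Cauchy_const] tendsto_const])

lemma commutant_envelope_rep:
  assumes \<rho>: "star_rep \<rho>" shows "commutant \<rho> \<subseteq> commutant (envelope_rep \<rho>)"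
proof
  fix T assume T: "T \<in> commutant \<rho>"
  have "envelope_rep \<rho> x (T v) = T (envelope_rep \<rho> x v)" for x v
  proof -
    obtain X where X: "env_Cauchy X" "x = abs_cstar_envelope X" by (rule abs_cases)
    show ?thesis unfolding X(2)
      using LIMSEQ_unique[OF envelope_rep_tendsto[OF \<rho> X(1), of "T v", unfolded commutantD(2)[OF T]]
          bounded_linear.tendsto[OF complex_linear_bounded[OF commutantD(1)[OF T]]
            envelope_rep_tendsto[OF \<rho> X(1), of v]]] .
  qed
  with T show "T \<in> commutant (envelope_rep \<rho>)" by (simp add: commutant_def)
qed

lemma tendsto_vector_scalar_mult:
  fixes f :: "nat \<Rightarrow> complex^'n"
  assumes "f \<longlonglongrightarrow> v" shows "(\<lambda>n. c *s f n) \<longlonglongrightarrow> c *s v"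
proof -
  have "complex_linear (\<lambda>v::complex^'n. c *s v)"
    by (simp add: complex_linear_def vec_eq_iff algebra_simps)
  from bounded_linear.tendsto[OF complex_linear_bounded[OF this] assms] show ?thesis .
qed

lemma star_rep_envelope_rep:
  fixes \<rho> :: "'a::enveloped_star_algebra \<Rightarrow> complex^'n \<Rightarrow> complex^'n"
  assumes \<rho>: "star_rep \<rho>"
  shows "star_rep (envelope_rep \<rho>)"
proof -
  note D = star_repD[OF \<rho>] and lim = envelope_rep_tendsto[OF \<rho>]
  let ?E = "envelope_rep \<rho>"
  have add: "?E (x + y) v = ?E x v + ?E y v" for x y v
  proof -
    obtain X where X: "env_Cauchy X" "x = abs_cstar_envelope X" by (rule abs_cases)
    obtain Y where Y: "env_Cauchy Y" "y = abs_cstar_envelope Y" by (rule abs_cases)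
    show ?thesis unfolding X(2) Y(2) abs_eqs(4)[OF X(1) Y(1)]
      using LIMSEQ_unique[OF lim[OF env_Cauchy_add[OF X(1) Y(1)], unfolded D(1)]
          tendsto_add[OF lim[OF X(1)] lim[OF Y(1)]]] .
  qed
  have scale: "?E (c *\<^sub>C x) v = c *s ?E x v" for c x v
  proof -
    obtain X where X: "env_Cauchy X" "x = abs_cstar_envelope X" by (rule abs_cases)
    show ?thesis unfolding X(2) abs_eqs(1)[OF X(1)]
      using LIMSEQ_unique[OF lim[OF env_Cauchy_scaleC[OF X(1)], unfolded D(2)]
          tendsto_vector_scalar_mult[OF lim[OF X(1)]]] .
  qed
  have lin: "complex_linear (?E x)" for x
    unfolding complex_linear_def
  proof safe
    obtain X where X: "env_Cauchy X" "x = abs_cstar_envelope X" by (rule abs_cases)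
    fix v w :: "complex^'n" and c
    show "?E x (v + w) = ?E x v + ?E x w" unfolding X(2)
      using LIMSEQ_unique[OF lim[OF X(1), of "v + w", unfolded complex_linear_simps(1)[OF D(5)]]
          tendsto_add[OF lim[OF X(1)] lim[OF X(1)]]] .
    show "?E x (c *s v) = c *s ?E x v" unfolding X(2)
      using LIMSEQ_unique[OF lim[OF X(1), of "c *s v", unfolded complex_linear_simps(2)[OF D(5)]]
          tendsto_vector_scalar_mult[OF lim[OF X(1)]]] .
  qed
  have mult: "?E (x * y) v = ?E x (?E y v)" for x y v
  proof -
    obtain X where X: "env_Cauchy X" "x = abs_cstar_envelope X" by (rule abs_cases)
    obtain Y where Y: "env_Cauchy Y" "y = abs_cstar_envelope Y" by (rule abs_cases)
    \<comment> \<open>Operator and vector both vary with \<open>n\<close>; a uniform bound on the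
      operators allows the inner vector to be replaced by its limit first.\<close>
    obtain K where K: "\<And>n. env_norm (X n) \<le> K" using env_Cauchy_bounded[OF X(1)] by blast
    let ?w = "?E y v"
    have lY: "(\<lambda>n. \<rho> (Y n) v - ?w) \<longlonglongrightarrow> 0"
      using lim[OF Y(1), of v] unfolding Y(2) by (rule LIM_zero)
    have K0: "(\<lambda>n. K * norm (\<rho> (Y n) v - ?w)) \<longlonglongrightarrow> 0"
      using tendsto_mult_right_zero[OF tendsto_norm_zero[OF lY]] .
    have "norm (\<rho> (X n) (\<rho> (Y n) v) - \<rho> (X n) ?w) \<le> K * norm (\<rho> (Y n) v - ?w)" for n
      using norm_star_rep_le[OF \<rho>, of "X n" "\<rho> (Y n) v - ?w"]
        mult_right_mono[OF K[of n] norm_ge_zero[of "\<rho> (Y n) v - ?w"]]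
      unfolding complex_linear_simps(5)[OF D(5)] by linarith
    then have "(\<lambda>n. \<rho> (X n) (\<rho> (Y n) v) - \<rho> (X n) ?w) \<longlonglongrightarrow> 0"
      by (intro Lim_null_comparison[OF always_eventually K0] allI)
    from tendsto_add[OF this lim[OF X(1), of ?w]]
    have "(\<lambda>n. \<rho> (X n) (\<rho> (Y n) v)) \<longlonglongrightarrow> ?E x ?w"
      by (simp add: X(2))
    then show ?thesis
      using LIMSEQ_unique[OF lim[OF env_Cauchy_mult[OF X(1) Y(1)], of v, unfolded D(3)]]
      unfolding X(2) Y(2) abs_eqs(5)[OF X(1) Y(1)] by blast
  qed
  have one: "?E 1 v = v" for v
    unfolding one_cstar_envelope.abs_eq
    using LIMSEQ_unique[OF lim[OF env_Cauchy_const, of 1 v, unfolded D(4)] tendsto_const] .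
  have adj: "?E x v \<bullet> w = v \<bullet> ?E (star x) w" for x v w
  proof -
    obtain X where X: "env_Cauchy X" "x = abs_cstar_envelope X" by (rule abs_cases)
    show ?thesis unfolding X(2) abs_eqs(2)[OF X(1)]
      using LIMSEQ_unique[OF tendsto_inner[OF lim[OF X(1), of v] tendsto_const[of w]]]
        tendsto_inner[OF tendsto_const[of v] lim[OF env_Cauchy_star[OF X(1)], of w]]
      unfolding D(6) by blast
  qed
  show ?thesis unfolding star_rep_def using add scale mult one lin adj by blast
qed

section \<open>Actions of monoid algebras\<close>

definition monoid_action :: "('m \<Rightarrow> complex^'n \<Rightarrow> complex^'n) \<Rightarrow> ('m \<Rightarrow>\<^sub>0 complex) \<Rightarrow> complex^'n \<Rightarrow> complex^'n"
  where "monoid_action \<mu> F v = (\<Sum>k\<in>Poly_Mapping.keys F. Poly_Mapping.lookup F k *s \<mu> k v)"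

lemma monoid_action_superset:
  assumes "finite K" "Poly_Mapping.keys F \<subseteq> K"
  shows "monoid_action \<mu> F v = (\<Sum>k\<in>K. Poly_Mapping.lookup F k *s \<mu> k v)"
  unfolding monoid_action_def using assms
  by (intro sum.mono_neutral_left) (auto simp: in_keys_iff)

lemma monoid_action_0: "monoid_action \<mu> 0 v = 0"
  by (simp add: monoid_action_def)

lemma monoid_action_single: "monoid_action \<mu> (Poly_Mapping.single k c) v = c *s \<mu> k v"
  by (simp add: monoid_action_def)

lemma monoid_action_add: "monoid_action \<mu> (F + G) v = monoid_action \<mu> F v + monoid_action \<mu> G v"
proof -
  have "finite (Poly_Mapping.keys F \<union> Poly_Mapping.keys G)" by simp
  note * = monoid_action_superset[OF this]
  show ?thesis
    by (subst (1 2 3) *) (auto simp: keys_add lookup_add vector_sadd_rdistrib sum.distrib)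
qed

lemma monoid_action_scale: "monoid_action \<mu> (scale_poly c F) v = c *s monoid_action \<mu> F v"
proof -
  have "Poly_Mapping.keys (scale_poly c F) \<subseteq> Poly_Mapping.keys F"
    by (auto simp: in_keys_iff)
  from monoid_action_superset[OF finite_keys this] show ?thesis
    by (simp add: monoid_action_def vec.scale_sum_right vector_smult_assoc)
qed

lemma monoid_action_diff: "monoid_action \<mu> (F - G) v = monoid_action \<mu> F v - monoid_action \<mu> G v"
  using monoid_action_add[of \<mu> "F - G" G v] by simp

lemma complex_linear_monoid_action:
  assumes "\<And>k. complex_linear (\<mu> k)"
  shows "complex_linear (monoid_action \<mu> F)"
  unfolding complex_linear_def monoid_action_def
  by (simp add: complex_linear_simps[OF assms] vector_add_ldistrib sum.distrib vec.scale_sum_right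
      vector_smult_assoc mult.commute)

lemma monoid_action_mult:
  fixes \<mu> :: "'m::monoid_add \<Rightarrow> complex^'n \<Rightarrow> complex^'n"
  assumes lin: "\<And>k. complex_linear (\<mu> k)" and hom: "\<And>k l v. \<mu> (k + l) v = \<mu> k (\<mu> l v)"
  shows "monoid_action \<mu> (F * G) v = monoid_action \<mu> F (monoid_action \<mu> G v)"
proof (induction F rule: poly_mapping_single_induct)
  case 1
  then show ?case by (simp add: monoid_action_0)
next
  case (2 k c F)
  have "monoid_action \<mu> (Poly_Mapping.single k c * G) v = c *s \<mu> k (monoid_action \<mu> G v)"
    by (induction G rule: poly_mapping_single_induct)
      (simp_all add: monoid_action_0 monoid_action_add monoid_action_single complex_linear_simps[OF lin]
        distrib_left mult_single hom vector_add_ldistrib vector_smult_assoc)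
  with 2 show ?case by (simp add: monoid_action_add monoid_action_single distrib_right)
qed

lemma monoid_action_adj:
  fixes \<mu> :: "'m::star_monoid \<Rightarrow> complex^'n \<Rightarrow> complex^'n"
  assumes lin: "\<And>k. complex_linear (\<mu> k)" and adj: "\<And>k v w. \<mu> k v \<bullet> w = v \<bullet> \<mu> (adj k) w"
  shows "monoid_action \<mu> F v \<bullet> w = v \<bullet> monoid_action \<mu> (star_poly F) w"
  by (induction F rule: poly_mapping_single_induct)
    (simp_all add: monoid_action_0 star_poly_0 monoid_action_add star_poly_add inner_left_distrib
      inner_right_distrib monoid_action_single star_poly_single inner_vector_scalar_mult adj
      complex_linear_simps[OF lin])

text \<open>The elements acting as zero form a two-sided ideal. It contains the stars of the
  relators as well, because an operator vanishes once its adjoint does.\<close>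

lemma monoid_action_cong:
  fixes \<mu> :: "'m::star_monoid \<Rightarrow> complex^'n \<Rightarrow> complex^'n"
  assumes lin: "\<And>k. complex_linear (\<mu> k)" and hom: "\<And>k l v. \<mu> (k + l) v = \<mu> k (\<mu> l v)"
    and adj: "\<And>k v w. \<mu> k v \<bullet> w = v \<bullet> \<mu> (adj k) w"
    and S: "\<And>r v. r \<in> S \<Longrightarrow> monoid_action \<mu> r v = 0"
    and FG: "star_ideal_cong S F G"
  shows "monoid_action \<mu> F v = monoid_action \<mu> G v"
proof -
  let ?K = "{F. \<forall>v. monoid_action \<mu> F v = 0}"
  have "two_sided_ideal ?K"
    unfolding two_sided_ideal_def
    by (auto simp: monoid_action_0 monoid_action_add monoid_action_mult[OF lin hom]
        complex_linear_simps[OF complex_linear_monoid_action[OF lin]])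
  moreover have "star_poly r \<in> ?K" if "r \<in> S" for r
  proof -
    have "v \<bullet> monoid_action \<mu> (star_poly r) w = 0" for v w
      using monoid_action_adj[where \<mu> = \<mu>, OF lin adj, of r v w] S[OF that] by simp
    from this[of "monoid_action \<mu> (star_poly r) w" w for w] show ?thesis by simp
  qed
  ultimately have "ideal_generated (S \<union> star_poly ` S) \<subseteq> ?K"
    using S by (intro ideal_generated_least) auto
  with FG have "monoid_action \<mu> (F - G) v = 0"
    unfolding star_ideal_cong_def by blast
  then show ?thesis by (simp add: monoid_action_diff)
qed

section \<open>Representations of the two-projection algebra and of algebraic tensor
  products\<close>

definition word_action :: "('l \<Rightarrow> 'v \<Rightarrow> 'v) \<Rightarrow> 'l word \<Rightarrow> 'v \<Rightarrow> 'v"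
  where "word_action \<alpha> w v = foldr \<alpha> (letters w) v"

primrec letter_action :: "('v \<Rightarrow> 'v) \<Rightarrow> ('v \<Rightarrow> 'v) \<Rightarrow> proj_letter \<Rightarrow> 'v \<Rightarrow> 'v"
  where "letter_action P Q Let_p = P" | "letter_action P Q Let_q = Q"
  | "letter_action P Q Let_p_star = P" | "letter_action P Q Let_q_star = Q"

lemma complex_linear_foldr:
  "(\<And>a. complex_linear (\<alpha> a)) \<Longrightarrow> complex_linear (foldr \<alpha> w)"
  by (induction w) (simp_all add: complex_linear_def)

lemma foldr_adjoint:
  fixes \<alpha> :: "'l \<Rightarrow> 'v::real_inner \<Rightarrow> 'v"
  assumes "\<And>a v w. \<alpha> a v \<bullet> w = v \<bullet> \<alpha> (i a) w"
  shows "foldr \<alpha> ls v \<bullet> w = v \<bullet> foldr \<alpha> (rev (map i ls)) w"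
  by (induction ls arbitrary: v w) (simp_all add: assms)

lemma star_rep_two_projections:
  fixes P Q :: "complex^'n \<Rightarrow> complex^'n"
  assumes lin: "complex_linear P" "complex_linear Q"
    and idem: "\<And>v. P (P v) = P v" "\<And>v. Q (Q v) = Q v"
    and sa: "\<And>v w. P v \<bullet> w = v \<bullet> P w" "\<And>v w. Q v \<bullet> w = v \<bullet> Q w"
  obtains \<rho> :: "proj_alg \<Rightarrow> complex^'n \<Rightarrow> complex^'n"
  where "star_rep \<rho>" "\<And>v. \<rho> (proj_monomial [Let_p]) v = P v" "\<And>v. \<rho> (proj_monomial [Let_q]) v = Q v"
    "commutant (letter_action P Q) \<subseteq> commutant \<rho>"
proof -
  let ?a = "letter_action P Q"
  define \<mu> where "\<mu> = word_action ?a"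
  have lin_a: "complex_linear (?a a)" for a by (cases a) (simp_all add: lin)
  have lin': "complex_linear (\<mu> k)" for k
    unfolding \<mu>_def word_action_def using complex_linear_foldr[of ?a "letters k"] lin_a by blast
  have hom: "\<mu> (k + l) v = \<mu> k (\<mu> l v)" for k l v
    by (simp add: \<mu>_def word_action_def plus_word_def)
  have adj_a: "?a a v \<bullet> w = v \<bullet> ?a (invol a) w" for a v w
    by (cases a) (simp_all add: invol_proj_letter_def sa)
  have adj: "\<mu> k v \<bullet> w = v \<bullet> \<mu> (adj k) w" for k v w
    unfolding \<mu>_def word_action_def adj_word_def word.sel by (rule foldr_adjoint) (rule adj_a)
  have S: "monoid_action \<mu> r v = 0" if "r \<in> proj_relators" for r v
    using that
    by (auto simp: proj_relators_def Let_def monoid_action_diff power2_eq_square mult_single plus_word_def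
        monoid_action_single \<mu>_def word_action_def idem)
  note cong = monoid_action_cong[OF lin' hom adj S]
  define \<rho> where "\<rho> x = monoid_action \<mu> (rep_proj_alg x)" for x
  have abs: "\<rho> (abs_proj_alg F) v = monoid_action \<mu> F v" for F v
    unfolding \<rho>_def
    by (rule cong[OF _ rep_abs_rsp_left[OF Quotient3_proj_alg star_ideal_cong_refl]])
  have ab: "\<exists>F. x = abs_proj_alg F" for x
    by (metis Quotient3_abs_rep[OF Quotient3_proj_alg])
  have "star_rep \<rho>"
    unfolding star_rep_def
  proof (intro conjI allI)
    fix x y v w c
    obtain F where F: "x = abs_proj_alg F" using ab by blast
    obtain G where G: "y = abs_proj_alg G" using ab by blast
    show "\<rho> (x + y) v = \<rho> x v + \<rho> y v"
      by (simp add: F G plus_proj_alg.abs_eq abs monoid_action_add)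
    show "\<rho> (c *\<^sub>C x) v = c *s \<rho> x v"
      by (simp add: F scaleC_proj_alg.abs_eq abs monoid_action_scale)
    show "\<rho> (x * y) v = \<rho> x (\<rho> y v)"
      by (simp add: F G times_proj_alg.abs_eq abs monoid_action_mult[OF lin' hom])
    show "\<rho> 1 v = v"
      unfolding one_proj_alg.abs_eq abs single_one[symmetric]
      by (simp only: monoid_action_single) (simp add: \<mu>_def word_action_def zero_word_def)
    show "complex_linear (\<rho> x)"
      unfolding \<rho>_def by (rule complex_linear_monoid_action[OF lin'])
    show "\<rho> x v \<bullet> w = v \<bullet> \<rho> (star x) w"
      by (simp add: F star_proj_alg.abs_eq abs monoid_action_adj[where \<mu> = \<mu>, OF lin' adj])
  qed
  moreover have "\<rho> (proj_monomial [Let_p]) v = P v" "\<rho> (proj_monomial [Let_q]) v = Q v" for v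
    by (simp_all add: proj_monomial.abs_eq abs monoid_action_single \<mu>_def word_action_def)
  moreover have "commutant ?a \<subseteq> commutant \<rho>"
  proof
    fix T assume T: "T \<in> commutant ?a"
    have "foldr ?a ls (T v) = T (foldr ?a ls v)" for ls v
      by (induction ls) (simp_all add: commutantD(2)[OF T])
    then have "\<mu> k (T v) = T (\<mu> k v)" for k v by (simp add: \<mu>_def word_action_def)
    then show "T \<in> commutant \<rho>"
      using commutantD(1)[OF T]
      by (simp add: commutant_def \<rho>_def monoid_action_def complex_linear_simps[OF commutantD(1)[OF T]])
  qed
  ultimately show thesis by (rule that)
qed

text \<open>A simple tensor acts as \<open>f a\<close> after \<open>g b\<close>; commutation of the
  two legs makes this multiplicative and compatible with adjoints.\<close>

lemma star_rep_alg_tensor: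
  fixes f :: "'a::complex_star_algebra \<Rightarrow> complex^'n \<Rightarrow> complex^'n"
    and g :: "'b::complex_star_algebra \<Rightarrow> complex^'n \<Rightarrow> complex^'n"
  assumes f: "star_rep f" and g: "star_rep g" and comm: "\<And>a b v. f a (g b v) = g b (f a v)"
  obtains h :: "('a, 'b) alg_tensor \<Rightarrow> complex^'n \<Rightarrow> complex^'n"
  where "star_rep h" "\<And>a b v. h (alg_tensor a b) v = f a (g b v)"
    "commutant f \<inter> commutant g \<subseteq> commutant h"
proof -
  note Df = star_repD[OF f] and Dg = star_repD[OF g]
  define \<mu> where "\<mu> k v = (case k of Simple_Tensor a b \<Rightarrow> f a (g b v))" for k v
  have lin: "complex_linear (\<mu> k)" for k
    by (cases k) (simp add: \<mu>_def complex_linear_def complex_linear_simps[OF Df(5)] complex_linear_simps[OF Dg(5)])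
  have hom: "\<mu> (k + l) v = \<mu> k (\<mu> l v)" for k l v
    by (cases k; cases l) (simp add: \<mu>_def Df(3) Dg(3) comm)
  have adj: "\<mu> k v \<bullet> w = v \<bullet> \<mu> (adj k) w" for k v w
    by (cases k) (simp add: \<mu>_def Df(6) Dg(6) comm)
  have S: "monoid_action \<mu> r v = 0" if "r \<in> bilinear_relators" for r v
    using that
    by (auto simp: bilinear_relators_def Let_def monoid_action_diff monoid_action_scale monoid_action_single
        \<mu>_def Df(1,2) Dg(1,2) complex_linear_simps[OF Df(5)])
  note cong = monoid_action_cong[OF lin hom adj S]
  define h where "h x = monoid_action \<mu> (rep_alg_tensor x)" for x
  have abs: "h (abs_alg_tensor F) v = monoid_action \<mu> F v" for F v
    unfolding h_def
    by (rule cong[OF _ rep_abs_rsp_left[OF Quotient3_alg_tensor star_ideal_cong_refl]])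
  have ab: "\<exists>F. x = abs_alg_tensor F" for x :: "('a, 'b) alg_tensor"
    by (metis Quotient3_abs_rep[OF Quotient3_alg_tensor])
  have "star_rep h"
    unfolding star_rep_def
  proof (intro conjI allI)
    fix x y :: "('a, 'b) alg_tensor" and v w c
    obtain F where F: "x = abs_alg_tensor F" using ab by blast
    obtain G where G: "y = abs_alg_tensor G" using ab by blast
    show "h (x + y) v = h x v + h y v"
      by (simp add: F G plus_alg_tensor.abs_eq abs monoid_action_add)
    show "h (c *\<^sub>C x) v = c *s h x v"
      by (simp add: F scaleC_alg_tensor.abs_eq abs monoid_action_scale)
    show "h (x * y) v = h x (h y v)"
      by (simp add: F G times_alg_tensor.abs_eq abs monoid_action_mult[OF lin hom])
    show "h 1 v = v"
      unfolding one_alg_tensor.abs_eq abs single_one[symmetric]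
      by (simp only: monoid_action_single) (simp add: \<mu>_def zero_simple_tensor_def Df(4) Dg(4))
    show "complex_linear (h x)"
      unfolding h_def by (rule complex_linear_monoid_action[OF lin])
    show "h x v \<bullet> w = v \<bullet> h (star x) w"
      by (simp add: F star_alg_tensor.abs_eq abs monoid_action_adj[where \<mu> = \<mu>, OF lin adj])
  qed
  moreover have "h (alg_tensor a b) v = f a (g b v)" for a b v
    by (simp add: alg_tensor.abs_eq abs monoid_action_single \<mu>_def)
  moreover have "commutant f \<inter> commutant g \<subseteq> commutant h"
  proof
    fix T assume "T \<in> commutant f \<inter> commutant g"
    then have T: "T \<in> commutant f" "T \<in> commutant g" by auto
    have "\<mu> k (T v) = T (\<mu> k v)" for k v
      by (cases k) (simp add: \<mu>_def commutantD(2)[OF T(1)] commutantD(2)[OF T(2)])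
    then show "T \<in> commutant h"
      using commutantD(1)[OF T(1)]
      by (simp add: commutant_def h_def monoid_action_def complex_linear_simps[OF commutantD(1)[OF T(1)]])
  qed
  ultimately show thesis by (rule that)
qed

section \<open>The magic unitary and its Euler angle representations\<close>

lemma UNIV_2_eq: "(UNIV :: 2 set) = {0, 1}"
proof -
  have "(2::2) = 0" by simp
  then show ?thesis unfolding UNIV_2 by auto
qed

lemma sum_UNIV_2: "sum f (UNIV :: 2 set) = f 0 + f 1"
  by (simp add: UNIV_2_eq)

lemma cases_2: obtains "(x::2) = 0" | "x = 1"
  using UNIV_2_eq by blast

lemma two_eq_0_2 [simp]: "(2::2) = 0"
  by simp

lemma add_self_2: "x + x = (0::2)"
  by (cases x rule: cases_2) simp_all

lemma add_self_pair: "x + x = (0 :: 2 \<times> 2)"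
  by (cases x) (simp add: add_self_2 zero_prod_def)

lemma add_self_left_pair: "x + (x + y) = (y :: 2 \<times> 2)"
  by (simp add: add_self_pair flip: add.assoc)

definition parity_sign :: "2 \<Rightarrow> complex"
  where "parity_sign x = (if x = 0 then 1 else - 1)"

lemma parity_sign_simps [simp]: "parity_sign 0 = 1" "parity_sign 1 = - 1"
  by (simp_all add: parity_sign_def)

lemma parity_sign_add: "parity_sign (x + y) = parity_sign x * parity_sign y"
  by (cases x rule: cases_2; cases y rule: cases_2) simp_all

lemma cnj_parity_sign: "cnj (parity_sign x) = parity_sign x"
  by (simp add: parity_sign_def)

lemma parity_sign_square: "parity_sign x * parity_sign x = 1"
  by (simp add: parity_sign_def)

section \<open>Arithmetic of tensors in the completion\<close>

lemma to_envelope_add: "to_envelope (x + y) = to_envelope x + to_envelope y"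
  and to_envelope_mult: "to_envelope (x * y) = to_envelope x * to_envelope y"
  and to_envelope_1: "to_envelope 1 = 1"
  unfolding to_envelope.abs_eq one_cstar_envelope.abs_eq
  by (simp_all only: abs_eqs(4,5)[OF env_Cauchy_const env_Cauchy_const])

lemma cstar_tensor_add_left: "(a + a') \<otimes> b = a \<otimes> b + a' \<otimes> b"
  and cstar_tensor_add_right: "a \<otimes> (b + b') = a \<otimes> b + a \<otimes> b'"
  and cstar_tensor_mult: "(a \<otimes> b) * (a' \<otimes> b') = (a * a') \<otimes> (b * b')"
  and cstar_tensor_1: "1 \<otimes> 1 = 1"
  by (simp_all add: cstar_tensor_def alg_tensor_bilinear to_envelope_add to_envelope_1 alg_tensor_1
      alg_tensor_mult flip: to_envelope_mult)

lemma cstar_tensor_0_left: "0 \<otimes> b = 0"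
  using cstar_tensor_add_left[of 0 0 b] by simp

lemma cstar_tensor_0_right: "a \<otimes> 0 = 0"
  using cstar_tensor_add_right[of a 0 0] by simp

lemma cstar_tensor_sum_left: "sum f A \<otimes> b = (\<Sum>i\<in>A. f i \<otimes> b)"
  by (induction A rule: infinite_finite_induct) (simp_all add: cstar_tensor_0_left cstar_tensor_add_left)

lemma cstar_tensor_sum_right: "a \<otimes> sum f A = (\<Sum>i\<in>A. a \<otimes> f i)"
  by (induction A rule: infinite_finite_induct) (simp_all add: cstar_tensor_0_right cstar_tensor_add_right)

lemma star_rep_cstar_tensor:
  fixes f :: "'a::cstar_algebra \<Rightarrow> complex^'n \<Rightarrow> complex^'n"
    and g :: "'b::cstar_algebra \<Rightarrow> complex^'n \<Rightarrow> complex^'n"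
  assumes f: "star_rep f" and g: "star_rep g" and comm: "\<And>a b v. f a (g b v) = g b (f a v)"
  obtains h :: "('a, 'b) cstar_tensor \<Rightarrow> complex^'n \<Rightarrow> complex^'n"
  where "star_rep h" "\<And>a b v. h (a \<otimes> b) v = f a (g b v)" "commutant f \<inter> commutant g \<subseteq> commutant h"
proof -
  obtain k :: "('a, 'b) alg_tensor \<Rightarrow> complex^'n \<Rightarrow> complex^'n" where k: "star_rep k"
    "\<And>a b v. k (alg_tensor a b) v = f a (g b v)" "commutant f \<inter> commutant g \<subseteq> commutant k"
    using star_rep_alg_tensor[OF f g comm] by blast
  show thesis
  proof
    show "star_rep (envelope_rep k)" by (rule star_rep_envelope_rep[OF k(1)])
    show "envelope_rep k (a \<otimes> b) v = f a (g b v)" for a b v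
      by (simp add: cstar_tensor_def envelope_rep_to_envelope[OF k(1)] k(2))
    show "commutant f \<inter> commutant g \<subseteq> commutant (envelope_rep k)"
      using k(3) commutant_envelope_rep[OF k(1)] by blast
  qed
qed

text \<open>
  The entries of the matrix \<open>R\<close>, addressed so that their positions become linear over the field with
  two elements.
\<close>

definition proj_entry :: "2 \<Rightarrow> 2 \<Rightarrow> two_proj_cstar"
  where "proj_entry a b = (let e = if a = 0 then proj_p else proj_q in if b = 0 then e else 1 - e)"

lemma proj_idem: "proj_p * proj_p = proj_p" "proj_q * proj_q = proj_q"
  by (simp_all add: proj_p_def proj_q_def proj_relations flip: to_envelope_mult)

lemma proj_entry_mult: "proj_entry a b * proj_entry a b' = (if b = b' then proj_entry a b else 0)"
  by (cases b rule: cases_2; cases b' rule: cases_2)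
    (simp_all add: proj_entry_def Let_def proj_idem algebra_simps)

lemma proj_entry_sum: "(\<Sum>b\<in>UNIV. proj_entry a b) = 1"
  by (simp add: sum_UNIV_2 proj_entry_def Let_def)

lemma proj_entry_sum_shift: "(\<Sum>b\<in>UNIV. proj_entry a (c + b)) = 1" "(\<Sum>b\<in>UNIV. proj_entry a (b + c)) = 1"
  using proj_entry_sum[of a] by (cases c rule: cases_2; simp add: sum_UNIV_2 add.commute)+

definition index4 :: "2 \<times> 2 \<Rightarrow> 4"
  where "index4 k = (if fst k = 0 then (if snd k = 0 then 1 else 2) else (if snd k = 0 then 3 else 4))"

lemma bij_index4: "bij index4"
proof (rule bijI)
  show "surj index4"
    unfolding surj_def
  proof
    fix y :: 4
    have "index4 (0, 0) = 1" "index4 (0, 1) = 2" "index4 (1, 0) = 3" "index4 (1, 1) = 4"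
      by (simp_all add: index4_def)
    then show "\<exists>x. y = index4 x" using exhaust_4[of y] by metis
  qed
  have "card (index4 ` UNIV) = card (UNIV :: (2 \<times> 2) set)"
    using \<open>surj index4\<close> by simp
  then show "inj index4" by (rule eq_card_imp_inj_on[rotated]) simp
qed

lemma R_matrix_index4:
  "R_matrix $ index4 (a, b) $ index4 (c, d) = (if d = a then proj_entry a (b + c) else 0)"
  by (cases a rule: cases_2; cases b rule: cases_2; cases c rule: cases_2; cases d rule: cases_2)
    (simp_all add: R_matrix_def Let_def index4_def proj_entry_def vector_def)

lemma sum_UNIV_4: "sum f (UNIV :: 4 set) = (\<Sum>k\<in>UNIV. f (index4 k))"
  using sum.reindex_bij_betw[OF bij_index4, of f] by simp

lemma sum_UNIV_prod: "sum f UNIV = (\<Sum>a\<in>UNIV. \<Sum>b\<in>UNIV. f (a, b))"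
  for f :: "'a::finite \<times> 'b::finite \<Rightarrow> 'c::comm_monoid_add"
  by (simp add: sum.cartesian_product flip: UNIV_Times_UNIV)

text \<open>
  \<open>R\<close> is a block diagonal matrix times the transposition of the indices 2 and 3. Relabelling the
  columns undoes the last such factor in \<open>M\<close>, which makes \<open>M\<close> compatible with translations of the
  Klein four-group.
\<close>

definition colindex4 :: "2 \<times> 2 \<Rightarrow> 4"
  where "colindex4 l = index4 (prod.swap l)"

lemma bij_colindex4: "bij colindex4"
  unfolding colindex4_def[abs_def] using bij_comp[OF bij_swap bij_index4] by (simp add: o_def)

text \<open>Each factor \<open>R_matrix\<close> passes the first coordinate of its row on to the
  second coordinate of its column. This resolves every summation index except
  \<open>e\<close>.\<close>

lemma M_matrix_index4:
  "M_matrix $ index4 (a, b) $ colindex4 (c, d)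
    = (\<Sum>e\<in>UNIV. proj_entry a (b + e) \<otimes> proj_entry e (a + c) \<otimes> proj_entry c (e + d))"
proof -
  have "M_matrix $ index4 (a, b) $ colindex4 (c, d)
      = (\<Sum>e\<in>UNIV. \<Sum>a'\<in>UNIV. \<Sum>f\<in>UNIV. \<Sum>e'\<in>UNIV. (if a' = a then proj_entry a (b + e) else 0)
          \<otimes> (if e' = e then proj_entry e (a' + f) else 0) \<otimes> (if c = f then proj_entry f (e' + d) else 0))"
    unfolding M_matrix_def colindex4_def
    by (simp only: vec_lambda_beta sum_UNIV_4 sum_UNIV_prod R_matrix_index4 swap_simp)
  also have "\<dots> = (\<Sum>e\<in>UNIV. \<Sum>a'\<in>UNIV. \<Sum>f\<in>UNIV. \<Sum>e'\<in>UNIV. if a' = a then if e' = e then if c = f then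
      proj_entry a (b + e) \<otimes> proj_entry e (a' + f) \<otimes> proj_entry f (e' + d) else 0 else 0 else 0)"
    by (intro sum.cong refl) (simp add: cstar_tensor_0_left cstar_tensor_0_right)
  also have "\<dots> = (\<Sum>e\<in>UNIV. proj_entry a (b + e) \<otimes> proj_entry e (a + c) \<otimes> proj_entry c (e + d))"
    by (cases a rule: cases_2; cases c rule: cases_2; simp add: sum_UNIV_2)
  finally show ?thesis .
qed

lemma M_matrix_mult:
  "M_matrix $ index4 (a, b) $ colindex4 (c, d) * M_matrix $ index4 (a', b') $ colindex4 (c', d')
    = (\<Sum>e\<in>UNIV. \<Sum>e'\<in>UNIV. (proj_entry a (b + e) * proj_entry a' (b' + e'))
        \<otimes> (proj_entry e (a + c) * proj_entry e' (a' + c')) \<otimes> (proj_entry c (e + d) * proj_entry c' (e' + d')))"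
  by (simp add: M_matrix_index4 sum_product cstar_tensor_mult)

text \<open>Orthogonality propagates from the first leg to the last: the first leg forces
  \<open>e = e'\<close>, then the second has a common index \<open>e\<close> and forces
  \<open>c = c'\<close>, then the third forces \<open>d = d'\<close>.\<close>

lemma M_matrix_row_mult:
  "M_matrix $ i $ j * M_matrix $ i $ j' = (if j = j' then M_matrix $ i $ j else 0)"
proof -
  obtain a b where i: "i = index4 (a, b)" using bij_index4 by (metis bij_pointE surj_pair)
  obtain c d where j: "j = colindex4 (c, d)" using bij_colindex4 by (metis bij_pointE surj_pair)
  obtain c' d' where j': "j' = colindex4 (c', d')" using bij_colindex4 by (metis bij_pointE surj_pair)
  have "M_matrix $ i $ j * M_matrix $ i $ j' = (\<Sum>e\<in>UNIV. \<Sum>e'\<in>UNIV. if e = e' then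
     (if c = c' \<and> d = d' then proj_entry a (b + e) \<otimes> proj_entry e (a + c) \<otimes> proj_entry c (e + d) else 0) else 0)"
    unfolding i j j' M_matrix_mult
    by (intro sum.cong refl) (auto simp: proj_entry_mult cstar_tensor_0_left cstar_tensor_0_right)
  also have "\<dots> = (if (c, d) = (c', d') then M_matrix $ i $ j else 0)"
    by (auto simp: i j M_matrix_index4)
  also have "(c, d) = (c', d') \<longleftrightarrow> j = j'"
    unfolding j j' using bij_colindex4 by (simp add: bij_def inj_eq)
  finally show ?thesis .
qed

text \<open>The same propagation from the last leg to the first: \<open>e = e'\<close>, then
  \<open>a = a'\<close>, then \<open>b = b'\<close>.\<close>

lemma M_matrix_col_mult:
  "M_matrix $ i $ j * M_matrix $ i' $ j = (if i = i' then M_matrix $ i $ j else 0)"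
proof -
  obtain a b where i: "i = index4 (a, b)" using bij_index4 by (metis bij_pointE surj_pair)
  obtain a' b' where i': "i' = index4 (a', b')" using bij_index4 by (metis bij_pointE surj_pair)
  obtain c d where j: "j = colindex4 (c, d)" using bij_colindex4 by (metis bij_pointE surj_pair)
  have "M_matrix $ i $ j * M_matrix $ i' $ j = (\<Sum>e\<in>UNIV. \<Sum>e'\<in>UNIV. if e = e' then
     (if a = a' \<and> b = b' then proj_entry a (b + e) \<otimes> proj_entry e (a + c) \<otimes> proj_entry c (e + d) else 0) else 0)"
    unfolding i j i' M_matrix_mult
    by (intro sum.cong refl) (auto simp: proj_entry_mult cstar_tensor_0_left cstar_tensor_0_right)
  also have "\<dots> = (if (a, b) = (a', b') then M_matrix $ i $ j else 0)"
    by (auto simp: i j M_matrix_index4)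
  also have "(a, b) = (a', b') \<longleftrightarrow> i = i'"
    unfolding i i' using bij_index4 by (simp add: bij_def inj_eq)
  finally show ?thesis .
qed

text \<open>The sum collapses from the last leg to the first, over \<open>d\<close>, then
  \<open>c\<close>, then \<open>e\<close>; at each stage only one leg depends on the
  variable.\<close>

lemma M_matrix_row_sum: "(\<Sum>j\<in>UNIV. M_matrix $ i $ j) = 1"
proof -
  obtain a b where i: "i = index4 (a, b)" using bij_index4 by (metis bij_pointE surj_pair)
  have "(\<Sum>j\<in>UNIV. M_matrix $ i $ j) = (\<Sum>l\<in>UNIV. M_matrix $ i $ colindex4 l)"
    using sum.reindex_bij_betw[OF bij_colindex4, of "\<lambda>j. M_matrix $ i $ j"] by simp
  also have "\<dots> = (\<Sum>c\<in>UNIV. \<Sum>e\<in>UNIV. \<Sum>d\<in>UNIV.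
      proj_entry a (b + e) \<otimes> proj_entry e (a + c) \<otimes> proj_entry c (e + d))"
    unfolding sum_UNIV_prod i M_matrix_index4 by (intro sum.cong refl sum.swap)
  also have "\<dots> = (\<Sum>c\<in>UNIV. \<Sum>e\<in>UNIV. proj_entry a (b + e) \<otimes> proj_entry e (a + c) \<otimes> 1)"
    unfolding cstar_tensor_sum_right[symmetric] proj_entry_sum_shift ..
  also have "\<dots> = (\<Sum>e\<in>UNIV. \<Sum>c\<in>UNIV. proj_entry a (b + e) \<otimes> proj_entry e (a + c) \<otimes> 1)"
    by (rule sum.swap)
  also have "\<dots> = (\<Sum>e\<in>UNIV. proj_entry a (b + e) \<otimes> (\<Sum>c\<in>UNIV. proj_entry e (a + c)) \<otimes> 1)"
    unfolding cstar_tensor_sum_left cstar_tensor_sum_right ..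
  also have "\<dots> = (\<Sum>e\<in>UNIV. proj_entry a (b + e) \<otimes> 1 \<otimes> 1)"
    unfolding proj_entry_sum_shift ..
  also have "\<dots> = (\<Sum>e\<in>UNIV. proj_entry a (b + e)) \<otimes> 1 \<otimes> 1"
    unfolding cstar_tensor_sum_left ..
  also have "\<dots> = 1"
    unfolding proj_entry_sum_shift cstar_tensor_1 ..
  finally show ?thesis .
qed

text \<open>Here the collapse runs from the first leg to the last, over \<open>b\<close>, then
  \<open>a\<close>, then \<open>e\<close>.\<close>

lemma M_matrix_col_sum: "(\<Sum>i\<in>UNIV. M_matrix $ i $ j) = 1"
proof -
  obtain c d where j: "j = colindex4 (c, d)" using bij_colindex4 by (metis bij_pointE surj_pair)
  have "(\<Sum>i\<in>UNIV. M_matrix $ i $ j) = (\<Sum>a\<in>UNIV. \<Sum>e\<in>UNIV. \<Sum>b\<in>UNIV.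
      proj_entry a (b + e) \<otimes> proj_entry e (a + c) \<otimes> proj_entry c (e + d))"
    unfolding sum_UNIV_4 sum_UNIV_prod j M_matrix_index4 by (intro sum.cong refl sum.swap)
  also have "\<dots> = (\<Sum>e\<in>UNIV. \<Sum>a\<in>UNIV. 1 \<otimes> proj_entry e (a + c) \<otimes> proj_entry c (e + d))"
    unfolding cstar_tensor_sum_left[symmetric] proj_entry_sum_shift by (rule sum.swap)
  also have "\<dots> = (\<Sum>e\<in>UNIV. 1 \<otimes> (\<Sum>a\<in>UNIV. proj_entry e (a + c)) \<otimes> proj_entry c (e + d))"
    unfolding cstar_tensor_sum_left cstar_tensor_sum_right ..
  also have "\<dots> = (\<Sum>e\<in>UNIV. 1 \<otimes> 1 \<otimes> proj_entry c (e + d))"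
    unfolding proj_entry_sum_shift ..
  also have "\<dots> = 1 \<otimes> 1 \<otimes> (\<Sum>e\<in>UNIV. proj_entry c (e + d))"
    unfolding cstar_tensor_sum_right ..
  also have "\<dots> = 1"
    unfolding proj_entry_sum_shift cstar_tensor_1 ..
  finally show ?thesis .
qed

lemma nceval_scale_poly: "nceval D (scale_poly c P) = c *\<^sub>C nceval D P"
  unfolding scale_poly_conv_mult nceval_mult nceval_single zero_word_def
  by (simp add: mult_scaleC_left)

lemma nceval_minus: "nceval D (P - Q) = nceval D P - nceval D Q"
  using nceval_add[of D "P - Q" Q] by simp

lemma nceval_sum: "nceval D (sum f A) = (\<Sum>i\<in>A. nceval D (f i))"
  by (induction A rule: infinite_finite_induct) (simp_all add: nceval_0 nceval_add)

lemma nceval_magic_ideal: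
  assumes "P \<in> magic_ideal"
  shows "nceval M_matrix P = 0"
proof -
  have "two_sided_ideal {P. nceval M_matrix P = 0}"
    by (auto simp: two_sided_ideal_def nceval_0 nceval_add nceval_mult)
  moreover have "magic_relators \<subseteq> {P. nceval M_matrix P = 0}"
    by (auto simp: magic_relators_def nceval_minus nceval_mult nceval_sum nceval_ncvar nceval_1
        power2_eq_square M_matrix_row_mult M_matrix_col_mult M_matrix_row_sum M_matrix_col_sum)
  ultimately show ?thesis
    using assms ideal_generated_least unfolding magic_ideal_def by blast
qed

text \<open>The laws of a lens: \<open>get\<close> reads one component of a tensor index and
  \<open>put\<close> overwrites it, so that the three legs share all operator lemmas.\<close>

locale coordinate =
  fixes get :: "'i::finite \<Rightarrow> 's::finite" and put :: "'s \<Rightarrow> 'i \<Rightarrow> 'i"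
  assumes get_put: "get (put s r) = s" and put_put: "put s (put t r) = put s r"
    and put_get: "put (get r) r = r"
begin

definition slot :: "('s \<Rightarrow> 's \<Rightarrow> complex) \<Rightarrow> complex^'i \<Rightarrow> complex^'i"
  where "slot e v = (\<chi> r. \<Sum>s\<in>UNIV. e (get r) s * v $ put s r)"

lemma slot_nth: "slot e v $ r = (\<Sum>s\<in>UNIV. e (get r) s * v $ put s r)"
  by (simp add: slot_def)

lemma complex_linear_slot: "complex_linear (slot e)"
  by (simp add: complex_linear_def vec_eq_iff slot_nth algebra_simps sum.distrib sum_distrib_left)

lemma slot_slot: "slot e (slot e' v) = slot (\<lambda>r t. \<Sum>s\<in>UNIV. e r s * e' s t) v"
proof -
  have "(\<Sum>s\<in>UNIV. e (get r) s * (\<Sum>t\<in>UNIV. e' s t * v $ put t r))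
      = (\<Sum>t\<in>UNIV. (\<Sum>s\<in>UNIV. e (get r) s * e' s t) * v $ put t r)" for r
    by (simp add: sum_distrib_left sum_distrib_right mult.assoc) (rule sum.swap)
  then show ?thesis by (simp add: vec_eq_iff slot_nth get_put put_put)
qed

lemma slot_inner:
  assumes "\<And>r s. e s r = cnj (e r s)"
  shows "slot e v \<bullet> w = v \<bullet> slot e w"
proof -
  have "slot e v \<bullet> w = (\<Sum>(r, s)\<in>UNIV \<times> UNIV. (e (get r) s * v $ put s r) \<bullet> w $ r)"
    by (simp add: inner_vec_def slot_nth inner_sum_left sum.cartesian_product)
  \<comment> \<open>The reindexing is the involution exchanging the component of \<open>r\<close>
    with the summation value \<open>s\<close>; it transposes \<open>e\<close>.\<close>
  also have "\<dots> = (\<Sum>(r, s)\<in>UNIV \<times> UNIV. v $ r \<bullet> (e (get r) s * w $ put s r))"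
  proof (rule sum.reindex_bij_witness[where i = "\<lambda>(r, s). (put s r, get r)" and j = "\<lambda>(r, s). (put s r, get r)"],
      goal_cases)
    case (5 rs)
    then show ?case
      using assms[of "get (fst rs)" "snd rs"]
      by (auto simp: get_put put_put put_get inner_complex_def algebra_simps split: prod.splits)
  qed (auto simp: get_put put_put put_get)
  also have "\<dots> = v \<bullet> slot e w"
    by (simp add: inner_vec_def slot_nth inner_sum_right sum.cartesian_product)
  finally show ?thesis .
qed

lemma slot_id: "slot (\<lambda>r s. if r = s then 1 else 0) v = v"
  by (simp add: vec_eq_iff slot_nth if_distribR put_get if_distrib[of "\<lambda>x. x * _"] cong: if_cong)

lemma slot_diff: "slot (\<lambda>r s. e r s - e' r s) v = slot e v - slot e' v"
  by (simp add: vec_eq_iff slot_nth algebra_simps sum_subtractf)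

end

lemma slot_commute:
  assumes "coordinate get put" "coordinate get' put'"
    and indep: "\<And>s r. get' (put s r) = get' r" "\<And>s r. get (put' s r) = get r"
      "\<And>s t r. put' t (put s r) = put s (put' t r)"
  shows "coordinate.slot get put e (coordinate.slot get' put' e' v)
    = coordinate.slot get' put' e' (coordinate.slot get put e v)"
proof -
  note nth = coordinate.slot_nth[OF assms(1)] coordinate.slot_nth[OF assms(2)]
  have "(\<Sum>s\<in>UNIV. \<Sum>t\<in>UNIV. e (get r) s * (e' (get' r) t * v $ put s (put' t r)))
      = (\<Sum>t\<in>UNIV. \<Sum>s\<in>UNIV. e' (get' r) t * (e (get r) s * v $ put s (put' t r)))" for r
    by (subst sum.swap) (simp add: algebra_simps)
  then show ?thesis by (simp add: vec_eq_iff nth indep sum_distrib_left)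
qed

interpretation slot1: coordinate fst "\<lambda>s r. (s, snd r)"
  by standard auto

interpretation slot2: coordinate "\<lambda>r. fst (snd r)" "\<lambda>s r. (fst r, s, snd (snd r))"
  by standard auto

interpretation slot3: coordinate "\<lambda>r. snd (snd r)" "\<lambda>s r. (fst r, fst (snd r), s)"
  by standard auto

text \<open>
  For \<open>u = (cos \<alpha>, sin \<alpha>)\<close> these are the projections onto the lines spanned by \<open>u\<close> and by
  \<open>(cos \<alpha>, - sin \<alpha>)\<close>, and their complements.
\<close>

definition proj_matrix :: "(2 \<Rightarrow> complex) \<Rightarrow> 2 \<Rightarrow> 2 \<Rightarrow> 2 \<Rightarrow> 2 \<Rightarrow> complex"
  where "proj_matrix u a b r s = parity_sign ((r + s) * (a + b)) * u (r + b) * u (s + b)"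

definition real_unit :: "('k::finite \<Rightarrow> complex) \<Rightarrow> bool"
  where "real_unit u \<longleftrightarrow> (\<forall>i. cnj (u i) = u i) \<and> (\<Sum>i\<in>UNIV. (u i)\<^sup>2) = 1"

lemma proj_matrix_hermitian: "real_unit u \<Longrightarrow> proj_matrix u a b s r = cnj (proj_matrix u a b r s)"
  by (simp add: proj_matrix_def real_unit_def cnj_parity_sign add.commute)

lemma proj_matrix_idem:
  assumes "real_unit u"
  shows "(\<Sum>s\<in>UNIV. proj_matrix u a b r s * proj_matrix u a b s t) = proj_matrix u a b r t"
proof -
  have "(\<Sum>s\<in>UNIV. (u (s + b))\<^sup>2) = 1"
    using assms by (cases b rule: cases_2) (simp_all add: real_unit_def sum_UNIV_2 add.commute)
  moreover have "proj_matrix u a b r s * proj_matrix u a b s t = proj_matrix u a b r t * (u (s + b))\<^sup>2" for s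
    by (cases a rule: cases_2; cases b rule: cases_2; cases r rule: cases_2; cases s rule: cases_2;
        cases t rule: cases_2; simp add: proj_matrix_def power2_eq_square)
  ultimately show ?thesis by (simp flip: sum_distrib_left)
qed

lemma proj_matrix_1:
  assumes "real_unit u"
  shows "proj_matrix u a 1 = (\<lambda>r s. (if r = s then 1 else 0) - proj_matrix u a 0 r s)"
proof (intro ext)
  fix r s
  have "u 0 * u 0 + u 1 * u 1 = 1" using assms by (simp add: real_unit_def sum_UNIV_2 power2_eq_square)
  then have "u 0 * u 0 = 1 - u 1 * u 1" by (simp add: eq_diff_eq)
  then show "proj_matrix u a 1 r s = (if r = s then 1 else 0) - proj_matrix u a 0 r s"
    by (cases a rule: cases_2; cases r rule: cases_2; cases s rule: cases_2; simp add: proj_matrix_def)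
qed

lemma star_rep_slot:
  fixes u :: "2 \<Rightarrow> complex"
  assumes c: "coordinate get put" and u: "real_unit u"
  obtains \<rho> :: "two_proj_cstar \<Rightarrow> complex^'i::finite \<Rightarrow> complex^'i"
  where "star_rep \<rho>"
    "\<And>a b v. \<rho> (proj_entry a b) v = coordinate.slot get put (proj_matrix u a b) v"
    "commutant (coordinate.slot get put) \<subseteq> commutant \<rho>"
proof -
  let ?s = "coordinate.slot get put"
  let ?P = "\<lambda>a. ?s (proj_matrix u a 0)"
  have idem: "?P a (?P a v) = ?P a v" for a v
    by (simp add: coordinate.slot_slot[OF c] proj_matrix_idem[OF u])
  have sa: "?P a v \<bullet> w = v \<bullet> ?P a w" for a v w
    by (rule coordinate.slot_inner[OF c proj_matrix_hermitian[OF u]])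
  note lin = coordinate.complex_linear_slot[OF c]
  obtain \<rho> :: "proj_alg \<Rightarrow> complex^'i \<Rightarrow> complex^'i" where \<rho>: "star_rep \<rho>"
    "\<And>v. \<rho> (proj_monomial [Let_p]) v = ?P 0 v" "\<And>v. \<rho> (proj_monomial [Let_q]) v = ?P 1 v"
    "commutant (letter_action (?P 0) (?P 1)) \<subseteq> commutant \<rho>"
    using star_rep_two_projections[OF lin lin idem idem sa sa, of 0 1] by blast
  note env = star_rep_envelope_rep[OF \<rho>(1)]
  show thesis
  proof
    show "star_rep (envelope_rep \<rho>)" by (rule env)
    have 0: "envelope_rep \<rho> (proj_entry a 0) v = ?P a v" for a v
      by (cases a rule: cases_2)
        (simp_all add: proj_entry_def proj_p_def proj_q_def envelope_rep_to_envelope[OF \<rho>(1)] \<rho>(2,3))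
    have "proj_entry a 1 = 1 - proj_entry a 0" for a
      by (simp add: proj_entry_def Let_def)
    then have "envelope_rep \<rho> (proj_entry a 1) v = ?s (proj_matrix u a 1) v" for a v
      by (simp add: star_rep_diff[OF env] star_repD(4)[OF env] 0 proj_matrix_1[OF u]
          coordinate.slot_diff[OF c] coordinate.slot_id[OF c])
    with 0 show "envelope_rep \<rho> (proj_entry a b) v = ?s (proj_matrix u a b) v" for a b v
      by (cases b rule: cases_2) simp_all
    have "commutant ?s \<subseteq> commutant (letter_action (?P 0) (?P 1))"
    proof
      fix T assume T: "T \<in> commutant ?s"
      have "letter_action (?P 0) (?P 1) l (T v) = T (letter_action (?P 0) (?P 1) l v)" for l v
        by (cases l) (simp_all add: commutantD(2)[OF T])
      with T show "T \<in> commutant (letter_action (?P 0) (?P 1))" by (simp add: commutant_def)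
    qed
    then show "commutant ?s \<subseteq> commutant (envelope_rep \<rho>)"
      using \<rho>(4) commutant_envelope_rep[OF \<rho>(1)] by blast
  qed
qed

text \<open>Commutants are used twice: each \<open>S e\<close> commutes with \<open>S'\<close> and
  hence with the image of \<open>g\<close>; so each \<open>g y\<close> commutes with
  \<open>S\<close> and hence with the image of \<open>f\<close>.\<close>

lemma commute_of_commutant:
  assumes "commutant S \<subseteq> commutant f" "commutant S' \<subseteq> commutant g" "star_rep g"
    and lin: "\<And>e. complex_linear (S e)" and comm: "\<And>e e' v. S e (S' e' v) = S' e' (S e v)"
  shows "f x (g y v) = g y (f x v)"
proof -
  have "S e \<in> commutant S'" for e
    by (simp add: commutant_def lin comm)
  then have "S e \<in> commutant g" for e using assms(2) by blast
  then have "g y \<in> commutant S"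
    using star_repD(5)[OF assms(3)] commutantD(2)[of "S _" g] by (simp add: commutant_def)
  then have "g y \<in> commutant f" using assms(1) by blast
  then show ?thesis by (rule commutantD(2))
qed

lemma three_slot_rep:
  fixes u v w :: "2 \<Rightarrow> complex"
  assumes "real_unit u" "real_unit v" "real_unit w"
  obtains \<theta> :: "two_proj_cstar3 \<Rightarrow> complex^(2 \<times> 2 \<times> 2) \<Rightarrow> complex^(2 \<times> 2 \<times> 2)"
  where "star_rep \<theta>"
    "\<And>a b c d e f x. \<theta> (proj_entry a b \<otimes> proj_entry c d \<otimes> proj_entry e f) x
      = slot1.slot (proj_matrix u a b) (slot2.slot (proj_matrix v c d) (slot3.slot (proj_matrix w e f) x))"
proof -
  note c1 = slot1.coordinate_axioms and c2 = slot2.coordinate_axioms and c3 = slot3.coordinate_axioms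
  obtain f :: "two_proj_cstar \<Rightarrow> complex^(2 \<times> 2 \<times> 2) \<Rightarrow> complex^(2 \<times> 2 \<times> 2)" where f: "star_rep f"
    "\<And>a b x. f (proj_entry a b) x = slot1.slot (proj_matrix u a b) x" "commutant slot1.slot \<subseteq> commutant f"
    by (rule star_rep_slot[OF c1 assms(1)]) (rule that)
  obtain g :: "two_proj_cstar \<Rightarrow> complex^(2 \<times> 2 \<times> 2) \<Rightarrow> complex^(2 \<times> 2 \<times> 2)" where g: "star_rep g"
    "\<And>a b x. g (proj_entry a b) x = slot2.slot (proj_matrix v a b) x" "commutant slot2.slot \<subseteq> commutant g"
    by (rule star_rep_slot[OF c2 assms(2)]) (rule that)
  obtain h :: "two_proj_cstar \<Rightarrow> complex^(2 \<times> 2 \<times> 2) \<Rightarrow> complex^(2 \<times> 2 \<times> 2)" where h: "star_rep h"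
    "\<And>a b x. h (proj_entry a b) x = slot3.slot (proj_matrix w a b) x" "commutant slot3.slot \<subseteq> commutant h"
    by (rule star_rep_slot[OF c3 assms(3)]) (rule that)
  have comm12: "slot1.slot e (slot2.slot e' x) = slot2.slot e' (slot1.slot e x)" for e e' x
    by (rule slot_commute[OF c1 c2]) simp_all
  have comm13: "slot1.slot e (slot3.slot e' x) = slot3.slot e' (slot1.slot e x)" for e e' x
    by (rule slot_commute[OF c1 c3]) simp_all
  have comm23: "slot2.slot e (slot3.slot e' x) = slot3.slot e' (slot2.slot e x)" for e e' x
    by (rule slot_commute[OF c2 c3]) simp_all
  note fg = commute_of_commutant[OF f(3) g(3) g(1) slot1.complex_linear_slot comm12]
  note fh = commute_of_commutant[OF f(3) h(3) h(1) slot1.complex_linear_slot comm13]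
  note gh = commute_of_commutant[OF g(3) h(3) h(1) slot2.complex_linear_slot comm23]
  obtain k :: "(two_proj_cstar, two_proj_cstar) cstar_tensor \<Rightarrow> complex^(2 \<times> 2 \<times> 2) \<Rightarrow> complex^(2 \<times> 2 \<times> 2)"
    where k: "star_rep k" "\<And>a b x. k (a \<otimes> b) x = g a (h b x)" "commutant g \<inter> commutant h \<subseteq> commutant k"
    by (rule star_rep_cstar_tensor[OF g(1) h(1) gh]) (rule that)
  \<comment> \<open>The first leg commutes with the second and the third separately, hence with the
    completed tensor product of both.\<close>
  have "f a \<in> commutant g \<inter> commutant h" for a
    using star_repD(5)[OF f(1)] by (simp add: commutant_def fg fh)
  then have fk: "f a (k b x) = k b (f a x)" for a b x
    by (intro commutantD(2)[of "f a" k, symmetric] subsetD[OF k(3)])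
  obtain \<theta> :: "two_proj_cstar3 \<Rightarrow> complex^(2 \<times> 2 \<times> 2) \<Rightarrow> complex^(2 \<times> 2 \<times> 2)"
    where \<theta>: "star_rep \<theta>" "\<And>a b x. \<theta> (a \<otimes> b) x = f a (k b x)"
    by (rule star_rep_cstar_tensor[OF f(1) k(1) fk]) (rule that)
  show thesis
    by (rule that[of \<theta>, OF \<theta>(1)]) (simp only: \<theta>(2) k(2) f(2) g(2) h(2))
qed

text \<open>
  An involution commutes with all entries of \<open>M\<close> in the representation on the eight-dimensional space;
  the vectors \<open>xi t\<close> span one of its two eigenspaces.
\<close>

definition xi :: "2 \<times> 2 \<Rightarrow> complex^(2 \<times> 2 \<times> 2)"
  where "xi t = (\<chi> r. if (fst (snd r), fst r + snd (snd r)) = t then parity_sign (fst r * (fst t + snd t)) else 0)"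

text \<open>The alternating bicharacter of the Klein four-group. It is the commutator pairing of the
  quaternion group of order eight and also identifies the Klein four-group with its dual.\<close>

definition commutation_sign :: "2 \<times> 2 \<Rightarrow> 2 \<times> 2 \<Rightarrow> complex"
  where "commutation_sign g h = parity_sign (fst g * snd h + snd g * fst h)"

text \<open>A 2-cocycle defining the quaternion group of order eight: it is bimultiplicative, equals
  \<open>- 1\<close> at \<open>(g, g)\<close> for every \<open>g \<noteq> 0\<close>, and satisfies
  \<open>cocycle_sign g h * cocycle_sign h g = commutation_sign g h\<close>.\<close>

definition cocycle_sign :: "2 \<times> 2 \<Rightarrow> 2 \<times> 2 \<Rightarrow> complex"
  where "cocycle_sign g h = parity_sign (snd g * snd h + fst g * snd h + fst g * fst h)"

text \<open>
  The product of three rotations in quaternion form: \<open>u\<close>, \<open>v\<close>, \<open>w\<close> are the cosines and sines of half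
  the Euler angles.
\<close>

definition euler_quaternion :: "(2 \<Rightarrow> complex) \<Rightarrow> (2 \<Rightarrow> complex) \<Rightarrow> (2 \<Rightarrow> complex) \<Rightarrow> 2 \<times> 2 \<Rightarrow> complex"
  where "euler_quaternion u v w g =
    (if fst g = 0 then v 0 * (if snd g = 0 then u 0 * w 0 + u 1 * w 1 else u 0 * w 1 - u 1 * w 0)
     else v 1 * (if snd g = 0 then u 0 * w 0 - u 1 * w 1 else u 0 * w 1 + u 1 * w 0))"

lemma slots_nth:
  "slot1.slot A (slot2.slot B (slot3.slot C x)) $ (r1, r2, r3)
    = (\<Sum>s1\<in>UNIV. \<Sum>s2\<in>UNIV. \<Sum>s3\<in>UNIV. A r1 s1 * B r2 s2 * C r3 s3 * x $ (s1, s2, s3))"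
  by (simp add: slot1.slot_nth slot2.slot_nth slot3.slot_nth sum_distrib_left mult.assoc)

text \<open>On the support of \<open>xi (t1, t2)\<close> the second index is \<open>t1\<close> and
  the third is the first plus \<open>t2\<close>, which leaves a single sum.\<close>

lemma slots_xi:
  "slot1.slot A (slot2.slot B (slot3.slot C (xi (t1, t2)))) $ (r1, r2, r3)
    = (\<Sum>s\<in>UNIV. A r1 s * B r2 t1 * C r3 (s + t2) * parity_sign (s * (t1 + t2)))"
  unfolding slots_nth sum_UNIV_2
  by (cases t1 rule: cases_2; cases t2 rule: cases_2; simp add: xi_def)

lemma sum_xi_nth:
  "(\<Sum>h\<in>UNIV. c h *s xi (t + h)) $ (r1, r2, r3)
    = c (t + (r2, r1 + r3)) * parity_sign (r1 * (r2 + r1 + r3))"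
proof -
  have "(\<Sum>h\<in>UNIV. c h *s xi (t + h)) $ (r1, r2, r3)
      = (\<Sum>h\<in>UNIV. if h = t + (r2, r1 + r3) then c h * parity_sign (r1 * (r2 + r1 + r3)) else 0)"
  proof (unfold sum_component, rule sum.cong[OF refl])
    fix h
    have "(r2, r1 + r3) = t + h \<longleftrightarrow> h = t + (r2, r1 + r3)"
      by (metis add_self_left_pair)
    then show "(c h *s xi (t + h)) $ (r1, r2, r3)
      = (if h = t + (r2, r1 + r3) then c h * parity_sign (r1 * (r2 + r1 + r3)) else 0)"
      by (auto simp: xi_def add_self_left_pair add.assoc)
  qed
  then show ?thesis by simp
qed

text \<open>For each of the 512 choices of the nine indices this is a polynomial identity in the
  values of \<open>u\<close>, \<open>v\<close>, \<open>w\<close>. Terms such as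
  \<open>a + (a + g1)\<close> keep the shape that \<open>M_matrix_index4\<close> produces.\<close>

lemma proj_matrix_xi_sum:
  "(\<Sum>e\<in>UNIV. \<Sum>s\<in>UNIV. proj_matrix u a (b + e) r1 s * proj_matrix v e (a + (a + g1)) r2 t1
      * proj_matrix w (a + g1) (e + (b + g2)) r3 (s + t2) * parity_sign (s * (t1 + t2)))
    = commutation_sign (a, b) ((t1, t2) + (r2, r1 + r3))
        * cocycle_sign (g1, g2) ((t1, t2) + (r2, r1 + r3)) * euler_quaternion u v w ((t1, t2) + (g1, g2))
        * euler_quaternion u v w ((g1, g2) + (r2, r1 + r3)) * parity_sign (r1 * (r2 + r1 + r3))"
  unfolding sum_UNIV_2 commutation_sign_def cocycle_sign_def proj_matrix_def euler_quaternion_def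
    plus_prod_def fst_conv snd_conv
  by (cases a rule: cases_2; cases b rule: cases_2; cases g1 rule: cases_2; cases g2 rule: cases_2;
      cases t1 rule: cases_2; cases t2 rule: cases_2; cases r1 rule: cases_2; cases r2 rule: cases_2;
      cases r3 rule: cases_2; simp add: algebra_simps)

text \<open>Both signs are characters in their second argument. In the basis \<open>xi\<close> the
  entry thus has coefficients \<open>x s * x t\<close> with
  \<open>x s = commutation_sign k s * cocycle_sign g s * q (s + g)\<close>: a rank-one projection
  when \<open>q\<close> is real of norm one.\<close>

lemma M_matrix_xi:
  fixes u v w :: "2 \<Rightarrow> complex"
  assumes \<theta>: "star_rep \<theta>"
    "\<And>a b c d e f x. \<theta> (proj_entry a b \<otimes> proj_entry c d \<otimes> proj_entry e f) x
      = slot1.slot (proj_matrix u a b) (slot2.slot (proj_matrix v c d) (slot3.slot (proj_matrix w e f) x))"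
  defines "q \<equiv> euler_quaternion u v w"
  shows "\<theta> (M_matrix $ index4 k $ colindex4 (k + g)) (xi t)
    = (\<Sum>h\<in>UNIV. (commutation_sign k h * cocycle_sign g h * q (t + g) * q (t + g + h)) *s xi (t + h))"
proof -
  obtain a b where k: "k = (a, b)" by (cases k)
  obtain g1 g2 where g: "g = (g1, g2)" by (cases g)
  obtain t1 t2 where t: "t = (t1, t2)" by (cases t)
  have "\<theta> (M_matrix $ index4 k $ colindex4 (k + g)) (xi t) $ (r1, r2, r3)
      = (\<Sum>h\<in>UNIV. (commutation_sign k h * cocycle_sign g h * q (t + g) * q (t + g + h)) *s xi (t + h)) $ (r1, r2, r3)"
    for r1 r2 r3
  proof -
    have "q (t + g + (t + (r2, r1 + r3))) = q (g + (r2, r1 + r3))"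
      by (metis add.assoc add.commute add_self_left_pair)
    then have R: "(\<Sum>h\<in>UNIV. (commutation_sign k h * cocycle_sign g h * q (t + g) * q (t + g + h)) *s xi (t + h)) $ (r1, r2, r3)
      = commutation_sign k (t + (r2, r1 + r3)) * cocycle_sign g (t + (r2, r1 + r3)) * q (t + g)
        * q (g + (r2, r1 + r3)) * parity_sign (r1 * (r2 + r1 + r3))"
      by (simp only: sum_xi_nth)
    have "\<theta> (M_matrix $ index4 k $ colindex4 (k + g)) (xi t) $ (r1, r2, r3)
      = (\<Sum>e\<in>UNIV. \<Sum>s\<in>UNIV. proj_matrix u a (b + e) r1 s * proj_matrix v e (a + (a + g1)) r2 t1
          * proj_matrix w (a + g1) (e + (b + g2)) r3 (s + t2) * parity_sign (s * (t1 + t2)))"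
      unfolding k g t plus_prod_def fst_conv snd_conv M_matrix_index4 star_rep_sum[OF \<theta>(1)] \<theta>(2) sum_component
        slots_xi ..
    also have "\<dots> = commutation_sign (a, b) ((t1, t2) + (r2, r1 + r3))
        * cocycle_sign (g1, g2) ((t1, t2) + (r2, r1 + r3)) * q ((t1, t2) + (g1, g2))
        * q ((g1, g2) + (r2, r1 + r3)) * parity_sign (r1 * (r2 + r1 + r3))"
      unfolding q_def by (rule proj_matrix_xi_sum)
    finally show ?thesis unfolding R unfolding k g t .
  qed
  then show ?thesis by (simp add: vec_eq_iff)
qed

section \<open>Normal forms modulo the magic unitary ideal\<close>

lemma commutation_sign_add_right:
  "commutation_sign k (g + h) = commutation_sign k g * commutation_sign k h"
  unfolding commutation_sign_def by (simp add: distrib_left add_ac flip: parity_sign_add)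

lemma commutation_sign_commute: "commutation_sign g h = commutation_sign h g"
  by (simp add: commutation_sign_def mult.commute add.commute)

lemma commutation_sign_add_left:
  "commutation_sign (g + h) k = commutation_sign g k * commutation_sign h k"
  by (simp add: commutation_sign_commute[of _ k] commutation_sign_add_right)

lemma commutation_sign_add_swap:
  "commutation_sign k (g + h) = commutation_sign g k * commutation_sign h k"
  by (simp add: commutation_sign_commute[of k] commutation_sign_add_left)

lemma commutation_sign_square: "commutation_sign g h * commutation_sign g h = 1"
  by (simp add: commutation_sign_def parity_sign_square)

lemma commutation_sign_0 [simp]: "commutation_sign g 0 = 1" "commutation_sign 0 g = 1"
  by (simp_all add: commutation_sign_def)

text \<open>The pairing is alternating and non-degenerate on a plane over two elements, so the
  annihilator of \<open>h\<close> is \<open>{0, h}\<close>.\<close>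

lemma commutation_sign_eq:
  assumes "h \<noteq> 0"
  shows "commutation_sign g h = (if g = 0 \<or> g = h then 1 else - 1)"
proof -
  obtain g1 g2 h1 h2 where "g = (g1, g2)" "h = (h1, h2)" by (cases g; cases h)
  with assms show ?thesis
    by (cases g1 rule: cases_2; cases g2 rule: cases_2; cases h1 rule: cases_2; cases h2 rule: cases_2;
        simp add: commutation_sign_def zero_prod_def)
qed

lemma sum_commutation_sign: "(\<Sum>k\<in>UNIV. commutation_sign k h) = (if h = 0 then 4 else 0)"
proof -
  obtain h1 h2 where "h = (h1, h2)" by (cases h)
  then show ?thesis
    by (cases h1 rule: cases_2; cases h2 rule: cases_2;
        simp add: sum_UNIV_prod sum_UNIV_2 commutation_sign_def zero_prod_def)
qed

lemma sum_UNIV_shift: "(\<Sum>k\<in>UNIV. f (k + g)) = (\<Sum>k\<in>UNIV. f k)"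
  for g :: "2 \<times> 2"
  by (rule sum.reindex_bij_witness[where i = "\<lambda>k. k + g" and j = "\<lambda>k. k + g"])
    (simp_all add: add.assoc add_self_pair)

lemma sum_UNIV_shift_left: "(\<Sum>k\<in>UNIV. f (g + k)) = (\<Sum>k\<in>UNIV. f k)"
  for g :: "2 \<times> 2"
  using sum_UNIV_shift[of f g] by (simp add: add.commute)

lemma pair_add_cancel: "x + (y + x) = (y :: 2 \<times> 2)" "x + y + x = (y :: 2 \<times> 2)" "x + y + y = (x :: 2 \<times> 2)"
  by (metis add.commute add_self_left_pair)+

lemma pair_add_eq_0: "x + y = 0 \<longleftrightarrow> x = (y :: 2 \<times> 2)"
  by (metis add_self_pair add_self_left_pair add_0_right)

lemma scale_poly_0_right: "scale_poly c 0 = 0"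
  using scale_poly_add[of c 0 0] by simp

lemma scale_poly_0_left: "scale_poly 0 P = 0"
  using scale_poly_add_left[of 0 0 P] by simp

lemma scale_poly_sum: "scale_poly c (sum f A) = (\<Sum>i\<in>A. scale_poly c (f i))"
  by (induction A rule: infinite_finite_induct) (simp_all add: scale_poly_0_right scale_poly_add)

lemma scale_poly_sum_left: "scale_poly (sum f A) P = (\<Sum>i\<in>A. scale_poly (f i) P)"
  by (induction A rule: infinite_finite_induct) (simp_all add: scale_poly_0_left scale_poly_add_left)

lemma magic_ideal_0: "0 \<in> magic_ideal"
  and magic_ideal_add: "P \<in> magic_ideal \<Longrightarrow> Q \<in> magic_ideal \<Longrightarrow> P + Q \<in> magic_ideal"
  and magic_ideal_mult_left: "P \<in> magic_ideal \<Longrightarrow> Q * P \<in> magic_ideal"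
  and magic_ideal_mult_right: "P \<in> magic_ideal \<Longrightarrow> P * Q \<in> magic_ideal"
  and magic_ideal_uminus: "P \<in> magic_ideal \<Longrightarrow> - P \<in> magic_ideal"
  unfolding magic_ideal_def by (fact ideal_generated_closed ideal_generated_uminus)+

lemma magic_ideal_diff: "P \<in> magic_ideal \<Longrightarrow> Q \<in> magic_ideal \<Longrightarrow> P - Q \<in> magic_ideal"
  using magic_ideal_add[OF _ magic_ideal_uminus] by fastforce

lemma magic_ideal_scale: "P \<in> magic_ideal \<Longrightarrow> scale_poly c P \<in> magic_ideal"
  unfolding scale_poly_conv_mult by (rule magic_ideal_mult_left)

lemma magic_ideal_sum: "(\<And>i. i \<in> A \<Longrightarrow> f i \<in> magic_ideal) \<Longrightarrow> sum f A \<in> magic_ideal"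
  by (induction A rule: infinite_finite_induct) (simp_all add: magic_ideal_0 magic_ideal_add)

section \<open>Generators and relations in Klein four-group coordinates\<close>

definition mvar :: "2 \<times> 2 \<Rightarrow> 2 \<times> 2 \<Rightarrow> 4 ncpoly"
  where "mvar k l = ncvar (index4 k) (colindex4 l)"

lemma mvar_surj: "\<exists>k l. ncvar i j = mvar k l"
  unfolding mvar_def using bij_index4 bij_colindex4 by (metis bij_pointE)

lemma mvar_relations:
  shows mvar_row: "l \<noteq> l' \<Longrightarrow> mvar k l * mvar k l' \<in> magic_ideal"
    and mvar_col: "k \<noteq> k' \<Longrightarrow> mvar k l * mvar k' l \<in> magic_ideal"
    and mvar_row_sum: "(\<Sum>l\<in>UNIV. mvar k l) - 1 \<in> magic_ideal"
    and mvar_col_sum: "(\<Sum>k\<in>UNIV. mvar k l) - 1 \<in> magic_ideal"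
proof -
  note sup = ideal_generated_superset[of magic_relators, folded magic_ideal_def]
  show "mvar k l * mvar k l' \<in> magic_ideal" if "l \<noteq> l'"
  proof -
    have "colindex4 l \<noteq> colindex4 l'" using that bij_colindex4 by (simp add: bij_def inj_eq)
    then have "mvar k l * mvar k l' \<in> magic_relators"
      unfolding mvar_def magic_relators_def by blast
    with sup show ?thesis by blast
  qed
  show "mvar k l * mvar k' l \<in> magic_ideal" if "k \<noteq> k'"
  proof -
    have "index4 k \<noteq> index4 k'" using that bij_index4 by (simp add: bij_def inj_eq)
    then have "mvar k l * mvar k' l \<in> magic_relators"
      unfolding mvar_def magic_relators_def by blast
    with sup show ?thesis by blast
  qed
  have "(\<Sum>l\<in>UNIV. mvar k l) = (\<Sum>j\<in>UNIV. ncvar (index4 k) j)"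
    unfolding mvar_def using sum.reindex_bij_betw[OF bij_colindex4] .
  then show "(\<Sum>l\<in>UNIV. mvar k l) - 1 \<in> magic_ideal"
    using sup by (auto simp: magic_relators_def)
  have "(\<Sum>k\<in>UNIV. mvar k l) = (\<Sum>i\<in>UNIV. ncvar i (colindex4 l))"
    unfolding mvar_def by (simp add: sum_UNIV_4)
  then show "(\<Sum>k\<in>UNIV. mvar k l) - 1 \<in> magic_ideal"
    using sup by (auto simp: magic_relators_def)
qed

text \<open>
  The Fourier transform of a generalised diagonal. Under the representations above \<open>quad m n\<close> becomes
  \<open>q\<^sub>m q\<^sub>n\<close> up to sign and translation, where \<open>q\<close> is a unit quaternion.
\<close>

definition quad :: "2 \<times> 2 \<Rightarrow> 2 \<times> 2 \<Rightarrow> 4 ncpoly"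
  where "quad m n = scale_poly (1/4) (\<Sum>k\<in>UNIV. scale_poly (commutation_sign k (m + n)) (mvar k (k + m)))"

text \<open>Fourier inversion along one generalised diagonal.\<close>

lemma mvar_eq_sum_quad:
  "mvar k l = (\<Sum>h\<in>UNIV. scale_poly (commutation_sign k h) (quad (k + l) (k + l + h)))"
proof -
  have h: "k + l + (k + l + h) = h" for h by (rule add_self_left_pair)
  have "(\<Sum>h\<in>UNIV. scale_poly (commutation_sign k h) (quad (k + l) (k + l + h)))
      = (\<Sum>h\<in>UNIV. \<Sum>j\<in>UNIV. scale_poly (1/4 * commutation_sign h (k + j)) (mvar j (j + (k + l))))"
    unfolding quad_def h scale_poly_sum scale_poly_scale_poly
    by (intro sum.cong refl arg_cong[where f = "\<lambda>c. scale_poly c _"])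
      (simp add: commutation_sign_add_swap)
  also have "\<dots> = (\<Sum>j\<in>UNIV. scale_poly (1/4 * (\<Sum>h\<in>UNIV. commutation_sign h (k + j))) (mvar j (j + (k + l))))"
    by (subst sum.swap) (simp add: scale_poly_sum_left[symmetric] sum_distrib_left)
  also have "\<dots> = (\<Sum>j\<in>UNIV. if j = k then mvar j (j + (k + l)) else 0)"
    by (intro sum.cong refl)
      (auto simp: sum_commutation_sign scale_poly_one scale_poly_0_left pair_add_eq_0)
  finally show ?thesis by (simp add: add_self_left_pair)
qed

text \<open>Add the Fourier coefficient of the row sums at \<open>h = m + n\<close> to that of the
  column sums, twisted by \<open>m\<close>. The constants drop out because the character of
  \<open>h\<close> is nontrivial. The variable \<open>mvar k (k + g)\<close> has coefficient
  \<open>commutation_sign k h * (1 + commutation_sign (g + m) h)\<close>, which survives only for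
  \<open>g = m\<close> and \<open>g = n\<close>. The factor 8 is this doubling times the 4 that
  normalises \<open>quad\<close>.\<close>

lemma quad_commute:
  assumes "m \<noteq> n"
  shows "quad m n + quad n m \<in> magic_ideal"
proof -
  define h where "h = m + n"
  have h: "h \<noteq> 0" using assms by (simp add: h_def pair_add_eq_0)
  let ?c = "\<lambda>k l. commutation_sign k h + commutation_sign (l + m) h"
  have c: "?c k (k + g) = (if g = m \<or> g = n then 2 * commutation_sign k h else 0)" for k g
  proof -
    have "?c k (k + g) = commutation_sign k h * (1 + commutation_sign (g + m) h)"
      by (simp add: commutation_sign_add_left algebra_simps commutation_sign_square)
    moreover have "g + m = 0 \<longleftrightarrow> g = m" by (rule pair_add_eq_0)
    moreover have "g + m = h \<longleftrightarrow> g = n" unfolding h_def by (metis add.commute add_right_imp_eq)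
    ultimately show ?thesis by (simp add: commutation_sign_eq[OF h])
  qed
  have "(\<Sum>k\<in>UNIV. \<Sum>l\<in>UNIV. scale_poly (?c k l) (mvar k l))
      = (\<Sum>k\<in>UNIV. \<Sum>g\<in>UNIV. scale_poly (?c k (k + g)) (mvar k (k + g)))"
    by (intro sum.cong refl sum_UNIV_shift_left[symmetric])
  also have "\<dots> = (\<Sum>k\<in>UNIV. \<Sum>g\<in>{m, n}. scale_poly (?c k (k + g)) (mvar k (k + g)))"
    by (intro sum.cong refl sum.mono_neutral_right) (auto simp: c scale_poly_0_left)
  also have "\<dots> = (\<Sum>k\<in>UNIV. scale_poly 2 (scale_poly (commutation_sign k h) (mvar k (k + m)))
      + scale_poly 2 (scale_poly (commutation_sign k h) (mvar k (k + n))))"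
    using assms by (intro sum.cong refl) (simp add: c scale_poly_scale_poly)
  also have "\<dots> = scale_poly 8 (quad m n + quad n m)"
    by (simp add: quad_def h_def add.commute[of n m] scale_poly_add scale_poly_scale_poly sum.distrib
        scale_poly_sum)
  finally have "scale_poly 8 (quad m n + quad n m)
    = (\<Sum>k\<in>UNIV. \<Sum>l\<in>UNIV. scale_poly (?c k l) (mvar k l))" ..
  also have "\<dots> = (\<Sum>k\<in>UNIV. scale_poly (commutation_sign k h) (\<Sum>l\<in>UNIV. mvar k l))
      + (\<Sum>l\<in>UNIV. scale_poly (commutation_sign (l + m) h) (\<Sum>k\<in>UNIV. mvar k l))"
    by (simp add: scale_poly_add_left sum.distrib scale_poly_sum)
      (rule sum.swap)
  also have "\<dots> = (\<Sum>k\<in>UNIV. scale_poly (commutation_sign k h) ((\<Sum>l\<in>UNIV. mvar k l) - 1))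
      + (\<Sum>l\<in>UNIV. scale_poly (commutation_sign (l + m) h) ((\<Sum>k\<in>UNIV. mvar k l) - 1))"
  proof -
    have "(\<Sum>k\<in>UNIV. scale_poly (commutation_sign k h) 1) = (0 :: 4 ncpoly)"
      using h by (simp add: sum_commutation_sign scale_poly_0_left flip: scale_poly_sum_left)
    moreover have "(\<Sum>l\<in>UNIV. scale_poly (commutation_sign (l + m) h) 1) = (0 :: 4 ncpoly)"
      using h sum_UNIV_shift[of "\<lambda>l. commutation_sign l h" m]
      by (simp add: sum_commutation_sign scale_poly_0_left flip: scale_poly_sum_left)
    ultimately show ?thesis by (simp add: scale_poly_diff sum_subtractf)
  qed
  also have "\<dots> \<in> magic_ideal"
    by (intro magic_ideal_add magic_ideal_sum magic_ideal_scale mvar_relations)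
  finally have "scale_poly (1/8) (scale_poly 8 (quad m n + quad n m)) \<in> magic_ideal"
    by (rule magic_ideal_scale)
  then show ?thesis by (simp add: scale_poly_scale_poly scale_poly_one)
qed

lemma sum_quad_diag: "(\<Sum>g\<in>UNIV. quad g g) - 1 \<in> magic_ideal"
proof -
  have "(\<Sum>g\<in>UNIV. quad g g) = (\<Sum>k\<in>UNIV. \<Sum>g\<in>UNIV. scale_poly (1/4) (mvar k (k + g)))"
    by (simp add: quad_def add_self_pair scale_poly_one scale_poly_sum) (rule sum.swap)
  also have "\<dots> = (\<Sum>k\<in>UNIV. scale_poly (1/4) (\<Sum>l\<in>UNIV. mvar k l))"
    unfolding scale_poly_sum by (intro sum.cong refl sum_UNIV_shift_left)
  finally have "(\<Sum>g\<in>UNIV. quad g g) - 1 = (\<Sum>k\<in>UNIV. scale_poly (1/4) ((\<Sum>l\<in>UNIV. mvar k l) - 1))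
      + ((\<Sum>k\<in>(UNIV :: (2 \<times> 2) set). scale_poly (1/4) 1) - 1)"
    by (simp add: scale_poly_diff sum_subtractf)
  also have "(\<Sum>k\<in>(UNIV :: (2 \<times> 2) set). scale_poly (1/4) 1) - 1 = (0 :: 4 ncpoly)"
    unfolding scale_poly_sum_left[symmetric] by (simp add: scale_poly_one)
  finally show ?thesis
    by (simp only: add_0_right) (intro magic_ideal_sum magic_ideal_scale mvar_relations)
qed

lemma quad_mult:
  "quad k l * quad m n = scale_poly (1/16) (\<Sum>a\<in>UNIV. \<Sum>b\<in>UNIV.
    scale_poly (commutation_sign a (k + l) * commutation_sign b (m + n)) (mvar a (a + k) * mvar b (b + m)))"
  by (simp add: quad_def scale_poly_mult_left scale_poly_mult_right scale_poly_scale_poly sum_product mult.commute)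

text \<open>With the translation by the first pair undone, the products stand for
  \<open>q\<^sub>k q\<^sub>l q\<^sub>m q\<^sub>n\<close> and
  \<open>q\<^sub>k q\<^sub>m q\<^sub>l q\<^sub>n\<close>. Expand both in variables from rows
  \<open>a\<close> and \<open>b\<close>. If \<open>a = b\<close>, two columns of one row meet; if
  \<open>a + b = l + m\<close> with \<open>a \<noteq> b\<close>, two rows meet in one column;
  otherwise \<open>commutation_sign (a + b) (l + m) = - 1\<close> and the coefficients
  cancel.\<close>

lemma quad_exchange:
  assumes "l \<noteq> m"
  shows "quad k l * quad (k + l + m) (k + l + n) + quad k m * quad (k + m + l) (k + m + n) \<in> magic_ideal"
proof -
  have s: "k + l + m + (k + l + n) = m + n" "k + m + l + (k + m + n) = l + n"
    by (metis add.assoc add.commute add_self_left_pair)+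
  have eq: "quad k l * quad (k + l + m) (k + l + n) + quad k m * quad (k + m + l) (k + m + n)
    = scale_poly (1/16) (\<Sum>a\<in>UNIV. \<Sum>b\<in>UNIV. scale_poly
      (commutation_sign a (k + l) * commutation_sign b (m + n) + commutation_sign a (k + m) * commutation_sign b (l + n))
      (mvar a (a + k) * mvar b (b + (k + l + m))))"
    unfolding quad_mult s scale_poly_add[symmetric] sum.distrib[symmetric] scale_poly_add_left
    by (simp add: add_ac)
  have "scale_poly (commutation_sign a (k + l) * commutation_sign b (m + n)
      + commutation_sign a (k + m) * commutation_sign b (l + n)) (mvar a (a + k) * mvar b (b + (k + l + m)))
      \<in> magic_ideal" for a b
  proof -
    have lm: "l + m \<noteq> 0" using assms by (simp add: pair_add_eq_0)
    consider "a = b" | "a \<noteq> b" "a + b = l + m" | "a + b \<noteq> 0" "a + b \<noteq> l + m"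
      using pair_add_eq_0 by blast
    then show ?thesis
    proof cases
      case 1
      have "b + (k + l + m) \<noteq> b + k" using lm by (simp add: add.assoc)
      with 1 show ?thesis by (metis magic_ideal_scale mvar_row)
    next
      case 2
      have "b + (k + l + m) = b + (l + m) + k" by (simp add: add_ac)
      also have "\<dots> = a + k" unfolding 2(2)[symmetric] by (simp add: pair_add_cancel)
      finally have "b + (k + l + m) = a + k" .
      with 2(1) show ?thesis by (metis magic_ideal_scale mvar_col)
    next
      case 3
      have "commutation_sign (a + b) (l + m) = - 1"
        using 3 by (simp add: commutation_sign_eq[OF lm])
      then have e: "commutation_sign a l * commutation_sign a m * (commutation_sign b l * commutation_sign b m) = - 1"
        by (simp add: commutation_sign_add_left commutation_sign_add_right mult_ac)
      have "commutation_sign a (k + m) * commutation_sign b (l + n) = commutation_sign a k * commutation_sign b n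
          * (commutation_sign a l * commutation_sign a l) * commutation_sign a m
          * commutation_sign b l * (commutation_sign b m * commutation_sign b m)"
        by (simp add: commutation_sign_square commutation_sign_add_right)
      also have "\<dots> = (commutation_sign a (k + l) * commutation_sign b (m + n)) *
          (commutation_sign a l * commutation_sign a m * (commutation_sign b l * commutation_sign b m))"
        by (simp add: commutation_sign_add_right mult_ac)
      finally show ?thesis unfolding e by (simp add: scale_poly_0_left magic_ideal_0)
    qed
  qed
  then show ?thesis unfolding eq
    by - (rule magic_ideal_scale, rule magic_ideal_sum, rule magic_ideal_sum)
qed

text \<open>
  Multiplying by \<open>quad k l\<close> translates the indices of the remaining factors by \<open>k + l\<close>; the
  accumulator \<open>s\<close> keeps track of this, so that \<open>quad_word 0 w\<close> stands for the product of the \<open>q\<^sub>k\<close>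
  along \<open>w\<close>. Only words of even length matter, but the value \<open>0\<close> on the others keeps
  \<open>quad_word_swap\<close> unconditional.
\<close>

fun quad_word :: "2 \<times> 2 \<Rightarrow> (2 \<times> 2) list \<Rightarrow> 4 ncpoly"
  where "quad_word s [] = 1"
  | "quad_word s [k] = 0"
  | "quad_word s (k # l # w) = quad (s + k) (s + l) * quad_word (s + k + l) w"

text \<open>Signs can be left undetermined: they affect neither a span nor the vanishing of a
  coefficient.\<close>

definition sign_cong :: "4 ncpoly \<Rightarrow> 4 ncpoly \<Rightarrow> bool"
  where "sign_cong P Q \<longleftrightarrow> P - Q \<in> magic_ideal \<or> P + Q \<in> magic_ideal"

lemma sign_cong_refl [simp]: "sign_cong P P"
  by (simp add: sign_cong_def magic_ideal_0)

lemma sign_cong_trans: 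
  assumes "sign_cong P Q" "sign_cong Q R" shows "sign_cong P R"
proof -
  have "P - R = (P - Q) + (Q - R)" "P - R = (P + Q) - (Q + R)"
    "P + R = (P - Q) + (Q + R)" "P + R = (P + Q) - (Q - R)" by simp_all
  with assms magic_ideal_add magic_ideal_diff show ?thesis unfolding sign_cong_def by metis
qed

lemma sign_cong_mult_left: "sign_cong P Q \<Longrightarrow> sign_cong (R * P) (R * Q)"
  unfolding sign_cong_def by (metis distrib_left right_diff_distrib magic_ideal_mult_left)

lemma sign_cong_mult_right: "sign_cong P Q \<Longrightarrow> sign_cong (P * R) (Q * R)"
  unfolding sign_cong_def by (metis distrib_right left_diff_distrib magic_ideal_mult_right)

text \<open>The induction strips pairs of letters. A swap inside a pair is
  \<open>quad_commute\<close>; a swap across two pairs is \<open>quad_exchange\<close>, which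
  involves the letter after the swap. If that letter is missing, the word is odd and both sides are
  \<open>0\<close>.\<close>

lemma quad_word_swap: "sign_cong (quad_word s (u @ a # b # w)) (quad_word s (u @ b # a # w))"
proof (cases "a = b")
  case False
  show ?thesis
  proof (induction s u rule: quad_word.induct)
    case (1 s)
    have "sign_cong (quad (s + a) (s + b)) (quad (s + b) (s + a))"
      unfolding sign_cong_def using quad_commute[of "s + a" "s + b"] False by simp
    then show ?case by (simp add: sign_cong_mult_right add_ac)
  next
    case (2 s k)
    show ?case
    proof (cases w)
      case (Cons n w')
      have 1: "s + k + (s + x) = k + x" for x
        by (metis add.assoc add.commute add_self_left_pair)
      have "sign_cong (quad (s + k) (s + a) * quad (s + k + a + b) (s + k + a + n))
        (quad (s + k) (s + b) * quad (s + k + b + a) (s + k + b + n))"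
        using quad_exchange[of "s + a" "s + b" "s + k" "s + n"] False
        unfolding sign_cong_def 1 by (simp add: add_ac)
      from sign_cong_mult_right[OF this, of "quad_word (s + k + a + b + n) w'"]
      show ?thesis by (simp add: Cons mult.assoc add_ac)
    qed simp
  next
    case (3 s k l u)
    then show ?case by (simp add: sign_cong_mult_left)
  qed
qed simp

lemma quad_word_move: "sign_cong (quad_word s (p @ v @ a # w)) (quad_word s (p @ a # v @ w))"
proof (induction v arbitrary: w rule: rev_induct)
  case (snoc b v)
  have "sign_cong (quad_word s (p @ v @ b # a # w)) (quad_word s (p @ v @ a # b # w))"
    using quad_word_swap[of s "p @ v" b a w] by simp
  from sign_cong_trans[OF this snoc.IH[of "b # w"]] show ?case by simp
qed simp

lemma quad_word_mset_append:
  "mset u = mset v \<Longrightarrow> sign_cong (quad_word s (p @ u)) (quad_word s (p @ v))"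
proof (induction u arbitrary: p v)
  case (Cons a u)
  then have "a \<in> set v" by (metis list.set_intros(1) set_mset_mset)
  then obtain v1 v2 where v: "v = v1 @ a # v2" by (meson split_list)
  with Cons.prems have "mset u = mset (v1 @ v2)" by simp
  from Cons.IH[OF this, of "p @ [a]"]
  have "sign_cong (quad_word s (p @ a # u)) (quad_word s (p @ a # v1 @ v2))" by simp
  moreover have "sign_cong (quad_word s (p @ a # v1 @ v2)) (quad_word s (p @ v1 @ a # v2))"
    using quad_word_move[of s p v1 a v2] by (auto simp: sign_cong_def add.commute dest: magic_ideal_uminus)
  ultimately show ?case unfolding v by (rule sign_cong_trans)
qed simp

lemma quad_word_mset: "mset u = mset v \<Longrightarrow> sign_cong (quad_word s u) (quad_word s v)"
  using quad_word_mset_append[of u v s "[]"] by simp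

lemma quad_word_map: "even (length w) \<Longrightarrow> quad_word s (map ((+) t) w) = quad_word (s + t) w"
proof (induction s w rule: quad_word.induct)
  case (3 s k l w)
  have 1: "s + (t + k) + (t + l) = s + k + l"
    by (metis add.assoc add.commute add_self_left_pair)
  have 2: "s + t + k + l = s + k + l + t" by (simp add: add_ac)
  have "even (length w)" using 3(2) by simp
  from 3(1)[OF this] show ?case
    unfolding list.map quad_word.simps 1 2 by (simp add: add.assoc)
qed simp_all

lemma quad_mult_quad_word:
  assumes "even (length w)"
  shows "quad m n * quad_word 0 w = quad_word 0 (m # n # map ((+) (m + n)) w)"
  using quad_word_map[OF assms, of "m + n" "m + n"] by (simp add: add_self_pair add.assoc)

section \<open>Spanning by normal forms\<close>

interpretation ncp: vector_space "scale_poly :: complex \<Rightarrow> 4 ncpoly \<Rightarrow> 4 ncpoly"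
  by standard (simp_all add: scale_poly_add scale_poly_add_left scale_poly_scale_poly scale_poly_one)

text \<open>The relation \<open>q\<^sub>0\<^sup>2 = 1 - q\<^sub>1\<^sup>2 - q\<^sub>2\<^sup>2 - q\<^sub>3\<^sup>2\<close> eliminates squares of \<open>q\<^sub>0\<close>.\<close>

definition normal_mset :: "(2 \<times> 2) multiset set"
  where "normal_mset = {m. even (size m) \<and> count m 0 \<le> 1}"

text \<open>Any ordering serves: another one changes the value by at most a sign modulo the
  ideal.\<close>

definition quad_mset :: "(2 \<times> 2) multiset \<Rightarrow> 4 ncpoly"
  where "quad_mset m = quad_word 0 (SOME w. mset w = m)"

lemma quad_mset_cong: "sign_cong (quad_word 0 w) (quad_mset (mset w))"
  unfolding quad_mset_def by (rule quad_word_mset) (metis (mono_tags) someI)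

definition normal_span :: "4 ncpoly set"
  where "normal_span = ncp.span (magic_ideal \<union> quad_mset ` normal_mset)"

lemma magic_ideal_subset_normal_span: "magic_ideal \<subseteq> normal_span"
  unfolding normal_span_def using ncp.span_superset by blast

lemma normal_span_closed:
  shows normal_span_add: "P \<in> normal_span \<Longrightarrow> Q \<in> normal_span \<Longrightarrow> P + Q \<in> normal_span"
    and normal_span_diff: "P \<in> normal_span \<Longrightarrow> Q \<in> normal_span \<Longrightarrow> P - Q \<in> normal_span"
    and normal_span_scale: "P \<in> normal_span \<Longrightarrow> scale_poly c P \<in> normal_span"
    and normal_span_sum: "(\<And>i. i \<in> A \<Longrightarrow> f i \<in> normal_span) \<Longrightarrow> sum f A \<in> normal_span"
  unfolding normal_span_def by (fact ncp.span_add ncp.span_diff ncp.span_scale ncp.span_sum)+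

lemma normal_span_sign_cong:
  assumes "sign_cong P Q" "Q \<in> normal_span" shows "P \<in> normal_span"
proof -
  have "P = (P - Q) + Q" "P = (P + Q) - Q" by simp_all
  with assms show ?thesis
    unfolding sign_cong_def
    by (metis magic_ideal_subset_normal_span normal_span_add normal_span_diff subsetD)
qed

lemma quad_word_in_normal_span: "even (length w) \<Longrightarrow> quad_word 0 w \<in> normal_span"
proof (induction "count (mset w) 0" arbitrary: w rule: less_induct)
  case less
  show ?case
  proof (cases "count (mset w) 0 \<le> 1")
    case True
    then have "mset w \<in> normal_mset" using less.prems by (simp add: normal_mset_def)
    then have "quad_mset (mset w) \<in> normal_span"
      unfolding normal_span_def by (intro ncp.span_base) blast
    with quad_mset_cong show ?thesis by (rule normal_span_sign_cong)
  next
    case False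
    then have "{#0, 0#} \<subseteq># mset w"
      by (auto simp: subseteq_mset_def)
    then obtain m where "mset w = {#0, 0#} + m" by (meson mset_subset_eq_exists_conv)
    moreover obtain w' where "mset w' = m" using ex_mset by blast
    ultimately have w': "mset w = mset (0 # 0 # w')" by simp
    have len: "even (length w')"
      using less.prems w' by (metis even_Suc length_Cons size_mset)
    have "quad_word 0 w' \<in> normal_span" using w' len by (intro less.hyps) simp_all
    moreover have "quad g g * quad_word 0 w' \<in> normal_span" if "g \<noteq> 0" for g
    proof -
      have "quad_word 0 (g # g # w') \<in> normal_span"
        using w' len that by (intro less.hyps) simp_all
      then show ?thesis by (simp add: add_self_pair)
    qed
    \<comment> \<open>A square \<open>quad g g\<close> translates nothing, since
      \<open>g + g = 0\<close>. Hence it can be split off, and replacing \<open>quad 0 0\<close> by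
      1 minus the other squares leaves words with fewer letters \<open>0\<close>.\<close>
    moreover have "quad_word 0 (0 # 0 # w') = ((\<Sum>g\<in>UNIV. quad g g) - 1) * quad_word 0 w'
        + (quad_word 0 w' - (\<Sum>g\<in>UNIV - {0}. quad g g * quad_word 0 w'))"
      by (simp add: sum.remove[of UNIV 0] algebra_simps sum_distrib_right)
    moreover have "((\<Sum>g\<in>UNIV. quad g g) - 1) * quad_word 0 w' \<in> normal_span"
      using magic_ideal_mult_right[OF sum_quad_diag] magic_ideal_subset_normal_span by blast
    ultimately have "quad_word 0 (0 # 0 # w') \<in> normal_span"
      by (simp only:) (intro normal_span_add normal_span_diff normal_span_sum; simp)
    with quad_word_mset[OF w'] show ?thesis by (rule normal_span_sign_cong)
  qed
qed

lemma ncvar_mult_normal_span: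
  assumes "P \<in> normal_span" shows "ncvar i j * P \<in> normal_span"
  using assms unfolding normal_span_def
proof (induction rule: ncp.span_induct)
  case base
  show ?case
    unfolding ncp.subspace_def
    by (auto simp: distrib_left scale_poly_mult_right ncp.span_zero intro: ncp.span_add ncp.span_scale)
next
  case (step P)
  then consider "P \<in> magic_ideal" | m where "P = quad_mset m" "m \<in> normal_mset" by blast
  then have "ncvar i j * P \<in> normal_span"
  proof cases
    case 1
    then show ?thesis using magic_ideal_mult_left magic_ideal_subset_normal_span by blast
  next
    case 2
    define w where "w = (SOME w. mset w = m)"
    have "mset w = m" unfolding w_def by (rule someI_ex) (rule ex_mset)
    with 2(2) have "even (length w)" by (auto simp: normal_mset_def)
    moreover have "P = quad_word 0 w" by (simp add: 2 quad_mset_def w_def)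
    moreover obtain k l where "ncvar i j = mvar k l" using mvar_surj by blast
    ultimately show ?thesis
      by (simp only: mvar_eq_sum_quad sum_distrib_right scale_poly_mult_left quad_mult_quad_word)
        (intro normal_span_sum normal_span_scale quad_word_in_normal_span; simp)
  qed
  then show ?case by (simp add: normal_span_def)
qed

text \<open>The span contains 1, the empty word, and is stable under left multiplication by the
  generators.\<close>

lemma normal_span_UNIV: "P \<in> normal_span"
proof -
  have "monomial (Word ls) \<in> normal_span" for ls
  proof (induction ls)
    case Nil
    have "monomial (Word []) = quad_word 0 []" by (simp flip: zero_word_def)
    then show ?case using quad_word_in_normal_span[of "[]"] by simp
  next
    case (Cons a ls)
    obtain i j where "a = (i, j)" by (cases a)
    then have "monomial (Word (a # ls)) = ncvar i j * monomial (Word ls)"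
      by (simp add: ncvar_def mult_single plus_word_def)
    with Cons show ?case by (simp add: ncvar_mult_normal_span)
  qed
  then have single: "Poly_Mapping.single w c \<in> normal_span" for w c
    using normal_span_scale[of "monomial w" c] by (cases w) (simp add: scale_poly_single)
  show ?thesis
  proof (induction P rule: poly_mapping_single_induct)
    case 1
    show ?case using magic_ideal_0 magic_ideal_subset_normal_span by blast
  qed (intro normal_span_add single)
qed

lemma normal_form:
  obtains x A c where "x \<in> magic_ideal" "finite A" "A \<subseteq> normal_mset"
    "P = x + (\<Sum>m\<in>A. scale_poly (c m) (quad_mset m))"
proof -
  have "ncp.subspace magic_ideal"
    by (simp add: ncp.subspace_def magic_ideal_0 magic_ideal_add magic_ideal_scale)
  then have "ncp.span magic_ideal = magic_ideal" by (simp add: ncp.span_eq_iff)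
  with normal_span_UNIV[of P] obtain x y where xy: "x \<in> magic_ideal" "y \<in> ncp.span (quad_mset ` normal_mset)"
    "P = x + y"
    unfolding normal_span_def ncp.span_Un by auto
  then obtain t r where t: "finite t" "t \<subseteq> quad_mset ` normal_mset" "y = (\<Sum>a\<in>t. scale_poly (r a) a)"
    unfolding ncp.span_explicit by blast
  \<comment> \<open>Distinct multisets are not yet known to give distinct polynomials; restricting
    to a set on which \<open>quad_mset\<close> is injective lets multisets index the
    coefficients.\<close>
  then obtain A where A: "A \<subseteq> normal_mset" "inj_on quad_mset A" "t = quad_mset ` A"
    unfolding subset_image_inj by blast
  show thesis
  proof
    show "finite A" using A t(1) by (simp add: finite_image_iff)
    show "P = x + (\<Sum>m\<in>A. scale_poly (r (quad_mset m)) (quad_mset m))"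
      by (simp add: xy(3) t(3) A(3) sum.reindex[OF A(2)])
  qed (use xy A in auto)
qed

section \<open>Independence of the normal forms\<close>

definition euler_rep ::
  "(two_proj_cstar3 \<Rightarrow> complex^(2 \<times> 2 \<times> 2) \<Rightarrow> complex^(2 \<times> 2 \<times> 2)) \<Rightarrow> (2 \<times> 2 \<Rightarrow> complex) \<Rightarrow> bool"
  where "euler_rep \<theta> q \<longleftrightarrow> star_rep \<theta> \<and> (\<forall>k g t. \<theta> (M_matrix $ index4 k $ colindex4 (k + g)) (xi t)
    = (\<Sum>h\<in>UNIV. (commutation_sign k h * cocycle_sign g h * q (t + g) * q (t + g + h)) *s xi (t + h)))"

lemma real_unit_2:
  assumes "a\<^sup>2 + b\<^sup>2 = (1::real)"
  shows "real_unit (\<lambda>i::2. complex_of_real (if i = 0 then a else b))"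
  using assms by (simp add: real_unit_def sum_UNIV_2 flip: of_real_power of_real_add)

text \<open>Hopf coordinates on the three-sphere: the two pairs of coordinates are put in polar
  form, and their radii form the unit vector \<open>v\<close>.\<close>

lemma euler_rep_exists:
  fixes q :: "2 \<times> 2 \<Rightarrow> real"
  assumes "(\<Sum>g\<in>UNIV. (q g)\<^sup>2) = 1"
  obtains \<theta> where "euler_rep \<theta> (\<lambda>g. complex_of_real (q g))"
proof -
  obtain r0 \<alpha> where q0: "q (0, 0) = r0 * cos \<alpha>" "q (0, 1) = r0 * sin \<alpha>" using polar_Ex by blast
  obtain r1 \<beta> where q1: "q (1, 0) = r1 * cos \<beta>" "q (1, 1) = r1 * sin \<beta>" using polar_Ex by blast
  have "(r0 * cos \<alpha>)\<^sup>2 + (r0 * sin \<alpha>)\<^sup>2 = r0\<^sup>2" "(r1 * cos \<beta>)\<^sup>2 + (r1 * sin \<beta>)\<^sup>2 = r1\<^sup>2"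
    by (simp_all add: power_mult_distrib flip: distrib_left)
  then have r: "r0\<^sup>2 + r1\<^sup>2 = 1"
    using assms unfolding sum_UNIV_prod sum_UNIV_2 q0 q1 by simp
  \<comment> \<open>The addition theorems turn \<open>euler_quaternion\<close> into functions of
    \<open>y - x\<close> and \<open>x + y\<close>, which have to be \<open>\<alpha>\<close> and
    \<open>\<beta>\<close>.\<close>
  define x where "x = (\<beta> - \<alpha>) / 2"
  define y where "y = (\<beta> + \<alpha>) / 2"
  have xy: "\<alpha> = y - x" "\<beta> = x + y" by (simp_all add: x_def y_def field_simps)
  define u where "u i = complex_of_real (if i = 0 then cos x else sin x)" for i :: 2
  define v where "v i = complex_of_real (if i = 0 then r0 else r1)" for i :: 2
  define w where "w i = complex_of_real (if i = 0 then cos y else sin y)" for i :: 2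
  have "real_unit u" "real_unit v" "real_unit w"
    unfolding u_def v_def w_def by (rule real_unit_2; simp add: r)+
  then obtain \<theta> where \<theta>: "star_rep \<theta>" "\<And>a b c d e f x. \<theta> (proj_entry a b \<otimes> proj_entry c d \<otimes> proj_entry e f) x
      = slot1.slot (proj_matrix u a b) (slot2.slot (proj_matrix v c d) (slot3.slot (proj_matrix w e f) x))"
    by (rule three_slot_rep) (rule that)
  have "euler_quaternion u v w = (\<lambda>g. complex_of_real (q g))"
  proof
    fix g :: "2 \<times> 2"
    obtain g1 g2 where g: "g = (g1, g2)" by (cases g)
    show "euler_quaternion u v w g = complex_of_real (q g)"
      unfolding g
      by (cases g1 rule: cases_2; cases g2 rule: cases_2)
        (simp_all add: euler_quaternion_def u_def v_def w_def q0 q1 xy cos_diff sin_diff cos_add sin_add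
          algebra_simps)
  qed
  then have "euler_rep \<theta> (\<lambda>g. complex_of_real (q g))"
    unfolding euler_rep_def using M_matrix_xi[OF \<theta>] \<theta>(1) by simp
  then show thesis by (rule that)
qed

lemma euler_rep_quad:
  assumes "euler_rep \<theta> q"
  shows "\<theta> (nceval M_matrix (quad m n)) (xi t)
    = (cocycle_sign m (m + n) * q (t + m) * q (t + n)) *s xi (t + m + n)"
proof -
  have \<theta>: "star_rep \<theta>" and M: "\<And>k g t. \<theta> (M_matrix $ index4 k $ colindex4 (k + g)) (xi t)
    = (\<Sum>h\<in>UNIV. (commutation_sign k h * cocycle_sign g h * q (t + g) * q (t + g + h)) *s xi (t + h))"
    using assms unfolding euler_rep_def by blast+
  let ?d = "\<lambda>h. cocycle_sign m h * q (t + m) * q (t + m + h)"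
  have "\<theta> (nceval M_matrix (quad m n)) (xi t)
    = (\<Sum>k\<in>UNIV. \<Sum>h\<in>UNIV. (1/4 * commutation_sign k (m + n) * (commutation_sign k h * ?d h)) *s xi (t + h))"
    by (simp add: quad_def mvar_def nceval_scale_poly nceval_sum nceval_ncvar star_rep_sum[OF \<theta>] star_repD(2)[OF \<theta>] M
        vec.scale_sum_right vector_smult_assoc mult.assoc)
  also have "\<dots> = (\<Sum>h\<in>UNIV. (1/4 * (\<Sum>k\<in>UNIV. commutation_sign k (m + n + h)) * ?d h) *s xi (t + h))"
    by (subst sum.swap)
      (simp add: commutation_sign_add_right sum_distrib_left sum_distrib_right vec.scale_sum_left mult.assoc)
  also have "\<dots> = (\<Sum>h\<in>UNIV. if h = m + n then ?d h *s xi (t + h) else 0)"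
    by (intro sum.cong refl) (auto simp: sum_commutation_sign pair_add_eq_0)
  also have "\<dots> = (cocycle_sign m (m + n) * q (t + m) * q (t + n)) *s xi (t + m + n)"
    by (simp add: add.assoc add_self_left_pair)
  finally show ?thesis .
qed

text \<open>The constant \<open>\<delta>\<close>, a product of cocycle signs, is chosen before
  \<open>\<theta>\<close> and \<open>q\<close>, so it is the same at every point of the sphere. The
  rightmost factors act first and move the base point; this combines with the accumulator
  \<open>s\<close> to one common translation of all letters.\<close>

lemma euler_rep_quad_word:
  assumes "even (length w)"
  shows "\<exists>\<delta>. \<delta> \<noteq> 0 \<and> (\<forall>\<theta> q. euler_rep \<theta> q \<longrightarrow> \<theta> (nceval M_matrix (quad_word s w)) (xi t)
    = (\<delta> * (\<Prod>g\<in>#mset w. q (t + sum_list w + s + g))) *s xi (t + sum_list w))"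
  using assms
proof (induction s w rule: quad_word.induct)
  case (1 s)
  show ?case
    by (rule exI[of _ 1]) (auto simp: euler_rep_def nceval_1 star_repD(4))
next
  case (3 s k l w)
  then obtain \<delta> where \<delta>: "\<delta> \<noteq> 0" "\<And>\<theta> q. euler_rep \<theta> q \<Longrightarrow> \<theta> (nceval M_matrix (quad_word (s + k + l) w)) (xi t)
    = (\<delta> * (\<Prod>g\<in>#mset w. q (t + sum_list w + (s + k + l) + g))) *s xi (t + sum_list w)"
    by auto
  let ?c = "cocycle_sign (s + k) (s + k + (s + l))"
  have "?c \<noteq> 0" by (simp add: cocycle_sign_def parity_sign_def)
  moreover have "\<theta> (nceval M_matrix (quad_word s (k # l # w))) (xi t)
    = (\<delta> * ?c * (\<Prod>g\<in>#mset (k # l # w). q (t + sum_list (k # l # w) + s + g))) *s xi (t + sum_list (k # l # w))"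
    if e: "euler_rep \<theta> q" for \<theta> q
  proof -
    have \<theta>: "star_rep \<theta>" using e by (simp add: euler_rep_def)
    have eqs: "t + sum_list w + (s + k) + (s + l) = t + sum_list (k # l # w)"
      "t + sum_list w + (s + k) = t + sum_list (k # l # w) + s + l"
      "t + sum_list w + (s + l) = t + sum_list (k # l # w) + s + k"
      "t + sum_list w + (s + k + l) = t + sum_list (k # l # w) + s"
      unfolding sum_list.Cons
      by (simp_all add: add_ac add_self_left_pair)
    show ?thesis
      unfolding quad_word.simps nceval_mult star_repD(3)[OF \<theta>] \<delta>(2)[OF e]
        complex_linear_simps(2)[OF star_repD(5)[OF \<theta>]] euler_rep_quad[OF e] vector_smult_assoc eqs(1)
      unfolding eqs(2-)
      by (simp add: mult_ac)
  qed
  ultimately show ?case using \<delta>(1) by (intro exI[of _ "\<delta> * ?c"]) simp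
qed simp

section \<open>Monomials as functions on the sphere\<close>

definition mset_monomial :: "('v \<Rightarrow> complex) \<Rightarrow> 'v multiset \<Rightarrow> complex"
  where "mset_monomial y m = (\<Prod>g\<in>#m. y g)"

lemma mset_monomial_split:
  "mset_monomial y m = y a ^ count m a * mset_monomial y {#g \<in># m. g \<noteq> a#}"
proof -
  have "m = replicate_mset (count m a) a + {#g \<in># m. g \<noteq> a#}"
    by (rule multiset_eqI) (auto simp: count_filter_mset)
  then have "mset_monomial y m = mset_monomial y (replicate_mset (count m a) a + {#g \<in># m. g \<noteq> a#})"
    by simp
  then show ?thesis by (simp add: mset_monomial_def)
qed

lemma mset_eq_filter_add_replicate:
  "count m a = i \<Longrightarrow> m = {#g \<in># m. g \<noteq> a#} + replicate_mset i a"
  by (rule multiset_eqI) auto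

text \<open>Deleting all copies of \<open>a\<close> is injective on multisets that contain exactly
  \<open>i\<close> of them.\<close>

lemma sum_filter_mset:
  assumes "\<And>m. m \<in> B \<Longrightarrow> count m a = i"
  shows "(\<Sum>m\<in>B. c m * f {#g \<in># m. g \<noteq> a#})
    = (\<Sum>m\<in>filter_mset (\<lambda>g. g \<noteq> a) ` B. c (m + replicate_mset i a) * f m)"
proof -
  have eq: "{#g \<in># m. g \<noteq> a#} + replicate_mset i a = m" if "m \<in> B" for m
    by (rule mset_eq_filter_add_replicate[symmetric]) (rule assms[OF that])
  have "inj_on (filter_mset (\<lambda>g. g \<noteq> a)) B"
  proof (rule inj_onI)
    fix m m' assume "m \<in> B" "m' \<in> B" and e: "{#g \<in># m. g \<noteq> a#} = {#g \<in># m'. g \<noteq> a#}"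
    then show "m = m'" using eq[of m] eq[of m'] unfolding e by simp
  qed
  then show ?thesis by (simp add: sum.reindex eq)
qed

lemma mset_monomial_upd: "a \<notin># m \<Longrightarrow> mset_monomial (y(a := z)) m = mset_monomial y m"
  unfolding mset_monomial_def by (rule arg_cong[where f = prod_mset], rule image_mset_cong) auto

text \<open>Induction on the variables: with the others fixed, the sum is a polynomial in the value
  at \<open>a\<close> with infinitely many roots. The bound \<open>1/2\<close> is chosen for the
  sphere: three squares of at most \<open>1/4\<close> leave room for a nonzero fourth
  coordinate.\<close>

lemma mset_monomials_independent:
  fixes c :: "'v multiset \<Rightarrow> complex"
  assumes "finite V" "finite A" "\<And>m. m \<in> A \<Longrightarrow> set_mset m \<subseteq> V"
    and "\<And>y :: 'v \<Rightarrow> real. (\<And>g. \<bar>y g\<bar> \<le> 1/2) \<Longrightarrow> (\<Sum>m\<in>A. c m * mset_monomial (\<lambda>g. of_real (y g)) m) = 0"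
    and "m \<in> A"
  shows "c m = 0"
  using assms
proof (induction V arbitrary: A c m rule: finite_induct)
  case empty
  then have "A = {{#}}" "m = {#}" by auto
  with empty.prems(3)[of "\<lambda>_. 0"] show ?case by (simp add: mset_monomial_def)
next
  case (insert a V)
  let ?F = "filter_mset (\<lambda>g. g \<noteq> a)"
  define i where "i = count m a"
  define B where "B = {m \<in> A. count m a = i}"
  define N where "N = Max ((\<lambda>m. count m a) ` A)"
  have N: "count m a \<le> N" if "m \<in> A" for m using that insert.prems(1) by (simp add: N_def)
  have zero: "(\<Sum>m\<in>B. c m * mset_monomial (\<lambda>g. of_real (y g)) (?F m)) = 0"
    if y: "\<And>g. \<bar>y g\<bar> \<le> 1/2" for y :: "'v \<Rightarrow> real"
  proof (rule ccontr)
    let ?Y = "\<lambda>g. complex_of_real (y g)"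
    define d where "d j = (\<Sum>m\<in>{m \<in> A. count m a = j}. c m * mset_monomial ?Y (?F m))" for j
    assume "(\<Sum>m\<in>B. c m * mset_monomial ?Y (?F m)) \<noteq> 0"
    then have "d i \<noteq> 0" by (simp add: d_def B_def)
    then have fin: "finite {x. (\<Sum>j\<le>N. d j * x ^ j) = 0}"
      using N[OF insert.prems(4)] unfolding polyfun_finite_roots i_def by blast
    have "(\<Sum>j\<le>N. d j * of_real x ^ j) = 0" if "x \<in> {0..1/2}" for x :: real
    proof -
      have "(\<Sum>j\<le>N. d j * of_real x ^ j)
          = (\<Sum>j\<in>{..N}. \<Sum>m\<in>{m \<in> A. count m a = j}. of_real x ^ count m a * (c m * mset_monomial ?Y (?F m)))"
        by (simp add: d_def sum_distrib_left sum_distrib_right mult.commute)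
      also have "\<dots> = (\<Sum>m\<in>A. of_real x ^ count m a * (c m * mset_monomial ?Y (?F m)))"
        by (rule sum.group) (use N insert.prems(1) in auto)
      also have "\<dots> = (\<Sum>m\<in>A. c m * mset_monomial (\<lambda>g. of_real ((y(a := x)) g)) m)"
      proof (rule sum.cong[OF refl])
        fix m
        have "(\<lambda>g. complex_of_real ((y(a := x)) g)) = ?Y(a := of_real x)" by auto
        then show "of_real x ^ count m a * (c m * mset_monomial ?Y (?F m))
          = c m * mset_monomial (\<lambda>g. of_real ((y(a := x)) g)) m"
          by (subst mset_monomial_split[of _ _ a]) (simp add: mset_monomial_upd)
      qed
      also have "\<dots> = 0"
        by (rule insert.prems(3)) (use y that in auto)
      finally show ?thesis .
    qed
    then have "complex_of_real ` {0..1/2} \<subseteq> {x. (\<Sum>j\<le>N. d j * x ^ j) = 0}" by auto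
    then have "finite (complex_of_real ` {0..1/2})" using fin finite_subset by blast
    then have "finite {0..1/2::real}" by (rule finite_imageD) (simp add: inj_on_def)
    then show False using infinite_Icc[of 0 "1/2 :: real"] by simp
  qed
  have "c (?F m + replicate_mset i a) = 0"
  proof (rule insert.IH[of "?F ` B" "\<lambda>m. c (m + replicate_mset i a)"])
    show "finite (?F ` B)" using insert.prems(1) by (simp add: B_def)
    show "set_mset m' \<subseteq> V" if "m' \<in> ?F ` B" for m'
      using that insert.prems(2) by (fastforce simp: B_def)
    show "?F m \<in> ?F ` B" using insert.prems(4) by (simp add: B_def i_def)
    show "(\<Sum>m\<in>?F ` B. c (m + replicate_mset i a) * mset_monomial (\<lambda>g. of_real (y g)) m) = 0"
      if "\<And>g. \<bar>y g\<bar> \<le> 1/2" for y :: "'v \<Rightarrow> real"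
      using zero[OF that] sum_filter_mset[of B a i c "mset_monomial (\<lambda>g. of_real (y g))"]
      by (simp add: B_def)
  qed
  then show ?case using mset_eq_filter_add_replicate[of m a i] by (simp add: i_def)
qed

text \<open>Over a point of the small cube in the three coordinates other than \<open>0\<close>, the
  sphere has the two points with coordinate \<open>sqrt (1 - e)\<close> and its negative. Adding and
  subtracting their equations separates degrees 0 and 1 in that coordinate.\<close>

lemma sphere_monomials_independent:
  fixes c :: "(2 \<times> 2) multiset \<Rightarrow> complex"
  assumes A: "finite A" "\<And>m. m \<in> A \<Longrightarrow> count m 0 \<le> 1"
    and zero: "\<And>q :: 2 \<times> 2 \<Rightarrow> real. (\<Sum>g\<in>UNIV. (q g)\<^sup>2) = 1 \<Longrightarrow>
      (\<Sum>m\<in>A. c m * mset_monomial (\<lambda>g. of_real (q g)) m) = 0"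
    and m: "m \<in> A"
  shows "c m = 0"
proof -
  let ?F = "filter_mset (\<lambda>g. g \<noteq> (0 :: 2 \<times> 2))"
  define B where "B i = {m \<in> A. count m 0 = i}" for i
  have vanish: "(\<Sum>m\<in>B i. c m * mset_monomial (\<lambda>g. of_real (y g)) (?F m)) = 0"
    if y: "\<And>g. \<bar>y g\<bar> \<le> 1/2" and i: "i \<le> 1" for i and y :: "2 \<times> 2 \<Rightarrow> real"
  proof -
    let ?Y = "\<lambda>g. complex_of_real (y g)"
    define S where "S i = (\<Sum>m\<in>B i. c m * mset_monomial ?Y (?F m))" for i
    define e where "e = (\<Sum>g\<in>UNIV - {0}. (y g)\<^sup>2)"
    have sq: "(y g)\<^sup>2 \<le> 1/4" for g
      using power_mono[OF y[of g] abs_ge_zero, of 2] by (simp add: power2_eq_square)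
    have "e \<le> (\<Sum>g\<in>UNIV - {0 :: 2 \<times> 2}. 1/4)" unfolding e_def by (rule sum_mono) (rule sq)
    then have e: "e < 1" by (simp add: card_Diff_singleton)
    have *: "S 0 + of_real r * S 1 = 0" if r: "r\<^sup>2 = 1 - e" for r :: real
    proof -
      let ?q = "y(0 := r)"
      have "(\<Sum>g\<in>UNIV. (?q g)\<^sup>2) = 1"
        by (simp add: sum.remove[of UNIV 0] r e_def)
      from zero[OF this] have "0 = (\<Sum>m\<in>A. c m * mset_monomial (\<lambda>g. of_real (?q g)) m)" by simp
      also have "(\<lambda>g. complex_of_real (?q g)) = ?Y(0 := of_real r)" by auto
      also have "(\<Sum>m\<in>A. c m * mset_monomial (?Y(0 := of_real r)) m)
        = (\<Sum>m\<in>A. of_real r ^ count m 0 * (c m * mset_monomial ?Y (?F m)))"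
        by (rule sum.cong[OF refl], subst mset_monomial_split[of _ _ 0]) (simp add: mset_monomial_upd)
      also have "\<dots> = (\<Sum>i\<in>{0, 1}. \<Sum>m\<in>B i. of_real r ^ count m 0 * (c m * mset_monomial ?Y (?F m)))"
        unfolding B_def
      proof (rule sum.group[symmetric])
        show "(\<lambda>m. count m 0) ` A \<subseteq> {0, 1}"
        proof (rule image_subsetI)
          fix m assume "m \<in> A"
          from A(2)[OF this] show "count m 0 \<in> {0, 1}" by (cases "count m 0") auto
        qed
      qed (use A(1) in auto)
      also have "\<dots> = S 0 + of_real r * S 1"
        by (simp add: S_def B_def sum_distrib_left)
      finally show ?thesis by simp
    qed
    have "S 0 + of_real (sqrt (1 - e)) * S 1 = 0" "S 0 - of_real (sqrt (1 - e)) * S 1 = 0"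
      using *[of "sqrt (1 - e)"] *[of "- sqrt (1 - e)"] e by simp_all
    then have "S 0 = 0 \<and> of_real (sqrt (1 - e)) * S 1 = 0" by (simp add: add_eq_0_iff)
    moreover have "complex_of_real (sqrt (1 - e)) \<noteq> 0" using e by simp
    ultimately have "S 0 = 0" "S 1 = 0" by simp_all
    with i show ?thesis by (auto simp: S_def le_Suc_eq)
  qed
  define i where "i = count m 0"
  have "c (?F m + replicate_mset i 0) = 0"
  proof (rule mset_monomials_independent[of UNIV "?F ` B i" "\<lambda>m. c (m + replicate_mset i 0)"])
    show "finite (?F ` B i)" using A(1) by (simp add: B_def)
    show "?F m \<in> ?F ` B i" using m by (simp add: B_def i_def)
    show "(\<Sum>m\<in>?F ` B i. c (m + replicate_mset i 0) * mset_monomial (\<lambda>g. of_real (y g)) m) = 0"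
      if "\<And>g. \<bar>y g\<bar> \<le> 1/2" for y :: "2 \<times> 2 \<Rightarrow> real"
      using vanish[OF that, of i] A(2)[OF m] sum_filter_mset[of "B i" 0 i c "mset_monomial (\<lambda>g. of_real (y g))"]
      by (simp add: B_def i_def)
  qed simp_all
  then show ?thesis using mset_eq_filter_add_replicate[of m 0 i] by (simp add: i_def)
qed

text \<open>Reading coordinate \<open>0\<close> selects a degree: an operator moving
  \<open>xi t\<close> into the line of \<open>xi (t + s)\<close> is seen only for
  \<open>t = s\<close>.\<close>

lemma xi_nth_0: "xi t $ 0 = (if t = 0 then 1 else 0)"
  by (auto simp: xi_def zero_prod_def)

lemma nceval_M_matrix_eq_0:
  assumes "nceval M_matrix P = 0"
  shows "P \<in> magic_ideal"
proof -
  obtain x A c where x: "x \<in> magic_ideal" and A: "finite A" "A \<subseteq> normal_mset"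
    and P: "P = x + (\<Sum>m\<in>A. scale_poly (c m) (quad_mset m))"
    by (rule normal_form)
  \<comment> \<open>For \<open>t = sum_mset m\<close> the translation of the letters cancels as
    well, so the plain monomial at \<open>q\<close> appears.\<close>
  have "\<exists>\<delta>. \<delta> \<noteq> 0 \<and> (\<forall>\<theta> q t. euler_rep \<theta> q \<longrightarrow> \<theta> (nceval M_matrix (quad_mset m)) (xi t) $ 0
      = (if sum_mset m = t then \<delta> * mset_monomial q m else 0))"
    if "m \<in> A" for m
  proof -
    define w where "w = (SOME w. mset w = m)"
    have w: "mset w = m" unfolding w_def by (rule someI_ex) (rule ex_mset)
    then have len: "even (length w)" and s: "sum_list w = sum_mset m"
      using that A(2) by (auto simp: normal_mset_def sum_mset_sum_list)
    have Q: "quad_mset m = quad_word 0 w" by (simp add: quad_mset_def w_def)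
    note eval = euler_rep_quad_word[OF len, of 0, folded Q, unfolded s w]
    obtain \<delta> where \<delta>: "\<delta> \<noteq> 0" "\<And>\<theta> q. euler_rep \<theta> q \<Longrightarrow> \<theta> (nceval M_matrix (quad_mset m)) (xi (sum_mset m))
        = (\<delta> * (\<Prod>g\<in>#m. q (sum_mset m + sum_mset m + 0 + g))) *s xi (sum_mset m + sum_mset m)"
      using eval[of "sum_mset m"] by blast
    have "\<theta> (nceval M_matrix (quad_mset m)) (xi t) $ 0 = (if sum_mset m = t then \<delta> * mset_monomial q m else 0)"
      if e: "euler_rep \<theta> q" for \<theta> q t
    proof (cases "sum_mset m = t")
      case True
      then show ?thesis
        using \<delta>(2)[OF e] by (simp add: xi_nth_0 add_self_pair mset_monomial_def)
    next
      case False
      obtain \<delta>' where "\<theta> (nceval M_matrix (quad_mset m)) (xi t)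
        = (\<delta>' * (\<Prod>g\<in>#m. q (t + sum_mset m + 0 + g))) *s xi (t + sum_mset m)"
        using eval[of t] e by blast
      moreover have "t + sum_mset m \<noteq> 0" using False pair_add_eq_0[of t "sum_mset m"] by blast
      ultimately show ?thesis using False by (simp add: xi_nth_0)
    qed
    with \<delta>(1) show ?thesis by blast
  qed
  then have "\<forall>m\<in>A. \<exists>\<delta>. \<delta> \<noteq> 0 \<and> (\<forall>\<theta> q t. euler_rep \<theta> q \<longrightarrow> \<theta> (nceval M_matrix (quad_mset m)) (xi t) $ 0
      = (if sum_mset m = t then \<delta> * mset_monomial q m else 0))"
    by blast
  from bchoice[OF this] obtain \<delta> where \<delta>: "\<And>m. m \<in> A \<Longrightarrow> \<delta> m \<noteq> 0"
    "\<And>m \<theta> q t. m \<in> A \<Longrightarrow> euler_rep \<theta> q \<Longrightarrow> \<theta> (nceval M_matrix (quad_mset m)) (xi t) $ 0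
      = (if sum_mset m = t then \<delta> m * mset_monomial q m else 0)"
    by blast
  have "c m = 0" if m: "m \<in> A" for m
  proof -
    \<comment> \<open>Starting at \<open>xi t\<close> isolates the monomials whose letters add up to
      \<open>t\<close>; independence is applied to each such class separately.\<close>
    define t where "t = sum_mset m"
    define B where "B = {m \<in> A. sum_mset m = t}"
    have "c m * \<delta> m = 0"
    proof (rule sphere_monomials_independent[of B])
      show "m \<in> B" "finite B" using m A(1) by (simp_all add: B_def t_def)
      show "count m' 0 \<le> 1" if "m' \<in> B" for m' using that A(2) by (auto simp: B_def normal_mset_def)
      fix q :: "2 \<times> 2 \<Rightarrow> real" assume "(\<Sum>g\<in>UNIV. (q g)\<^sup>2) = 1"
      then obtain \<theta> where \<theta>: "euler_rep \<theta> (\<lambda>g. complex_of_real (q g))" by (rule euler_rep_exists)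
      then have rep: "star_rep \<theta>" by (simp add: euler_rep_def)
      have "0 = \<theta> (nceval M_matrix P) (xi t) $ 0" by (simp add: assms star_rep_0[OF rep])
      also have "\<dots> = (\<Sum>m\<in>A. c m * \<theta> (nceval M_matrix (quad_mset m)) (xi t) $ 0)"
        by (simp add: P nceval_add nceval_sum nceval_scale_poly nceval_magic_ideal[OF x] star_rep_sum[OF rep]
            star_repD(2)[OF rep])
      also have "\<dots> = (\<Sum>m\<in>A. if sum_mset m = t then c m * \<delta> m * mset_monomial (\<lambda>g. of_real (q g)) m else 0)"
        using \<delta>(2)[OF _ \<theta>] by (intro sum.cong refl) auto
      also have "\<dots> = (\<Sum>m\<in>B. c m * \<delta> m * mset_monomial (\<lambda>g. of_real (q g)) m)"
        unfolding B_def by (rule sum.inter_filter[symmetric, OF A(1)])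
      finally show "(\<Sum>m\<in>B. c m * \<delta> m * mset_monomial (\<lambda>g. of_real (q g)) m) = 0" ..
    qed
    with \<delta>(1)[OF m] show ?thesis by simp
  qed
  then have "P = x" by (simp add: P scale_poly_0_left)
  with x show ?thesis by simp
qed

theorem theorem3p3:
  shows "\<not> (\<exists>P :: 4 ncpoly. separating M_matrix P \<and> ncdegree P \<le> 50)"
  using nceval_M_matrix_eq_0 by (auto simp: separating_def)

end
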